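(* For every fixed real constant $\alpha>1$, there is a quantum sample algorithm that estimates $\mathrm{T}_\alpha(\rho_0,\rho_1)$ to within additive error $\epsilon$ by using $$O\left(\frac{1}{\epsilon^{3\alpha+2+\frac{2}{\alpha-1}}}\log^2\left(\frac1\epsilon\right)\right)$$ samples of $n$-qubit quantum states $\rho_0$ and $\rho_1$, and $$O\left(\frac{n}{\epsilon^{3\alpha+2+\frac{2}{\alpha-1}}}\log^2\left(\frac1\epsilon\right)\right)$$ one- and two-qubit gates.
   Context: $\mathrm{T}_\alpha(\rho_0,\rho_1)=\frac12\big(\mathrm{tr}(|\rho_0-\rho_1|^\alpha)\big)^{1/\alpha}$, with $|A|=(A^\dagger A)^{1/2}$. A quantum sample algorithm is a quantum algorithm given independent copies (samples) of the unknown states $\rho_0$ and $\rho_1$; its sample complexity is the number of copies used. The output is within the stated error with probability at least $2/3$. The constants in $O(\cdot)$ depend only on $\alpha$, and the bounds are understood for sufficiently small $\epsilon>0$. *)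

theory Defs
  imports "Jordan_Normal_Form.Schur_Decomposition"
begin

section \<open>Matrices and functional calculus\<close>

definition mat_trace :: "complex mat \<Rightarrow> complex" where
  "mat_trace A = (\<Sum>i<dim_row A. A $$ (i, i))"

definition unitary_mat :: "nat \<Rightarrow> complex mat \<Rightarrow> bool" where
  "unitary_mat d U \<longleftrightarrow>
     U \<in> carrier_mat d d \<and> mat_adjoint U * U = 1\<^sub>m d \<and> U * mat_adjoint U = 1\<^sub>m d"

text \<open>The comparison below is the order on the complex numbers: the quadratic form is
  real and nonnegative. In particular such a matrix is Hermitian.\<close>

definition psd_mat :: "nat \<Rightarrow> complex mat \<Rightarrow> bool" where
  "psd_mat d A \<longleftrightarrow>
     A \<in> carrier_mat d d \<and> (\<forall>v\<in>carrier_vec d. 0 \<le> (A *\<^sub>v v) \<bullet>c v)"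

definition density_mat :: "nat \<Rightarrow> complex mat \<Rightarrow> bool" where
  "density_mat d \<rho> \<longleftrightarrow> psd_mat d \<rho> \<and> mat_trace \<rho> = 1"

definition is_mat_fun :: "(real \<Rightarrow> real) \<Rightarrow> complex mat \<Rightarrow> complex mat \<Rightarrow> bool" where
  "is_mat_fun f A B \<longleftrightarrow>
     (\<exists>U e. unitary_mat (dim_row A) U \<and>
        A = U * mat_diag (dim_row A) (\<lambda>i. complex_of_real (e i)) * mat_adjoint U \<and>
        B = U * mat_diag (dim_row A) (\<lambda>i. complex_of_real (f (e i))) * mat_adjoint U)"

text \<open>\<open>mat_fun f A\<close> is \<open>f(A)\<close> for Hermitian \<open>A\<close>, i.e. \<open>f\<close> applied to the eigenvalues of
  \<open>A\<close>. Independence of the chosen diagonalisation is lemma \<open>is_mat_fun_unique\<close>; for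
  matrices that are not Hermitian the value is unspecified.\<close>

definition mat_fun :: "(real \<Rightarrow> real) \<Rightarrow> complex mat \<Rightarrow> complex mat" where
  "mat_fun f A = (THE B. is_mat_fun f A B)"

lemma mat_adjoint_carrier:
  assumes "(U :: complex mat) \<in> carrier_mat d d"
  shows "mat_adjoint U \<in> carrier_mat d d"
  using assms by (auto simp: mat_adjoint_def mat_of_rows_def)

lemma is_mat_fun_unique:
  assumes "is_mat_fun f A B" "is_mat_fun f A B'"
  shows "B = B'"
proof -
  define d where "d = dim_row A"
  obtain U e where U: "unitary_mat d U"
    and A1: "A = U * mat_diag d (\<lambda>i. complex_of_real (e i)) * mat_adjoint U"
    and B1: "B = U * mat_diag d (\<lambda>i. complex_of_real (f (e i))) * mat_adjoint U"
    using assms(1)[unfolded is_mat_fun_def, folded d_def] by (elim exE conjE) (rule that)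
  obtain V e' where V: "unitary_mat d V"
    and A2: "A = V * mat_diag d (\<lambda>i. complex_of_real (e' i)) * mat_adjoint V"
    and B2: "B' = V * mat_diag d (\<lambda>i. complex_of_real (f (e' i))) * mat_adjoint V"
    using assms(2)[unfolded is_mat_fun_def, folded d_def] by (elim exE conjE) (rule that)
  let ?D = "mat_diag d (\<lambda>i. complex_of_real (e i))"
  let ?D' = "mat_diag d (\<lambda>i. complex_of_real (e' i))"
  let ?F = "mat_diag d (\<lambda>i. complex_of_real (f (e i)))"
  let ?F' = "mat_diag d (\<lambda>i. complex_of_real (f (e' i)))"
  define W where "W = mat_adjoint V * U"
  note [simp] = mat_diag_dim
  have Uc: "U \<in> carrier_mat d d" and Vc: "V \<in> carrier_mat d d"
    and UU: "mat_adjoint U * U = 1\<^sub>m d" "U * mat_adjoint U = 1\<^sub>m d"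
    and VV: "mat_adjoint V * V = 1\<^sub>m d" "V * mat_adjoint V = 1\<^sub>m d"
    using U V unfolding unitary_mat_def by auto
  have Ua: "mat_adjoint U \<in> carrier_mat d d" and Va: "mat_adjoint V \<in> carrier_mat d d"
    using Uc Vc mat_adjoint_carrier by auto
  have Wc: "W \<in> carrier_mat d d" using Va Uc unfolding W_def by auto
  have Dc: "?D \<in> carrier_mat d d" "?D' \<in> carrier_mat d d" "?F \<in> carrier_mat d d"
    "?F' \<in> carrier_mat d d" by auto
  have left: "mat_adjoint V * (U * X * mat_adjoint U) * U = W * X"
    if X: "X \<in> carrier_mat d d" for X
  proof -
    have "mat_adjoint V * (U * X * mat_adjoint U) * U
        = mat_adjoint V * (U * X * mat_adjoint U * U)"
      by (rule assoc_mult_mat[OF Va mult_carrier_mat[OF mult_carrier_mat[OF Uc X] Ua] Uc])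
    also have "U * X * mat_adjoint U * U = U * X * (mat_adjoint U * U)"
      by (rule assoc_mult_mat[OF mult_carrier_mat[OF Uc X] Ua Uc])
    also have "\<dots> = U * X" using UU Uc X by simp
    finally show ?thesis using assoc_mult_mat[OF Va Uc X] by (simp add: W_def)
  qed
  have right: "mat_adjoint V * (V * X * mat_adjoint V) * U = X * W"
    if X: "X \<in> carrier_mat d d" for X
  proof -
    have "mat_adjoint V * (V * X * mat_adjoint V) = mat_adjoint V * V * X * mat_adjoint V"
      using assoc_mult_mat[OF Va mult_carrier_mat[OF Vc X] Va] assoc_mult_mat[OF Va Vc X] by simp
    also have "\<dots> = X * mat_adjoint V" using VV X by simp
    finally show ?thesis using assoc_mult_mat[OF X Va Uc] by (simp add: W_def)
  qed
  have WD: "W * ?D = ?D' * W"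
    using left[OF Dc(1)] right[OF Dc(2)] unfolding A1[symmetric] A2[symmetric] by simp
  have ent: "W $$ (i,j) * complex_of_real (e j) = complex_of_real (e' i) * W $$ (i,j)"
    if "i < d" "j < d" for i j
    using arg_cong[OF WD, of "\<lambda>M. M $$ (i,j)"] that
    by (simp add: mat_diag_mult_left[OF Wc] mat_diag_mult_right[OF Wc])
  have WF: "W * ?F = ?F' * W"
  proof (rule eq_matI)
    fix i j assume "i < dim_row (?F' * W)" "j < dim_col (?F' * W)"
    hence ij: "i < d" "j < d" using Wc by (auto simp: mat_diag_def)
    have "W $$ (i,j) = 0 \<or> e j = e' i" using ent[OF ij] by auto
    thus "(W * ?F) $$ (i,j) = (?F' * W) $$ (i,j)"
      using ij by (auto simp: mat_diag_mult_left[OF Wc] mat_diag_mult_right[OF Wc])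
  qed (use Wc in \<open>auto simp: mat_diag_def\<close>)
  have undo: "V * (mat_adjoint V * X * U) * mat_adjoint U = X"
    if X: "X \<in> carrier_mat d d" for X
  proof -
    have "V * (mat_adjoint V * X * U) * mat_adjoint U
        = V * (mat_adjoint V * X * U * mat_adjoint U)"
      by (rule assoc_mult_mat[OF Vc mult_carrier_mat[OF mult_carrier_mat[OF Va X] Uc] Ua])
    also have "mat_adjoint V * X * U * mat_adjoint U = mat_adjoint V * X * (U * mat_adjoint U)"
      by (rule assoc_mult_mat[OF mult_carrier_mat[OF Va X] Uc Ua])
    also have "\<dots> = mat_adjoint V * X" using UU Va X by simp
    also have "V * (mat_adjoint V * X) = V * mat_adjoint V * X"
      using assoc_mult_mat[OF Vc Va X] by simp
    finally show ?thesis using VV X by simp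
  qed
  have Bc: "B \<in> carrier_mat d d" "B' \<in> carrier_mat d d"
    unfolding B1 B2 using mult_carrier_mat[OF mult_carrier_mat[OF Uc Dc(3)] Ua]
      mult_carrier_mat[OF mult_carrier_mat[OF Vc Dc(4)] Va] by auto
  have eq: "mat_adjoint V * B * U = mat_adjoint V * B' * U"
    using left[OF Dc(3)] right[OF Dc(4)] WF unfolding B1[symmetric] B2[symmetric] by simp
  show ?thesis by (rule trans[OF undo[OF Bc(1), symmetric, unfolded eq] undo[OF Bc(2)]])
qed

lemma mat_fun_eqI: "is_mat_fun f A B \<Longrightarrow> mat_fun f A = B"
  unfolding mat_fun_def using is_mat_fun_unique by blast

definition mat_abs :: "complex mat \<Rightarrow> complex mat" where
  "mat_abs A = mat_fun sqrt (mat_adjoint A * A)"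

definition mat_powr :: "complex mat \<Rightarrow> real \<Rightarrow> complex mat" where
  "mat_powr A a = mat_fun (\<lambda>x. x powr a) A"

text \<open>The trace in question is a nonnegative real; \<open>Re\<close> only adjusts the type.\<close>

definition l_distance :: "real \<Rightarrow> complex mat \<Rightarrow> complex mat \<Rightarrow> real" where
  "l_distance a \<rho>\<^sub>0 \<rho>\<^sub>1 =
     1/2 * (Re (mat_trace (mat_powr (mat_abs (\<rho>\<^sub>0 - \<rho>\<^sub>1)) a))) powr (1/a)"


section \<open>Quantum circuits acting on samples\<close>

definition kron :: "complex mat \<Rightarrow> complex mat \<Rightarrow> complex mat" where
  "kron A B = Matrix.mat (dim_row A * dim_row B) (dim_col A * dim_col B)
     (\<lambda>(i, j). A $$ (i div dim_row B, j div dim_col B) * B $$ (i mod dim_row B, j mod dim_col B))"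

fun kron_pow :: "complex mat \<Rightarrow> nat \<Rightarrow> complex mat" where
  "kron_pow A 0 = 1\<^sub>m 1"
| "kron_pow A (Suc k) = kron A (kron_pow A k)"

definition ket0_proj :: "complex mat" where
  "ket0_proj = Matrix.mat 2 2 (\<lambda>(i, j). if i = 0 \<and> j = 0 then 1 else 0)"

text \<open>The computational basis of \<open>N\<close> qubits is indexed by the numbers below \<open>2 ^ N\<close>; qubit
  \<open>q\<close> is binary digit \<open>q\<close> of the index, so the rightmost tensor factor consists of the
  qubits with the smallest numbers. In \<open>Gate2 p q U\<close>, qubit \<open>p\<close> is the left tensor
  factor of \<open>U\<close>.\<close>

datatype gate = Gate1 nat "complex mat" | Gate2 nat nat "complex mat"

fun valid_gate :: "nat \<Rightarrow> gate \<Rightarrow> bool" where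
  "valid_gate N (Gate1 q U) \<longleftrightarrow> q < N \<and> unitary_mat 2 U"
| "valid_gate N (Gate2 p q U) \<longleftrightarrow> p < N \<and> q < N \<and> p \<noteq> q \<and> unitary_mat 4 U"

fun gate_mat :: "nat \<Rightarrow> gate \<Rightarrow> complex mat" where
  "gate_mat N (Gate1 q U) = Matrix.mat (2 ^ N) (2 ^ N) (\<lambda>(i, j).
     if \<forall>k<N. k \<noteq> q \<longrightarrow> bit i k = bit j k
     then U $$ (of_bool (bit i q), of_bool (bit j q)) else 0)"
| "gate_mat N (Gate2 p q U) = Matrix.mat (2 ^ N) (2 ^ N) (\<lambda>(i, j).
     if \<forall>k<N. k \<noteq> p \<and> k \<noteq> q \<longrightarrow> bit i k = bit j k
     then U $$ (2 * of_bool (bit i p) + of_bool (bit i q),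
                2 * of_bool (bit j p) + of_bool (bit j q)) else 0)"

fun run_gates :: "nat \<Rightarrow> gate list \<Rightarrow> complex mat \<Rightarrow> complex mat" where
  "run_gates N [] \<sigma> = \<sigma>"
| "run_gates N (g # gs) \<sigma> = run_gates N gs (gate_mat N g * \<sigma> * mat_adjoint (gate_mat N g))"

text \<open>An algorithm, for a fixed number \<open>n\<close> of qubits per sample, receives \<open>copies0\<close> copies
  of the first and \<open>copies1\<close> copies of the second state together with \<open>ancillas\<close> qubits in
  state \<open>|0>\<close>, applies its gates in order, measures all qubits in the computational basis
  and outputs the real number that \<open>estimate\<close> assigns to the outcome. It has no other
  access to the states.\<close>

record sample_algorithm =
  copies0 :: nat
  copies1 :: nat
  ancillas :: nat
  gates :: "gate list"
  estimate :: "nat \<Rightarrow> real"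

definition num_qubits :: "nat \<Rightarrow> sample_algorithm \<Rightarrow> nat" where
  "num_qubits n Q = n * copies0 Q + n * copies1 Q + ancillas Q"

definition valid_algorithm :: "nat \<Rightarrow> sample_algorithm \<Rightarrow> bool" where
  "valid_algorithm n Q \<longleftrightarrow> (\<forall>g\<in>set (gates Q). valid_gate (num_qubits n Q) g)"

definition sample_count :: "sample_algorithm \<Rightarrow> nat" where
  "sample_count Q = copies0 Q + copies1 Q"

definition gate_count :: "sample_algorithm \<Rightarrow> nat" where
  "gate_count Q = length (gates Q)"

definition initial_state :: "sample_algorithm \<Rightarrow> complex mat \<Rightarrow> complex mat \<Rightarrow> complex mat" where
  "initial_state Q \<rho>\<^sub>0 \<rho>\<^sub>1 =
     kron (kron (kron_pow \<rho>\<^sub>0 (copies0 Q)) (kron_pow \<rho>\<^sub>1 (copies1 Q)))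
          (kron_pow ket0_proj (ancillas Q))"

definition final_state ::
    "nat \<Rightarrow> sample_algorithm \<Rightarrow> complex mat \<Rightarrow> complex mat \<Rightarrow> complex mat" where
  "final_state n Q \<rho>\<^sub>0 \<rho>\<^sub>1 =
     run_gates (num_qubits n Q) (gates Q) (initial_state Q \<rho>\<^sub>0 \<rho>\<^sub>1)"

text \<open>Born rule: outcome \<open>x\<close> has probability equal to the diagonal entry at \<open>x\<close>.\<close>

definition output_prob ::
    "nat \<Rightarrow> sample_algorithm \<Rightarrow> complex mat \<Rightarrow> complex mat \<Rightarrow> (real \<Rightarrow> bool) \<Rightarrow> real" where
  "output_prob n Q \<rho>\<^sub>0 \<rho>\<^sub>1 P =
     (\<Sum>x | x < 2 ^ num_qubits n Q \<and> P (estimate Q x). Re (final_state n Q \<rho>\<^sub>0 \<rho>\<^sub>1 $$ (x, x)))"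

definition estimates_l_distance :: "real \<Rightarrow> nat \<Rightarrow> real \<Rightarrow> sample_algorithm \<Rightarrow> bool" where
  "estimates_l_distance a n \<epsilon> Q \<longleftrightarrow>
     (\<forall>\<rho>\<^sub>0 \<rho>\<^sub>1. density_mat (2 ^ n) \<rho>\<^sub>0 \<longrightarrow> density_mat (2 ^ n) \<rho>\<^sub>1 \<longrightarrow>
        output_prob n Q \<rho>\<^sub>0 \<rho>\<^sub>1 (\<lambda>y. \<bar>y - l_distance a \<rho>\<^sub>0 \<rho>\<^sub>1\<bar> \<le> \<epsilon>) \<ge> 2/3)"

end

theory Submission
  imports Defs "HOL-Analysis.Analysis" "HOL-Library.Nat_Bijection"
begin

text \<open>Let \<open>l\<^sub>k\<close> be the eigenvalues of \<open>\<rho>0 - \<rho>1\<close> and \<open>f(x) = sgn x \<cdot> |x|\<^sup>\<alpha>\<^sup>-\<^sup>1\<close>, so that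
  \<open>\<Sum>|l\<^sub>k|\<^sup>\<alpha> = \<Sum> l\<^sub>k f(l\<^sub>k)\<close>. One copy of each state, consumed by a controlled superposition of
  swaps with a third register, multiplies that register by \<open>cos \<theta> + \<i> sin \<theta> (\<rho>0 - \<rho>1) / 2\<close>
  inside a Hadamard test. A test of this kind with angles \<open>\<theta>\<^sub>1, \<dots>, \<theta>\<^sub>M\<close> on a copy of \<open>\<rho>0\<close>, minus the
  same test on a copy of \<open>\<rho>1\<close>, has expectation
  \<open>\<Sum> l\<^sub>k Re (\<zeta> \<Prod>\<^sub>j (cos \<theta>\<^sub>j + \<i> sin \<theta>\<^sub>j l\<^sub>k / 2))\<close>.

  These products approximate \<open>(x/2)\<^sup>q e\<^sup>i\<^sup>\<omega>\<^sup>x\<close> for \<open>q \<in> {0, p}\<close>. Writing \<open>f\<close> as an integral of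
  powers of \<open>sinc\<close> shows that, up to error \<open>\<delta>\<close> and a constant factor, it lies in the closed convex
  hull of such functions with \<open>|\<omega>| = O(\<delta>\<^sup>-\<^sup>1\<^sup>/\<^sup>(\<^sup>\<alpha>\<^sup>-\<^sup>1\<^sup>))\<close>, and by a derandomised Maurey argument
  \<open>O(log(1/\<delta>)/\<delta>\<^sup>2)\<close> of them suffice for a uniform approximation by an average. With
  \<open>\<delta> = \<Theta>(\<epsilon>\<^sup>\<alpha>)\<close>, running each of the two tests once per member of the average and applying
  Chebyshev's inequality gives the estimate.\<close>

section \<open>Configurations and kernels\<close>

text \<open>The exponents arise as follows. The root of order \<alpha> is Hoelder continuous with
  exponent 1/\<alpha>, so the power sum is needed to accuracy \<epsilon>^\<alpha>. A product of m
  rotations imitates a character of frequency \<omega> up to O(\<omega>^2/m), so the truncation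
  frequency enters squared and m is of order \<delta>^(-1-2/(\<alpha>-1)). Multiplying by the number
  of tests gives the stated power, because \<alpha>(3 + 2/(\<alpha>-1)) = 3\<alpha> + 2 +
  2/(\<alpha>-1). The obstacle is that an algorithm here is one fixed circuit with a single final
  measurement: frequencies cannot be drawn at random and registers cannot be discarded. Randomness
  is replaced by a list of frequencies fixed in advance; up to a logarithm it is as long as the
  repetitions that Chebyshev's inequality demands anyway, so one run per member serves both
  purposes. Discarding is replaced by giving every swap fresh copies and tracing them out in the
  analysis.\<close>

text \<open>A basis state is identified with the set of qubits that are 1, and a matrix with a kernel on
  such sets; tensor products then become products of kernels of intersections.\<close>

definition conf :: "nat \<Rightarrow> nat set" where
  "conf x = {k. bit x k}"

lemma bit_set_encode: "finite X \<Longrightarrow> bit (set_encode X) k \<longleftrightarrow> k \<in> X"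
  using set_encode_inverse[of X] by (auto simp: set_decode_def bit_iff_odd)

lemma conf_set_encode: "finite X \<Longrightarrow> conf (set_encode X) = X"
  by (auto simp: conf_def bit_set_encode)

lemma conf_less_iff: "x < 2 ^ N \<longleftrightarrow> conf x \<subseteq> {..<N}"
proof
  assume "x < 2 ^ N"
  hence "take_bit N x = x" by (simp add: take_bit_nat_eq_self)
  thus "conf x \<subseteq> {..<N}" by (metis bit_take_bit_iff conf_def lessThan_iff mem_Collect_eq subsetI)
next
  assume *: "conf x \<subseteq> {..<N}"
  have "take_bit N x = x"
    by (rule bit_eqI) (use * in \<open>auto simp: conf_def bit_take_bit_iff\<close>)
  thus "x < 2 ^ N" by (metis take_bit_nat_less_exp)
qed

lemma inj_conf: "conf x = conf y \<Longrightarrow> x = y"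
  by (rule bit_eqI) (auto simp: conf_def set_eq_iff)

lemma bij_betw_conf: "bij_betw conf {..<2 ^ N} (Pow {..<N})"
proof (rule bij_betw_imageI)
  show "inj_on conf {..<2 ^ N}" by (auto intro: inj_onI inj_conf)
  show "conf ` {..<2 ^ N} = Pow {..<N}"
  proof (intro equalityI subsetI)
    fix X assume "X \<in> Pow {..<N}"
    hence "finite X" "X \<subseteq> {..<N}" by (auto intro: finite_subset)
    hence "X = conf (set_encode X)" "set_encode X < 2 ^ N"
      by (auto simp: conf_set_encode conf_less_iff)
    thus "X \<in> conf ` {..<2 ^ N}" by auto
  qed (auto simp: conf_less_iff)
qed

lemma sum_conf: "(\<Sum>x<2 ^ N. f (conf x)) = (\<Sum>X\<in>Pow {..<N}. f X)"
  by (rule sum.reindex_bij_betw[OF bij_betw_conf])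

lemma sum_Pow_Un:
  assumes "finite A" "finite B" "A \<inter> B = {}"
  shows "(\<Sum>X\<in>Pow (A \<union> B). f X) = (\<Sum>X\<in>Pow A. \<Sum>Y\<in>Pow B. f (X \<union> Y))"
proof -
  have "(\<Sum>X\<in>Pow A. \<Sum>Y\<in>Pow B. f (X \<union> Y)) = (\<Sum>(X, Y)\<in>Pow A \<times> Pow B. f (X \<union> Y))"
    by (simp add: sum.cartesian_product)
  also have "\<dots> = (\<Sum>X\<in>Pow (A \<union> B). f X)"
    by (rule sum.reindex_bij_witness[of _ "\<lambda>X. (X \<inter> A, X \<inter> B)" "\<lambda>(X, Y). X \<union> Y"])
      (use assms in auto)
  finally show ?thesis ..
qed

lemma sum_Pow_insert:
  assumes "finite A" "a \<notin> A"
  shows "(\<Sum>X\<in>Pow (insert a A). f X) = (\<Sum>X\<in>Pow A. f X + f (insert a X))"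
  using sum_Pow_Un[of A "{a}" f] assms by (simp add: Pow_insert add.commute)

section \<open>Gates as local operators on wave functions and kernels\<close>

fun gate_qubits :: "gate \<Rightarrow> nat set" where
  "gate_qubits (Gate1 q U) = {q}"
| "gate_qubits (Gate2 p q U) = {p, q}"

fun gate_entry :: "gate \<Rightarrow> nat set \<Rightarrow> nat set \<Rightarrow> complex" where
  "gate_entry (Gate1 q U) X Y = U $$ (of_bool (q \<in> X), of_bool (q \<in> Y))"
| "gate_entry (Gate2 p q U) X Y =
     U $$ (2 * of_bool (p \<in> X) + of_bool (q \<in> X), 2 * of_bool (p \<in> Y) + of_bool (q \<in> Y))"

text \<open>The number of qubits does not enter. The same gates can therefore be analysed on the
  whole register and on the qubits of a single test.\<close>

definition vec_act :: "gate \<Rightarrow> (nat set \<Rightarrow> complex) \<Rightarrow> nat set \<Rightarrow> complex" where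
  "vec_act g \<psi> X = (\<Sum>Z\<in>Pow (gate_qubits g). gate_entry g X Z * \<psi> (X - gate_qubits g \<union> Z))"

text \<open>This is G s followed by the adjoint of G. Conjugating before and after lets
  \<open>vec_act\<close> also perform the action on the second argument, so no adjoint gate has to
  be introduced.\<close>

definition ker_act :: "gate \<Rightarrow> (nat set \<Rightarrow> nat set \<Rightarrow> complex) \<Rightarrow> nat set \<Rightarrow> nat set \<Rightarrow> complex" where
  "ker_act g s X Y = vec_act g (\<lambda>X'. cnj (vec_act g (\<lambda>Y'. cnj (s X' Y')) Y)) X"

definition vec_acts :: "gate list \<Rightarrow> (nat set \<Rightarrow> complex) \<Rightarrow> nat set \<Rightarrow> complex" where
  "vec_acts gs \<psi> = fold vec_act gs \<psi>"

definition ker_acts :: "gate list \<Rightarrow> (nat set \<Rightarrow> nat set \<Rightarrow> complex) \<Rightarrow> nat set \<Rightarrow> nat set \<Rightarrow> complex" where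
  "ker_acts gs s = fold ker_act gs s"

lemma vec_acts_simps [simp]:
  "vec_acts [] \<psi> = \<psi>" "vec_acts (g # gs) \<psi> = vec_acts gs (vec_act g \<psi>)"
  "vec_acts (gs @ hs) \<psi> = vec_acts hs (vec_acts gs \<psi>)"
  by (simp_all add: vec_acts_def)

lemma ker_acts_simps [simp]:
  "ker_acts [] s = s" "ker_acts (g # gs) s = ker_acts gs (ker_act g s)"
  "ker_acts (gs @ hs) s = ker_acts hs (ker_acts gs s)"
  by (simp_all add: ker_acts_def)

lemma finite_gate_qubits [simp]: "finite (gate_qubits g)"
  by (cases g) auto

lemma ker_act_eq: "ker_act g s X Y =
  (\<Sum>Z\<in>Pow (gate_qubits g). \<Sum>W\<in>Pow (gate_qubits g).
     gate_entry g X Z * cnj (gate_entry g Y W) * s (X - gate_qubits g \<union> Z) (Y - gate_qubits g \<union> W))"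
  by (simp add: ker_act_def vec_act_def sum_distrib_left mult_ac)

lemma mat_adjoint_dim [simp]: "dim_row (mat_adjoint A) = dim_col A" "dim_col (mat_adjoint A) = dim_row A"
  by (auto simp: mat_adjoint_def mat_of_rows_def)

lemma mat_adjoint_index [simp]:
  "i < dim_col A \<Longrightarrow> j < dim_row A \<Longrightarrow> mat_adjoint (A :: complex mat) $$ (i, j) = cnj (A $$ (j, i))"
  by (simp add: mat_adjoint_def mat_of_rows_def)

definition represents :: "nat \<Rightarrow> complex mat \<Rightarrow> (nat set \<Rightarrow> nat set \<Rightarrow> complex) \<Rightarrow> bool" where
  "represents N M s \<longleftrightarrow> M \<in> carrier_mat (2 ^ N) (2 ^ N) \<and>
     (\<forall>x<2 ^ N. \<forall>y<2 ^ N. M $$ (x, y) = s (conf x) (conf y))"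

lemma gate_mat_carrier [simp]: "gate_mat N g \<in> carrier_mat (2 ^ N) (2 ^ N)"
  by (cases g) auto

lemma gate_mat_dim [simp]: "dim_row (gate_mat N g) = 2 ^ N" "dim_col (gate_mat N g) = 2 ^ N"
  by (cases g; simp)+

lemma gate_mat_index:
  assumes "x < 2 ^ N" "y < 2 ^ N"
  shows "gate_mat N g $$ (x, y) =
    (if conf x - gate_qubits g = conf y - gate_qubits g then gate_entry g (conf x) (conf y) else 0)"
proof -
  have *: "(\<forall>k<N. k \<notin> S \<longrightarrow> bit x k = bit y k) \<longleftrightarrow> conf x - S = conf y - S" for S
    using assms[unfolded conf_less_iff] by (auto simp: conf_def set_eq_iff)
  show ?thesis
    using assms *[of "gate_qubits g"] by (cases g) (auto simp: conf_def)
qed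

lemma gate_mat_sum:
  assumes "x < 2 ^ N" "gate_qubits g \<subseteq> {..<N}"
  shows "(\<Sum>i<2 ^ N. gate_mat N g $$ (x, i) * f (conf i)) = vec_act g f (conf x)"
proof -
  let ?S = "gate_qubits g"
  have "(\<Sum>i<2 ^ N. gate_mat N g $$ (x, i) * f (conf i)) =
    (\<Sum>i<2 ^ N. (\<lambda>I. if conf x - ?S = I - ?S then gate_entry g (conf x) I * f I else 0) (conf i))"
    by (rule sum.cong) (use assms in \<open>auto simp: gate_mat_index\<close>)
  also have "\<dots> = (\<Sum>I\<in>Pow {..<N}. if conf x - ?S = I - ?S then gate_entry g (conf x) I * f I else 0)"
    by (rule sum_conf)
  also have "\<dots> = (\<Sum>I\<in>{I \<in> Pow {..<N}. conf x - ?S = I - ?S}. gate_entry g (conf x) I * f I)"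
    by (rule sum.inter_filter[symmetric]) auto
  also have "\<dots> = (\<Sum>Z\<in>Pow ?S. gate_entry g (conf x) (conf x - ?S \<union> Z) * f (conf x - ?S \<union> Z))"
    by (rule sum.reindex_bij_witness[of _ "\<lambda>Z. conf x - ?S \<union> Z" "\<lambda>I. I \<inter> ?S"])
      (use assms[unfolded conf_less_iff] in \<open>auto simp: Un_Diff Un_Diff_Int\<close>)
  also have "\<dots> = vec_act g f (conf x)"
    unfolding vec_act_def by (rule sum.cong) (cases g; auto)+
  finally show ?thesis .
qed

lemma valid_gate_qubits: "valid_gate N g \<Longrightarrow> gate_qubits g \<subseteq> {..<N}"
  by (cases g) auto

lemma represents_gate:
  assumes "represents N M s" "gate_qubits g \<subseteq> {..<N}"
  shows "represents N (gate_mat N g * M * mat_adjoint (gate_mat N g)) (ker_act g s)"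
proof -
  let ?G = "gate_mat N g"
  have M: "M \<in> carrier_mat (2 ^ N) (2 ^ N)"
    and s: "\<And>x y. x < 2 ^ N \<Longrightarrow> y < 2 ^ N \<Longrightarrow> M $$ (x, y) = s (conf x) (conf y)"
    using assms(1) by (auto simp: represents_def)
  have GM: "?G * M \<in> carrier_mat (2 ^ N) (2 ^ N)" by (rule mult_carrier_mat[OF gate_mat_carrier M])
  have adj: "mat_adjoint ?G \<in> carrier_mat (2 ^ N) (2 ^ N)" by (rule mat_adjoint_carrier) simp
  have 1: "(?G * M) $$ (x, y) = vec_act g (\<lambda>X. s X (conf y)) (conf x)" if "x < 2 ^ N" "y < 2 ^ N" for x y
  proof -
    have "(?G * M) $$ (x, y) = (\<Sum>i<2 ^ N. ?G $$ (x, i) * s (conf i) (conf y))"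
      using that M s by (auto simp: scalar_prod_def lessThan_atLeast0 intro!: sum.cong)
    thus ?thesis using gate_mat_sum[OF that(1) assms(2), of "\<lambda>X. s X (conf y)"] by simp
  qed
  have 2: "(?G * M * mat_adjoint ?G) $$ (x, y) = ker_act g s (conf x) (conf y)" if xy: "x < 2 ^ N" "y < 2 ^ N" for x y
  proof -
    have "(?G * M * mat_adjoint ?G) $$ (x, y) = (\<Sum>i<2 ^ N. (?G * M) $$ (x, i) * mat_adjoint ?G $$ (i, y))"
      using xy M adj by (subst index_mult_mat) (auto simp: scalar_prod_def lessThan_atLeast0 intro!: sum.cong)
    also have "\<dots> = (\<Sum>i<2 ^ N. vec_act g (\<lambda>X. s X (conf i)) (conf x) * cnj (?G $$ (y, i)))"
      using xy by (intro sum.cong) (auto simp: 1)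
    also have "\<dots> = cnj (\<Sum>i<2 ^ N. ?G $$ (y, i) * cnj (vec_act g (\<lambda>X. s X (conf i)) (conf x)))"
      by (simp add: mult_ac)
    also have "\<dots> = cnj (vec_act g (\<lambda>Y. cnj (vec_act g (\<lambda>X. s X Y) (conf x))) (conf y))"
      using gate_mat_sum[OF xy(2) assms(2), of "\<lambda>Y. cnj (vec_act g (\<lambda>X. s X Y) (conf x))"] by simp
    also have "\<dots> = ker_act g s (conf x) (conf y)"
      unfolding ker_act_eq vec_act_def
      by (simp add: sum_distrib_left mult_ac) (rule sum.swap)
    finally show ?thesis .
  qed
  show ?thesis unfolding represents_def using GM adj 2 by auto
qed

lemma represents_run_gates:
  assumes "represents N M s" "\<And>g. g \<in> set gs \<Longrightarrow> gate_qubits g \<subseteq> {..<N}"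
  shows "represents N (run_gates N gs M) (ker_acts gs s)"
  using assms
proof (induction gs arbitrary: M s)
  case (Cons g gs)
  show ?case using Cons.IH[OF represents_gate[OF Cons.prems(1)]] Cons.prems(2) by simp
qed auto

text \<open>This is orthonormality of the columns of U. In the two-qubit case \<open>k\<close>
  translates subsets of the gate's qubits into column numbers, injectively because
  \<open>p \<noteq> q\<close>.\<close>

lemma gate_entry_unitary:
  assumes "valid_gate N g" "Z \<subseteq> gate_qubits g" "W \<subseteq> gate_qubits g"
  shows "(\<Sum>A\<in>Pow (gate_qubits g). gate_entry g A Z * cnj (gate_entry g A W)) = (if Z = W then 1 else 0)"
proof (cases g)
  case (Gate1 q U)
  have U: "U \<in> carrier_mat 2 2" and UU: "mat_adjoint U * U = 1\<^sub>m 2"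
    using assms(1) Gate1 by (auto simp: unitary_mat_def)
  have *: "cnj (U $$ (0, i)) * U $$ (0, j) + cnj (U $$ (1, i)) * U $$ (1, j) = (if i = j then 1 else 0)"
    if "i < 2" "j < 2" for i j
    using arg_cong[OF UU, of "\<lambda>M. M $$ (i, j)"] that U
    by (auto simp: scalar_prod_def numeral_2_eq_2)
  show ?thesis
    using assms(2,3) *[of 0 0] *[of 0 1] *[of 1 0] *[of 1 1]
    by (auto simp: Gate1 sum_Pow_insert subset_singleton_iff mult_ac add_ac)
next
  case (Gate2 p q U)
  have U: "U \<in> carrier_mat 4 4" and UU: "mat_adjoint U * U = 1\<^sub>m 4" and pq: "p \<noteq> q"
    using assms(1) Gate2 by (auto simp: unitary_mat_def)
  have *: "cnj (U $$ (0, i)) * U $$ (0, j) + cnj (U $$ (1, i)) * U $$ (1, j)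
      + cnj (U $$ (2, i)) * U $$ (2, j) + cnj (U $$ (3, i)) * U $$ (3, j) = (if i = j then 1 else 0)"
    if "i < 4" "j < 4" for i j
    using arg_cong[OF UU, of "\<lambda>M. M $$ (i, j)"] that U
    by (auto simp: scalar_prod_def eval_nat_numeral)
  define k where "k Z = (2 * of_bool (p \<in> Z) + of_bool (q \<in> Z) :: nat)" for Z
  have k4: "k Z < 4" for Z by (auto simp: k_def)
  have kinj: "k Z = k W \<longleftrightarrow> Z = W"
    using assms(2,3) pq by (auto simp: Gate2 k_def split: if_splits)
  have "(\<Sum>A\<in>Pow (gate_qubits g). gate_entry g A Z * cnj (gate_entry g A W)) = (if k W = k Z then 1 else 0)"
    using *[OF k4[of W] k4[of Z]] pq
    by (simp add: Gate2 sum_Pow_insert k_def mult_ac add_ac numeral_2_eq_2 numeral_3_eq_3)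
  thus ?thesis using kinj by auto
qed

lemma gate_entry_Un_outside:
  "R \<inter> gate_qubits g = {} \<Longrightarrow> gate_entry g (R \<union> A) Z = gate_entry g A Z"
  by (cases g) auto

lemma gate_entry_cong:
  "X \<inter> gate_qubits g = Y \<inter> gate_qubits g \<Longrightarrow> gate_entry g X Z = gate_entry g Y Z"
  by (cases g) (auto simp: set_eq_iff intro!: arg_cong[where f = "\<lambda>i. _ $$ i"])

text \<open>For a fixed configuration \<open>R\<close> of the other qubits, summing over the row
  patterns first leaves the inner products of the columns of the gate, that is, the identity. Since
  \<open>B\<close> is any finite set containing the gate, this also normalises the outcome
  distribution of one test on its own.\<close>

lemma ker_act_trace:
  assumes g: "valid_gate N g" "gate_qubits g \<subseteq> B" and B: "finite B"
  shows "(\<Sum>X\<in>Pow B. ker_act g s X X) = (\<Sum>X\<in>Pow B. s X X)"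
proof -
  let ?S = "gate_qubits g"
  have BB: "B = (B - ?S) \<union> ?S" using g by auto
  have split: "(\<Sum>X\<in>Pow B. F X) = (\<Sum>R\<in>Pow (B - ?S). \<Sum>A\<in>Pow ?S. F (R \<union> A))" for F :: "nat set \<Rightarrow> complex"
    by (subst BB, rule sum_Pow_Un) (use B in auto)
  have "(\<Sum>A\<in>Pow ?S. ker_act g s (R \<union> A) (R \<union> A)) = (\<Sum>A\<in>Pow ?S. s (R \<union> A) (R \<union> A))"
    if R: "R \<in> Pow (B - ?S)" for R
  proof -
    have d: "R \<inter> ?S = {}" using R by auto
    have "(\<Sum>A\<in>Pow ?S. ker_act g s (R \<union> A) (R \<union> A)) =
      (\<Sum>A\<in>Pow ?S. \<Sum>Z\<in>Pow ?S. \<Sum>W\<in>Pow ?S. gate_entry g A Z * cnj (gate_entry g A W) * s (R \<union> Z) (R \<union> W))"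
    proof (rule sum.cong[OF refl])
      fix A assume "A \<in> Pow ?S"
      hence "R \<union> A - ?S = R" using d by auto
      thus "ker_act g s (R \<union> A) (R \<union> A) = (\<Sum>Z\<in>Pow ?S. \<Sum>W\<in>Pow ?S.
          gate_entry g A Z * cnj (gate_entry g A W) * s (R \<union> Z) (R \<union> W))"
        by (simp add: ker_act_eq gate_entry_Un_outside[OF d])
    qed
    also have "\<dots> = (\<Sum>Z\<in>Pow ?S. \<Sum>A\<in>Pow ?S. \<Sum>W\<in>Pow ?S. gate_entry g A Z * cnj (gate_entry g A W) * s (R \<union> Z) (R \<union> W))"
      by (rule sum.swap)
    also have "\<dots> = (\<Sum>Z\<in>Pow ?S. \<Sum>W\<in>Pow ?S. \<Sum>A\<in>Pow ?S. gate_entry g A Z * cnj (gate_entry g A W) * s (R \<union> Z) (R \<union> W))"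
      by (intro sum.cong refl sum.swap)
    also have "\<dots> = (\<Sum>Z\<in>Pow ?S. \<Sum>W\<in>Pow ?S. (if Z = W then s (R \<union> Z) (R \<union> W) else 0))"
    proof (intro sum.cong refl)
      fix Z W assume "Z \<in> Pow ?S" "W \<in> Pow ?S"
      hence "(\<Sum>A\<in>Pow ?S. gate_entry g A Z * cnj (gate_entry g A W)) = (if Z = W then 1 else 0)"
        by (intro gate_entry_unitary[OF g(1)]) auto
      thus "(\<Sum>A\<in>Pow ?S. gate_entry g A Z * cnj (gate_entry g A W) * s (R \<union> Z) (R \<union> W))
        = (if Z = W then s (R \<union> Z) (R \<union> W) else 0)"
        by (simp flip: sum_distrib_right)
    qed
    also have "\<dots> = (\<Sum>A\<in>Pow ?S. s (R \<union> A) (R \<union> A))" by simp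
    finally show ?thesis .
  qed
  thus ?thesis unfolding split by (rule sum.cong[OF refl])
qed

lemma ker_acts_trace:
  assumes "\<And>g. g \<in> set gs \<Longrightarrow> valid_gate N g \<and> gate_qubits g \<subseteq> B" "finite B"
  shows "(\<Sum>X\<in>Pow B. ker_acts gs s X X) = (\<Sum>X\<in>Pow B. s X X)"
  using assms(1)
proof (induction gs arbitrary: s)
  case (Cons g gs)
  show ?case using Cons.IH[of "ker_act g s"] Cons.prems ker_act_trace[of N g B s] assms(2) by auto
qed auto

text \<open>Positive semidefiniteness, as a sum of rank one kernels.\<close>

definition gram :: "(nat set \<Rightarrow> nat set \<Rightarrow> complex) \<Rightarrow> bool" where
  "gram s \<longleftrightarrow> (\<exists>vs. \<forall>X Y. s X Y = (\<Sum>v\<leftarrow>vs. v X * cnj (v Y)))"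

lemma gram_diag_nonneg: "gram s \<Longrightarrow> 0 \<le> Re (s X X)"
proof -
  have "0 \<le> Re (\<Sum>v\<leftarrow>vs. v X * cnj (v X))" for vs :: "(nat set \<Rightarrow> complex) list"
    by (induction vs) (auto simp flip: power2_eq_square)
  thus "gram s \<Longrightarrow> 0 \<le> Re (s X X)" by (auto simp: gram_def)
qed

lemma gram_cnj: "gram s \<Longrightarrow> cnj (s X Y) = s Y X"
proof -
  have "cnj (\<Sum>v\<leftarrow>vs. v X * cnj (v Y)) = (\<Sum>v\<leftarrow>vs. v Y * cnj (v X))" for vs :: "(nat set \<Rightarrow> complex) list"
    by (induction vs) auto
  thus "gram s \<Longrightarrow> cnj (s X Y) = s Y X" by (auto simp: gram_def)
qed

text \<open>Schur's product theorem: the product of two rank one kernels is the rank one kernel of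
  the pointwise product of the vectors. It makes tensor products of states positive.\<close>

lemma gram_mult:
  assumes "gram s" "gram t" shows "gram (\<lambda>X Y. s X Y * t X Y)"
proof -
  obtain vs ws where v: "\<And>X Y. s X Y = (\<Sum>v\<leftarrow>vs. v X * cnj (v Y))"
    and w: "\<And>X Y. t X Y = (\<Sum>v\<leftarrow>ws. v X * cnj (v Y))"
    using assms unfolding gram_def by blast
  have "(\<Sum>v\<leftarrow>vs. v X * cnj (v Y)) * (\<Sum>v\<leftarrow>ws. v X * cnj (v Y)) =
     (\<Sum>u\<leftarrow>concat (map (\<lambda>v. map (\<lambda>w X. v X * w X) ws) vs). u X * cnj (u Y))" for X Y
  proof (induction vs)
    case (Cons a vs)
    have "(\<Sum>w\<leftarrow>ws. a X * w X * cnj (a Y * w Y)) = a X * cnj (a Y) * (\<Sum>w\<leftarrow>ws. w X * cnj (w Y))"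
      by (simp add: mult_ac flip: sum_list_const_mult)
    thus ?case using Cons by (simp add: o_def distrib_right)
  qed simp
  thus ?thesis unfolding gram_def v w by blast
qed

lemma gram_one: "gram (\<lambda>_ _. 1)"
  unfolding gram_def by (rule exI[of _ "[\<lambda>_. 1]"]) simp

lemma gram_prod: "(\<And>i. i \<in> I \<Longrightarrow> gram (s i)) \<Longrightarrow> gram (\<lambda>X Y. \<Prod>i\<in>I. s i X Y)"
  by (induction I rule: infinite_finite_induct) (auto intro: gram_mult gram_one)

lemma gram_ker_act: "gram s \<Longrightarrow> gram (ker_act g s)"
proof -
  assume "gram s"
  then obtain vs where vs: "\<And>X Y. s X Y = (\<Sum>v\<leftarrow>vs. v X * cnj (v Y))" unfolding gram_def by blast
  have "ker_act g s X Y = (\<Sum>v\<leftarrow>map (vec_act g) vs. v X * cnj (v Y))" for X Y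
    unfolding ker_act_eq vs
    by (induction vs) (simp_all add: distrib_left sum.distrib sum_product vec_act_def mult_ac)
  thus ?thesis unfolding gram_def by metis
qed

lemma gram_ker_acts: "gram s \<Longrightarrow> gram (ker_acts gs s)"
  by (induction gs arbitrary: s) (auto intro: gram_ker_act)

section \<open>Gates on a tensor product over disjoint blocks\<close>

lemma ker_act_prod:
  assumes T: "finite T" "t \<in> T" and g: "gate_qubits g \<subseteq> B t"
    and disj: "\<And>u. u \<in> T \<Longrightarrow> u \<noteq> t \<Longrightarrow> B t \<inter> B u = {}"
  shows "ker_act g (\<lambda>X Y. \<Prod>u\<in>T. s u (X \<inter> B u) (Y \<inter> B u)) =
    (\<lambda>X Y. \<Prod>u\<in>T. (s(t := ker_act g (s t))) u (X \<inter> B u) (Y \<inter> B u))"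
proof (intro ext)
  fix X Y
  let ?S = "gate_qubits g"
  let ?P = "\<Prod>u\<in>T - {t}. s u (X \<inter> B u) (Y \<inter> B u)"
  have 1: "(\<Prod>u\<in>T. s u ((X - ?S \<union> Z) \<inter> B u) ((Y - ?S \<union> W) \<inter> B u)) =
     s t (X \<inter> B t - ?S \<union> Z) (Y \<inter> B t - ?S \<union> W) * ?P" if "Z \<in> Pow ?S" "W \<in> Pow ?S" for Z W
  proof -
    have "(X' - ?S \<union> Z') \<inter> B u = X' \<inter> B u" if "u \<in> T" "u \<noteq> t" "Z' \<in> Pow ?S" for u X' Z'
      using that disj[of u] g by blast
    moreover have "(X' - ?S \<union> Z') \<inter> B t = X' \<inter> B t - ?S \<union> Z'" if "Z' \<in> Pow ?S" for X' Z'
      using that g by blast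
    ultimately show ?thesis using T that
      by (subst prod.remove[OF T]) (auto intro!: arg_cong2[where f = times] prod.cong)
  qed
  have 2: "gate_entry g (X' \<inter> B t) Z = gate_entry g X' Z" for X' Z
    using g by (intro gate_entry_cong) auto
  have "ker_act g (\<lambda>X Y. \<Prod>u\<in>T. s u (X \<inter> B u) (Y \<inter> B u)) X Y =
     (\<Sum>Z\<in>Pow ?S. \<Sum>W\<in>Pow ?S. gate_entry g X Z * cnj (gate_entry g Y W) *
        (s t (X \<inter> B t - ?S \<union> Z) (Y \<inter> B t - ?S \<union> W) * ?P))"
    unfolding ker_act_eq by (intro sum.cong refl) (simp only: 1)
  also have "\<dots> = ker_act g (s t) (X \<inter> B t) (Y \<inter> B t) * ?P"
    unfolding ker_act_eq 2 by (simp add: sum_distrib_left sum_distrib_right mult_ac)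
  also have "\<dots> = (\<Prod>u\<in>T. (s(t := ker_act g (s t))) u (X \<inter> B u) (Y \<inter> B u))"
    using T by (subst prod.remove[OF T]) (auto intro!: arg_cong2[where f = times] prod.cong)
  finally show "ker_act g (\<lambda>X Y. \<Prod>u\<in>T. s u (X \<inter> B u) (Y \<inter> B u)) X Y =
    (\<Prod>u\<in>T. (s(t := ker_act g (s t))) u (X \<inter> B u) (Y \<inter> B u))" .
qed

lemma ker_acts_prod:
  assumes T: "finite T" "t \<in> T" and g: "\<And>g. g \<in> set gs \<Longrightarrow> gate_qubits g \<subseteq> B t"
    and disj: "\<And>u. u \<in> T \<Longrightarrow> u \<noteq> t \<Longrightarrow> B t \<inter> B u = {}"
  shows "ker_acts gs (\<lambda>X Y. \<Prod>u\<in>T. s u (X \<inter> B u) (Y \<inter> B u)) =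
    (\<lambda>X Y. \<Prod>u\<in>T. (s(t := ker_acts gs (s t))) u (X \<inter> B u) (Y \<inter> B u))"
  using g
proof (induction gs arbitrary: s)
  case (Cons g gs)
  have g: "gate_qubits g \<subseteq> B t" using Cons.prems by auto
  have "ker_acts (g # gs) (\<lambda>X Y. \<Prod>u\<in>T. s u (X \<inter> B u) (Y \<inter> B u)) =
      ker_acts gs (\<lambda>X Y. \<Prod>u\<in>T. (s(t := ker_act g (s t))) u (X \<inter> B u) (Y \<inter> B u))"
    unfolding ker_acts_simps
    by (intro arg_cong[where f = "ker_acts gs"] ker_act_prod[where B = B and t = t and T = T and s = s and g = g])
      (use T g disj in auto)
  also have "\<dots> = (\<lambda>X Y. \<Prod>u\<in>T. ((s(t := ker_act g (s t)))
      (t := ker_acts gs ((s(t := ker_act g (s t))) t))) u (X \<inter> B u) (Y \<inter> B u))"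
    by (rule Cons.IH) (use Cons.prems in auto)
  also have "(s(t := ker_act g (s t)))(t := ker_acts gs ((s(t := ker_act g (s t))) t)) =
      s(t := ker_acts (g # gs) (s t))"
    by simp
  finally show ?case .
qed simp

text \<open>Each stage touches one block and so changes one tensor factor. This is what makes the
  outcomes of different tests independent.\<close>

lemma ker_acts_concat_prod:
  assumes g: "\<And>t g. t < k \<Longrightarrow> g \<in> set (gs t) \<Longrightarrow> gate_qubits g \<subseteq> B t"
    and disj: "\<And>u t. u < k \<Longrightarrow> t < k \<Longrightarrow> u \<noteq> t \<Longrightarrow> B t \<inter> B u = {}"
  shows "ker_acts (concat (map gs [0..<k])) (\<lambda>X Y. \<Prod>u<k. s u (X \<inter> B u) (Y \<inter> B u)) =
    (\<lambda>X Y. \<Prod>u<k. ker_acts (gs u) (s u) (X \<inter> B u) (Y \<inter> B u))"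
proof -
  have "ker_acts (concat (map gs [0..<j])) (\<lambda>X Y. \<Prod>u<k. s u (X \<inter> B u) (Y \<inter> B u)) =
    (\<lambda>X Y. \<Prod>u<k. (if u < j then ker_acts (gs u) (s u) else s u) (X \<inter> B u) (Y \<inter> B u))" if "j \<le> k" for j
    using that
  proof (induction j)
    case (Suc j)
    let ?s = "\<lambda>u. if u < j then ker_acts (gs u) (s u) else s u"
    have "ker_acts (concat (map gs [0..<Suc j])) (\<lambda>X Y. \<Prod>u<k. s u (X \<inter> B u) (Y \<inter> B u)) =
      ker_acts (gs j) (\<lambda>X Y. \<Prod>u<k. ?s u (X \<inter> B u) (Y \<inter> B u))"
      using Suc by simp
    also have "\<dots> = (\<lambda>X Y. \<Prod>u<k. (?s(j := ker_acts (gs j) (?s j))) u (X \<inter> B u) (Y \<inter> B u))"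
      using Suc.prems g disj by (intro ker_acts_prod) auto
    also have "?s(j := ker_acts (gs j) (?s j)) = (\<lambda>u. if u < Suc j then ker_acts (gs u) (s u) else s u)"
      by (auto simp: fun_eq_iff less_Suc_eq)
    finally show ?case .
  qed simp
  from this[of k] show ?thesis by (auto simp: fun_eq_iff intro!: prod.cong)
qed

section \<open>The elementary step of the circuit\<close>

definition flip :: "nat \<Rightarrow> nat set \<Rightarrow> nat set" where
  "flip q X = (if q \<in> X then X - {q} else insert q X)"

lemma mem_flip [simp]: "k \<in> flip q X \<longleftrightarrow> (if k = q then k \<notin> X else k \<in> X)"
  by (auto simp: flip_def)

lemma flip_flip [simp]: "flip q (flip q X) = X"
  by (auto simp: set_eq_iff)

lemma flip_commute: "flip p (flip q X) = flip q (flip p X)"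
  by (auto simp: set_eq_iff)

definition had :: "nat \<Rightarrow> gate" where
  "had q = Gate1 q (Matrix.mat 2 2 (\<lambda>(i, j).
     if i = 1 \<and> j = 1 then - 1 / complex_of_real (sqrt 2) else 1 / complex_of_real (sqrt 2)))"

text \<open>One shape covers all two-qubit gates of the circuit, since it applies a + b NOT to
  \<open>q\<close>: (0, 1) is CNOT, the entries (1 + \<i>)/2 and (1 - \<i>)/2 give the square roots
  of NOT, and (cos \<theta>, \<i> sin \<theta>) gives exp(\<i> \<theta> NOT).\<close>

definition ctrl :: "nat \<Rightarrow> nat \<Rightarrow> complex \<Rightarrow> complex \<Rightarrow> gate" where
  "ctrl c q a b = Gate2 c q (Matrix.mat 4 4 (\<lambda>(i, j).
     if i < 2 \<or> j < 2 then of_bool (i = j) else if i = j then a else b))"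

definition had_fun :: "nat \<Rightarrow> (nat set \<Rightarrow> complex) \<Rightarrow> nat set \<Rightarrow> complex" where
  "had_fun q \<psi> X = (\<psi> (X - {q}) + (if q \<in> X then - 1 else 1) * \<psi> (insert q X)) / sqrt 2"

lemma gate_qubits_had [simp]: "gate_qubits (had q) = {q}"
  by (simp add: had_def)

lemma gate_qubits_ctrl [simp]: "gate_qubits (ctrl c q a b) = {c, q}"
  by (simp add: ctrl_def)

lemma vec_act_had [simp]: "vec_act (had q) \<psi> = had_fun q \<psi>"
  by (auto simp: fun_eq_iff vec_act_def had_fun_def had_def sum_Pow_insert field_simps)

lemma vec_act_ctrl:
  assumes "c \<noteq> q"
  shows "vec_act (ctrl c q a b) \<psi> = (\<lambda>X. if c \<in> X then a * \<psi> X + b * \<psi> (flip q X) else \<psi> X)"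
proof
  fix X
  have e: "c \<in> X \<Longrightarrow> insert c (X - {c, q}) = X - {q}" "c \<notin> X \<Longrightarrow> X - {c, q} = X - {q}"
    "c \<in> X \<Longrightarrow> q \<in> X \<Longrightarrow> insert c (insert q (X - {c, q})) = X"
    "c \<in> X \<Longrightarrow> q \<notin> X \<Longrightarrow> insert c (insert q (X - {c, q})) = insert q X"
    "c \<in> X \<Longrightarrow> q \<in> X \<Longrightarrow> insert q (insert c (X - {c, q})) = X"
    "c \<in> X \<Longrightarrow> q \<notin> X \<Longrightarrow> insert q (insert c (X - {c, q})) = insert q X"
    "c \<notin> X \<Longrightarrow> q \<in> X \<Longrightarrow> insert q (X - {c, q}) = X"
    "c \<notin> X \<Longrightarrow> q \<in> X \<Longrightarrow> insert q (X - {q}) = X"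
    "q \<notin> X \<Longrightarrow> X - {q} = X" "q \<in> X \<Longrightarrow> insert q X = X"
    using assms by auto
  have S: "(\<Sum>Z\<in>Pow {c, q}. f Z) = f {} + f {q} + f {c} + f {c, q}" for f :: "nat set \<Rightarrow> complex"
    using assms by (simp add: sum_Pow_insert add_ac insert_commute)
  show "vec_act (ctrl c q a b) \<psi> X = (if c \<in> X then a * \<psi> X + b * \<psi> (flip q X) else \<psi> X)"
    using assms
    by (cases "c \<in> X"; cases "q \<in> X")
      (simp_all add: vec_act_def gate_qubits_ctrl S, simp_all add: ctrl_def flip_def e insert_commute)
qed

section \<open>Unitarity of the elementary gates\<close>

lemma unitary_matI:
  assumes "U \<in> carrier_mat d d" "mat_adjoint U * U = 1\<^sub>m d"
  shows "unitary_mat d U"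
  using assms mat_mult_left_right_inverse[OF mat_adjoint_carrier[OF assms(1)] assms(1) assms(2)]
  by (auto simp: unitary_mat_def)

lemma valid_had: "q < N \<Longrightarrow> valid_gate N (had q)"
proof -
  let ?U = "Matrix.mat 2 2 (\<lambda>(i, j).
     if i = 1 \<and> j = 1 then - 1 / complex_of_real (sqrt 2) else 1 / complex_of_real (sqrt 2))"
  have s: "complex_of_real (sqrt 2) * complex_of_real (sqrt 2) = 2"
    by (simp flip: of_real_mult)
  have "unitary_mat 2 ?U"
  proof (rule unitary_matI)
    show "mat_adjoint ?U * ?U = 1\<^sub>m 2"
      by (rule eq_matI) (auto simp: scalar_prod_def numeral_2_eq_2 less_Suc_eq s)
  qed auto
  thus "q < N \<Longrightarrow> valid_gate N (had q)" by (simp add: had_def)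
qed

lemma valid_ctrl:
  assumes "c < N" "q < N" "c \<noteq> q" "a * cnj a + b * cnj b = 1" "a * cnj b + b * cnj a = 0"
  shows "valid_gate N (ctrl c q a b)"
proof -
  let ?U = "Matrix.mat 4 4 (\<lambda>(i, j). if i < 2 \<or> j < 2 then of_bool (i = j) else if i = j then a else b)"
  have "unitary_mat 4 ?U"
  proof (rule unitary_matI)
    show "mat_adjoint ?U * ?U = 1\<^sub>m 4"
      by (rule eq_matI) (use assms(4,5) in \<open>auto simp: scalar_prod_def eval_nat_numeral less_Suc_eq mult_ac add_ac\<close>)
  qed auto
  thus ?thesis using assms by (simp add: ctrl_def)
qed

text \<open>The decomposition of the Toffoli gate into controlled square roots of NOT, whose entries are
  \<open>(1 \<plusminus> \<i>) / 2\<close>.\<close>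

definition toffoli :: "nat \<Rightarrow> nat \<Rightarrow> nat \<Rightarrow> gate list" where
  "toffoli a p q = [ctrl p q ((1 + \<i>) / 2) ((1 - \<i>) / 2), ctrl a p 0 1,
     ctrl p q ((1 - \<i>) / 2) ((1 + \<i>) / 2), ctrl a p 0 1, ctrl a q ((1 + \<i>) / 2) ((1 - \<i>) / 2)]"

lemma vec_acts_toffoli:
  assumes "a \<noteq> p" "a \<noteq> q" "p \<noteq> q"
  shows "vec_acts (toffoli a p q) \<psi> = (\<lambda>X. \<psi> (if a \<in> X \<and> p \<in> X then flip q X else X))"
proof
  fix X
  note ne = assms assms(1,2,3)[symmetric]
  define v w where "v = (1 + \<i>) / 2" and "w = (1 - \<i>) / 2"
  \<comment> \<open>For V = v + w NOT these two identities say that V V = NOT and that w + v NOT is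
    the inverse of V.\<close>
  have vw: "v * v + w * w = 0" "2 * (v * w) = 1" by (simp_all add: v_def w_def field_simps)
  have 1: "v * (v * y + w * z) + w * (v * z + w * y) = z" "v * (w * y + v * z) + w * (w * z + v * y) = y"
    "w * (v * y + w * z) + v * (v * z + w * y) = y" for y z
  proof -
    have "v * (v * y + w * z) + w * (v * z + w * y) = (v * v + w * w) * y + 2 * (v * w) * z"
      "v * (w * y + v * z) + w * (w * z + v * y) = 2 * (v * w) * y + (v * v + w * w) * z"
      "w * (v * y + w * z) + v * (v * z + w * y) = 2 * (v * w) * y + (v * v + w * w) * z"
      by (simp_all add: algebra_simps)
    thus "v * (v * y + w * z) + w * (v * z + w * y) = z" "v * (w * y + v * z) + w * (w * z + v * y) = y"
      "w * (v * y + w * z) + v * (v * z + w * y) = y"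
      unfolding vw by simp_all
  qed
  show "vec_acts (toffoli a p q) \<psi> X = \<psi> (if a \<in> X \<and> p \<in> X then flip q X else X)"
    unfolding toffoli_def v_def[symmetric] w_def[symmetric]
    by (cases "a \<in> X"; cases "p \<in> X") (simp_all add: vec_act_ctrl ne 1 flip_commute[of q p])
qed

definition swap_at :: "nat \<Rightarrow> nat \<Rightarrow> nat set \<Rightarrow> nat set" where
  "swap_at p q X = {k. (if k = p then q else if k = q then p else k) \<in> X}"

text \<open>A swap is three CNOT gates; it suffices to control the middle one, because the outer two
  cancel when it is absent.\<close>

definition fredkin :: "nat \<Rightarrow> nat \<Rightarrow> nat \<Rightarrow> gate list" where
  "fredkin a p q = ctrl q p 0 1 # toffoli a p q @ [ctrl q p 0 1]"

lemma vec_acts_fredkin: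
  assumes "a \<noteq> p" "a \<noteq> q" "p \<noteq> q"
  shows "vec_acts (fredkin a p q) \<psi> = (\<lambda>X. \<psi> (if a \<in> X then swap_at p q X else X))"
proof
  fix X
  show "vec_acts (fredkin a p q) \<psi> X = \<psi> (if a \<in> X then swap_at p q X else X)"
    using assms
    by (auto simp: fredkin_def vec_acts_toffoli vec_act_ctrl swap_at_def set_eq_iff intro!: arg_cong[where f = \<psi>])
qed

section \<open>Controlled swaps of whole registers\<close>

definition swap_blk :: "nat \<Rightarrow> nat \<Rightarrow> nat \<Rightarrow> nat set \<Rightarrow> nat set" where
  "swap_blk n P Q X = {k. (if k \<in> {P..<P + n} then k - P + Q else if k \<in> {Q..<Q + n} then k - Q + P else k) \<in> X}"

definition cswap :: "nat \<Rightarrow> nat \<Rightarrow> nat \<Rightarrow> nat \<Rightarrow> gate list" where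
  "cswap n a P Q = concat (map (\<lambda>k. fredkin a (P + k) (Q + k)) [0..<n])"

abbreviation blkset :: "nat \<Rightarrow> nat \<Rightarrow> nat set" where
  "blkset n P \<equiv> {P..<P + n}"

lemma blkset_disjD:
  assumes "blkset n P \<inter> blkset n Q = {}" "i < n"
  shows "P + i \<notin> blkset n Q" "Q + i \<notin> blkset n P"
proof -
  have "P + i \<in> blkset n P" "Q + i \<in> blkset n Q" using assms(2) by auto
  thus "P + i \<notin> blkset n Q" "Q + i \<notin> blkset n P" using assms(1) by blast+
qed

lemma mem_swap_blk_outside [simp]:
  "a \<notin> blkset n P \<Longrightarrow> a \<notin> blkset n Q \<Longrightarrow> a \<in> swap_blk n P Q X \<longleftrightarrow> a \<in> X"
  by (auto simp: swap_blk_def)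

lemma mem_swap_blk_inside:
  assumes "blkset n P \<inter> blkset n Q = {}" "i < n"
  shows "P + i \<in> swap_blk n P Q X \<longleftrightarrow> Q + i \<in> X" "Q + i \<in> swap_blk n P Q X \<longleftrightarrow> P + i \<in> X"
  using blkset_disjD[OF assms] assms(2) by (auto simp: swap_blk_def add.commute)

lemma vec_acts_cswap:
  assumes "a \<notin> blkset n P" "a \<notin> blkset n Q" "blkset n P \<inter> blkset n Q = {}"
  shows "vec_acts (cswap n a P Q) \<psi> = (\<lambda>X. \<psi> (if a \<in> X then swap_blk n P Q X else X))"
  using assms
proof (induction n)
  case 0
  have "swap_blk 0 P Q X = X" for X by (auto simp: swap_blk_def)
  thus ?case by (simp add: cswap_def cong: if_cong)
next
  case (Suc n)
  have d: "P + k \<noteq> Q + l" if "k < Suc n" "l < Suc n" for k l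
    using blkset_disjD(1)[OF Suc.prems(3) that(1)] that(2) by auto
  have IH: "vec_acts (cswap n a P Q) \<psi> = (\<lambda>X. \<psi> (if a \<in> X then swap_blk n P Q X else X))"
    by (rule Suc.IH) (use Suc.prems in auto)
  have ne: "a \<noteq> P + n" "a \<noteq> Q + n" using Suc.prems by auto
  have dn: "blkset n P \<inter> blkset n Q = {}" using Suc.prems(3) by auto
  have 1: "swap_blk n P Q (swap_at (P + n) (Q + n) X) = swap_blk (Suc n) P Q X" for X
  proof -
    have "(k \<in> swap_blk n P Q (swap_at (P + n) (Q + n) X)) = (k \<in> swap_blk (Suc n) P Q X)" for k
    proof -
      consider "k \<in> blkset n P" | "k = P + n" | "k \<in> blkset n Q" | "k = Q + n" | "k \<notin> blkset (Suc n) P \<union> blkset (Suc n) Q"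
        by (auto simp: less_Suc_eq)
      thus ?thesis
      proof cases
        case 1
        then obtain j where j: "k = P + j" "j < n" by (metis atLeastLessThan_iff le_Suc_ex nat_add_left_cancel_less)
        thus ?thesis using d[of n j] d[of j n] mem_swap_blk_inside[OF dn j(2)] mem_swap_blk_inside[OF Suc.prems(3), of j]
          by (auto simp: swap_at_def)
      next
        case 2
        have "k \<notin> blkset n P" "k \<notin> blkset n Q" using 2 blkset_disjD[OF Suc.prems(3), of n] by auto
        thus ?thesis using 2 mem_swap_blk_inside[OF Suc.prems(3), of n] by (simp add: swap_at_def del: atLeastLessThan_iff)
      next
        case 3
        then obtain j where j: "k = Q + j" "j < n" by (metis atLeastLessThan_iff le_Suc_ex nat_add_left_cancel_less)
        thus ?thesis using d[of n j] d[of j n] mem_swap_blk_inside[OF dn j(2)] mem_swap_blk_inside[OF Suc.prems(3), of j]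
          by (auto simp: swap_at_def)
      next
        case 4
        have "k \<notin> blkset n P" "k \<notin> blkset n Q" using 4 blkset_disjD[OF Suc.prems(3), of n] by auto
        thus ?thesis using 4 mem_swap_blk_inside[OF Suc.prems(3), of n] d[of n n]
          by (simp add: swap_at_def del: atLeastLessThan_iff)
      next
        case 5
        have "k \<notin> blkset n P" "k \<notin> blkset n Q" using 5 by auto
        moreover have "k \<notin> blkset (Suc n) P" "k \<notin> blkset (Suc n) Q" "k \<noteq> P + n" "k \<noteq> Q + n" using 5 by auto
        ultimately show ?thesis by (simp add: swap_at_def del: atLeastLessThan_iff)
      qed
    qed
    thus ?thesis by blast
  qed
  have 2: "a \<in> swap_at (P + n) (Q + n) X \<longleftrightarrow> a \<in> X" for X
    using ne by (simp add: swap_at_def)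
  show ?case
    using vec_acts_fredkin[OF ne d[of n n]] IH 1 2 by (auto simp: cswap_def fun_eq_iff)
qed

lemma swap_blk_restrict:
  assumes "B \<inter> blkset n P = {}" "B \<inter> blkset n Q = {}" "Z \<subseteq> B"
  shows "swap_blk n P Q (X - B \<union> Z) = swap_blk n P Q X - B \<union> Z"
proof -
  have "k \<in> swap_blk n P Q (X - B \<union> Z) \<longleftrightarrow> k \<in> swap_blk n P Q X - B \<union> Z" for k
  proof (cases "k \<in> blkset n P \<union> blkset n Q")
    case True
    hence "k \<in> blkset n P \<Longrightarrow> k - P + Q \<in> blkset n Q" "k \<in> blkset n Q \<Longrightarrow> k - Q + P \<in> blkset n P" by auto
    thus ?thesis using assms True unfolding swap_blk_def by (auto simp del: atLeastLessThan_iff)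
  next
    case False
    thus ?thesis unfolding swap_blk_def by auto
  qed
  thus ?thesis by blast
qed

lemma swap_blk_flip:
  assumes "a \<notin> blkset n P" "a \<notin> blkset n Q"
  shows "swap_blk n P Q (flip a X) = flip a (swap_blk n P Q X)"
    "swap_blk n P Q (insert a X) = insert a (swap_blk n P Q X)"
    "swap_blk n P Q (X - {a}) = swap_blk n P Q X - {a}"
proof -
  have *: "swap_blk n P Q (X - {a} \<union> Z) = swap_blk n P Q X - {a} \<union> Z" if "Z \<subseteq> {a}" for Z
    by (rule swap_blk_restrict) (use that assms in auto)
  show "swap_blk n P Q (insert a X) = insert a (swap_blk n P Q X)"
    "swap_blk n P Q (X - {a}) = swap_blk n P Q X - {a}"
    using *[of "{a}"] *[of "{}"] by auto
  thus "swap_blk n P Q (flip a X) = flip a (swap_blk n P Q X)"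
    using assms by (auto simp: flip_def)
qed

lemma swap_blk_swap_blk [simp]:
  assumes "blkset n P \<inter> blkset n Q = {}"
  shows "swap_blk n P Q (swap_blk n P Q X) = X"
proof -
  have "k \<in> swap_blk n P Q (swap_blk n P Q X) \<longleftrightarrow> k \<in> X" for k
    using assms unfolding swap_blk_def by (auto simp: set_eq_iff)
  thus ?thesis by blast
qed

text \<open>In the symmetric group on the three registers, conjugating the transposition (T P) by (P
  Q) gives (T Q). This is how the coin can select which register is swapped with T.\<close>

lemma swap_blk_conj:
  assumes "blkset n P \<inter> blkset n Q = {}" "blkset n T \<inter> blkset n P = {}" "blkset n T \<inter> blkset n Q = {}"
  shows "swap_blk n P Q (swap_blk n T P (swap_blk n P Q X)) = swap_blk n T Q X"
proof -
  note m = mem_swap_blk_inside[OF assms(1)] mem_swap_blk_inside[OF assms(2)] mem_swap_blk_inside[OF assms(3)]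
  note d = blkset_disjD[OF assms(1)] blkset_disjD[OF assms(2)] blkset_disjD[OF assms(3)]
  have "k \<in> swap_blk n P Q (swap_blk n T P (swap_blk n P Q X)) \<longleftrightarrow> k \<in> swap_blk n T Q X" for k
  proof -
    consider (p) i where "i < n" "k = P + i" | (q) i where "i < n" "k = Q + i" | (t) i where "i < n" "k = T + i"
      | "k \<notin> blkset n P \<union> blkset n Q \<union> blkset n T"
      by (auto simp: atLeastLessThan_iff) (metis le_Suc_ex nat_add_left_cancel_less)+
    thus ?thesis
    proof cases
      case p
      thus ?thesis using d[OF p(1)] m[OF p(1)] by (simp del: atLeastLessThan_iff)
    next
      case q
      thus ?thesis using d[OF q(1)] m[OF q(1)] by (simp del: atLeastLessThan_iff)
    next
      case t
      thus ?thesis using d[OF t(1)] m[OF t(1)] by (simp del: atLeastLessThan_iff)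
    next
      case 4
      hence "k \<notin> blkset n P" "k \<notin> blkset n Q" "k \<notin> blkset n T" by blast+
      thus ?thesis by (simp del: atLeastLessThan_iff)
    qed
  qed
  thus ?thesis by blast
qed

lemma had_fun_had_fun [simp]: "had_fun q (had_fun q \<psi>) = \<psi>"
proof
  fix X
  have s: "complex_of_real (sqrt 2) * complex_of_real (sqrt 2) = 2" by (simp flip: of_real_mult)
  have "q \<in> X \<Longrightarrow> insert q X = X" "q \<notin> X \<Longrightarrow> X - {q} = X" by auto
  thus "had_fun q (had_fun q \<psi>) X = \<psi> X"
    by (cases "q \<in> X") (simp_all add: had_fun_def s insert_Diff_if flip: add_divide_distrib diff_divide_distrib)
qed

text \<open>Conjugation of the controlled rotation by the coin and the swaps yields
  \<open>exp(\<i> \<theta> W)\<close> with \<open>W\<close> the involution \<open>coin_swap\<close>, controlled by \<open>c\<close>.\<close>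

definition step :: "nat \<Rightarrow> nat \<Rightarrow> nat \<Rightarrow> nat \<Rightarrow> nat \<Rightarrow> nat \<Rightarrow> real \<Rightarrow> gate list" where
  "step n c T a P Q \<theta> = [had a] @ cswap n a P Q @ [had a] @ cswap n a T P @
     [ctrl c a (complex_of_real (cos \<theta>)) (\<i> * complex_of_real (sin \<theta>))] @ cswap n a T P @ [had a] @ cswap n a P Q @ [had a]"

text \<open>In the basis |+>, |-> of the coin this is SWAP(T,P) on |+> and -SWAP(T,Q) on |->. Its
  block at the coin state |0> is (SWAP(T,P) - SWAP(T,Q))/2, which is the origin of the difference of
  the two states and of the factor 1/2.\<close>

definition coin_swap :: "nat \<Rightarrow> nat \<Rightarrow> nat \<Rightarrow> nat \<Rightarrow> nat \<Rightarrow> (nat set \<Rightarrow> complex) \<Rightarrow> nat set \<Rightarrow> complex" where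
  "coin_swap n T a P Q \<psi> = had_fun a (\<lambda>X. if a \<in> X then - had_fun a \<psi> (swap_blk n T Q X)
     else had_fun a \<psi> (swap_blk n T P X))"

definition step_fun :: "nat \<Rightarrow> nat \<Rightarrow> nat \<Rightarrow> nat \<Rightarrow> nat \<Rightarrow> real \<Rightarrow> (nat set \<Rightarrow> complex) \<Rightarrow> nat set \<Rightarrow> complex" where
  "step_fun n T a P Q \<theta> \<psi> X = complex_of_real (cos \<theta>) * \<psi> X + \<i> * complex_of_real (sin \<theta>) * coin_swap n T a P Q \<psi> X"

lemma had_fun_if:
  assumes "c \<noteq> a"
  shows "had_fun a (\<lambda>X. if c \<in> X then x * \<psi> X + y * \<phi> X else \<psi> X) =
    (\<lambda>X. if c \<in> X then x * had_fun a \<psi> X + y * had_fun a \<phi> X else had_fun a \<psi> X)"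
  using assms by (auto simp: fun_eq_iff had_fun_def field_simps)

text \<open>Let X and Z be the Pauli operators on the coin. Conjugating X by the coin-controlled
  swap of T and P gives X SWAP(T,P), and the inner Hadamard gates turn it into Z SWAP(T,P).
  Conjugating by the coin-controlled swap of P and Q replaces SWAP(T,P) by SWAP(T,Q) where the coin
  is 1, and the outer Hadamard gates give \<open>coin_swap\<close>. All conjugating factors are
  involutions, so they pass through cos \<theta> + \<i> sin \<theta> X, and only the central gate
  has to carry the angle and the control \<open>c\<close>.\<close>

lemma vec_acts_step:
  assumes "blkset n P \<inter> blkset n Q = {}" "blkset n T \<inter> blkset n P = {}" "blkset n T \<inter> blkset n Q = {}"
    and a: "a \<notin> blkset n T" "a \<notin> blkset n P" "a \<notin> blkset n Q"
    and c: "c \<notin> blkset n T" "c \<notin> blkset n P" "c \<notin> blkset n Q" "c \<noteq> a"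
  shows "vec_acts (step n c T a P Q \<theta>) \<psi> =
    (\<lambda>X. if c \<in> X then step_fun n T a P Q \<theta> \<psi> X else \<psi> X)"
proof -
  let ?D1 = "\<lambda>\<psi> X. \<psi> (if a \<in> X then swap_blk n P Q X else X)"
  let ?D2 = "\<lambda>\<psi> X. \<psi> (if a \<in> X then swap_blk n T P X else X)"
  let ?x = "complex_of_real (cos \<theta>)" and ?y = "\<i> * complex_of_real (sin \<theta>)"
  let ?G = "\<lambda>\<psi> X. if c \<in> X then ?x * \<psi> X + ?y * \<psi> (flip a X) else \<psi> X"
  note [simp] = c(4) mem_swap_blk_outside[OF a(2,3)] mem_swap_blk_outside[OF a(1,2)] mem_swap_blk_outside[OF a(1,3)]
    mem_swap_blk_outside[OF c(2,3)] mem_swap_blk_outside[OF c(1,2)] mem_swap_blk_outside[OF c(1,3)]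
    swap_blk_flip[OF a(2,3)] swap_blk_flip[OF a(1,2)] swap_blk_flip[OF a(1,3)]
    swap_blk_swap_blk[OF assms(1)] swap_blk_swap_blk[OF assms(2)] swap_blk_swap_blk[OF assms(3)]
  have D1D1: "?D1 (?D1 \<phi>) = \<phi>" for \<phi> :: "nat set \<Rightarrow> complex" by (auto simp: fun_eq_iff)
  have 1: "?D2 (?G (?D2 \<phi>)) = (\<lambda>X. if c \<in> X then ?x * \<phi> X + ?y * \<phi> (flip a (swap_blk n T P X)) else \<phi> X)"
    for \<phi> :: "nat set \<Rightarrow> complex"
    by (auto simp: fun_eq_iff)
  have h: "had_fun a (\<lambda>X. had_fun a \<phi> (flip a (swap_blk n T P X))) =
      (\<lambda>X. (if a \<in> X then - 1 else 1) * \<phi> (swap_blk n T P X))" for \<phi>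
  proof -
    have s: "complex_of_real (sqrt 2) * complex_of_real (sqrt 2) = 2" by (simp flip: of_real_mult)
    have "had_fun a (\<lambda>X. had_fun a \<phi> (flip a (swap_blk n T P X))) X =
      (if a \<in> X then - 1 else 1) * \<phi> (swap_blk n T P X)" for X
    proof (cases "a \<in> X")
      case True
      define Y where "Y = X - {a}"
      have "X = insert a Y" "a \<notin> Y" using True by (auto simp: Y_def)
      thus ?thesis by (simp add: had_fun_def flip_def s field_simps)
    next
      case False
      thus ?thesis by (simp add: had_fun_def flip_def s field_simps)
    qed
    thus ?thesis by auto
  qed
  have 2: "had_fun a (?D2 (?G (?D2 (had_fun a \<phi>)))) =
    (\<lambda>X. if c \<in> X then ?x * \<phi> X + ?y * ((if a \<in> X then - 1 else 1) * \<phi> (swap_blk n T P X)) else \<phi> X)" for \<phi>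
    unfolding 1 had_fun_if[OF c(4)] h had_fun_had_fun by (rule refl)
  have 3: "?D1 (had_fun a (?D2 (?G (?D2 (had_fun a (?D1 \<phi>)))))) =
    (\<lambda>X. if c \<in> X then ?x * \<phi> X + ?y * (if a \<in> X then - \<phi> (swap_blk n T Q X) else \<phi> (swap_blk n T P X))
      else \<phi> X)" for \<phi>
    unfolding 2 using swap_blk_conj[OF assms(1-3)] by (auto simp: fun_eq_iff)
  have "vec_acts (step n c T a P Q \<theta>) \<psi> =
    had_fun a (?D1 (had_fun a (?D2 (?G (?D2 (had_fun a (?D1 (had_fun a \<psi>))))))))"
    by (simp add: step_def vec_acts_cswap[OF a(2,3) assms(1)] vec_acts_cswap[OF a(1,2) assms(2)] vec_act_ctrl)
  also have "\<dots> = (\<lambda>X. if c \<in> X then step_fun n T a P Q \<theta> \<psi> X else \<psi> X)"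
    unfolding 3 had_fun_if[OF c(4)] by (simp add: step_fun_def coin_swap_def fun_eq_iff)
  finally show ?thesis .
qed

section \<open>Tracing out one cell\<close>

definition blk :: "nat \<Rightarrow> nat \<Rightarrow> nat set \<Rightarrow> nat" where
  "blk n P X = set_encode {k. k < n \<and> P + k \<in> X}"

lemma blk_cong: "X \<inter> blkset n P = Y \<inter> blkset n P \<Longrightarrow> blk n P X = blk n P Y"
proof -
  assume XY: "X \<inter> blkset n P = Y \<inter> blkset n P"
  have "P + k \<in> X \<longleftrightarrow> P + k \<in> Y" if "k < n" for k
  proof -
    have "P + k \<in> blkset n P" using that by simp
    thus ?thesis using XY by blast
  qed
  hence "{k. k < n \<and> P + k \<in> X} = {k. k < n \<and> P + k \<in> Y}" by blast
  thus ?thesis unfolding blk_def by simp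
qed

lemma conf_blk: "conf (blk n P X) = {k. k < n \<and> P + k \<in> X}"
  unfolding blk_def by (rule conf_set_encode) auto

lemma blk_less [simp]: "blk n P X < 2 ^ n"
  by (auto simp: conf_less_iff conf_blk)

lemma sum_blk: "(\<Sum>Z\<in>Pow (blkset n P). f (blk n P Z)) = (\<Sum>p<2 ^ n. f p)"
proof (rule sum.reindex_bij_betw)
  show "bij_betw (blk n P) (Pow (blkset n P)) {..<2 ^ n}"
  proof (rule bij_betw_byWitness[where f' = "\<lambda>p. (+) P ` conf p"])
    show "\<forall>Z\<in>Pow (blkset n P). (+) P ` conf (blk n P Z) = Z"
      by (auto simp: conf_blk image_iff) (metis le_Suc_ex nat_add_left_cancel_less atLeastLessThan_iff subsetD)
    show "\<forall>p\<in>{..<2 ^ n}. blk n P ((+) P ` conf p) = p"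
      by (auto intro!: inj_conf simp: conf_blk conf_less_iff)
    show "blk n P ` Pow (blkset n P) \<subseteq> {..<2 ^ n}" by auto
    show "(\<lambda>p. (+) P ` conf p) ` {..<2 ^ n} \<subseteq> Pow (blkset n P)"
      by (auto simp: conf_less_iff)
  qed
qed

lemma blk_swap_blk:
  assumes "blkset n P \<inter> blkset n Q = {}"
  shows "blk n P (swap_blk n P Q X) = blk n Q X" "blk n Q (swap_blk n P Q X) = blk n P X"
proof -
  have "{k. k < n \<and> P + k \<in> swap_blk n P Q X} = {k. k < n \<and> Q + k \<in> X}"
    "{k. k < n \<and> Q + k \<in> swap_blk n P Q X} = {k. k < n \<and> P + k \<in> X}"
    using mem_swap_blk_inside[OF assms] by blast+
  thus "blk n P (swap_blk n P Q X) = blk n Q X" "blk n Q (swap_blk n P Q X) = blk n P X"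
    unfolding blk_def by simp_all
qed

lemma blk_swap_blk_outside:
  assumes "blkset n R \<inter> blkset n P = {}" "blkset n R \<inter> blkset n Q = {}"
  shows "blk n R (swap_blk n P Q X) = blk n R X"
proof (rule blk_cong, rule Set.set_eqI)
  fix k
  have "k \<notin> blkset n P \<and> k \<notin> blkset n Q" if "k \<in> blkset n R" using that assms by blast
  thus "k \<in> swap_blk n P Q X \<inter> blkset n R \<longleftrightarrow> k \<in> X \<inter> blkset n R"
    using mem_swap_blk_outside[of k P n Q X] by blast
qed

text \<open>The qubits in \<open>B\<close> are mere parameters for \<open>W\<close>.\<close>

definition local_op :: "nat set \<Rightarrow> ((nat set \<Rightarrow> complex) \<Rightarrow> nat set \<Rightarrow> complex) \<Rightarrow> bool" where
  "local_op B W \<longleftrightarrow> (\<forall>f Z. Z \<subseteq> B \<longrightarrow> W (\<lambda>X. f (X - B \<union> Z)) = (\<lambda>X. W f (X - B \<union> Z)))"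

definition linear_op :: "((nat set \<Rightarrow> complex) \<Rightarrow> nat set \<Rightarrow> complex) \<Rightarrow> bool" where
  "linear_op W \<longleftrightarrow> (\<forall>f g. W (\<lambda>X. f X + g X) = (\<lambda>X. W f X + W g X)) \<and>
     (\<forall>k f. W (\<lambda>X. k * f X) = (\<lambda>X. k * W f X))"

lemma linear_op_add: "linear_op W \<Longrightarrow> W (\<lambda>X. f X + g X) = (\<lambda>X. W f X + W g X)"
  unfolding linear_op_def by (drule conjunct1, drule spec[where x = f], drule spec[where x = g])

lemma linear_op_mult: "linear_op W \<Longrightarrow> W (\<lambda>X. k * f X) = (\<lambda>X. k * W f X)"
  unfolding linear_op_def by (drule conjunct2, drule spec[where x = k], drule spec[where x = f])

lemma linear_op_zero: "linear_op W \<Longrightarrow> W (\<lambda>_. 0) = (\<lambda>_. 0)"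
proof -
  assume "linear_op W"
  from linear_op_mult[OF this, of 0 "\<lambda>_. 0"] show ?thesis by simp
qed

lemma linear_op_sum:
  assumes "linear_op W" shows "W (\<lambda>X. \<Sum>i\<in>I. f i X) = (\<lambda>X. \<Sum>i\<in>I. W (f i) X)"
proof (induction I rule: infinite_finite_induct)
  case (insert i I)
  hence "(\<lambda>X. \<Sum>i\<in>insert i I. f i X) = (\<lambda>X. f i X + (\<Sum>i\<in>I. f i X))" by simp
  thus ?case using insert by (simp add: linear_op_add[OF assms])
qed (use linear_op_zero[OF assms] in auto)

lemma linear_op_sum_list:
  assumes "linear_op W" shows "W (\<lambda>X. \<Sum>i\<leftarrow>xs. f i X) = (\<lambda>X. \<Sum>i\<leftarrow>xs. W (f i) X)"
proof (induction xs)
  case (Cons x xs)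
  thus ?case by (simp add: linear_op_add[OF assms])
qed (use linear_op_zero[OF assms] in auto)

lemma local_opE: "local_op B W \<Longrightarrow> Z \<subseteq> B \<Longrightarrow> W (\<lambda>X. f (X - B \<union> Z)) = (\<lambda>X. W f (X - B \<union> Z))"
  unfolding local_op_def by (drule spec[where x = f], drule spec[where x = Z], erule (1) mp)

lemma local_opD: "local_op B W \<Longrightarrow> Z \<subseteq> B \<Longrightarrow> W f (X - B \<union> Z) = W (\<lambda>X. f (X - B \<union> Z)) X"
proof -
  assume "local_op B W" "Z \<subseteq> B"
  hence "W (\<lambda>X. f (X - B \<union> Z)) = (\<lambda>X. W f (X - B \<union> Z))" by (rule local_opE)
  from fun_cong[OF this, of X] show ?thesis by (rule sym)
qed

lemma local_op_comp:
  assumes "local_op B W" "local_op B V" shows "local_op B (\<lambda>f. V (W f))"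
  unfolding local_op_def
proof (intro allI impI)
  fix f Z assume Z: "Z \<subseteq> B"
  show "V (W (\<lambda>X. f (X - B \<union> Z))) = (\<lambda>X. V (W f) (X - B \<union> Z))"
    unfolding local_opE[OF assms(1) Z] by (rule local_opE[OF assms(2) Z])
qed

lemma linear_op_comp: "linear_op W \<Longrightarrow> linear_op V \<Longrightarrow> linear_op (\<lambda>f. V (W f))"
proof -
  assume W: "linear_op W" and V: "linear_op V"
  show "linear_op (\<lambda>f. V (W f))"
    unfolding linear_op_def
    by (intro conjI allI) (simp_all only: linear_op_add[OF W] linear_op_add[OF V] linear_op_mult[OF W] linear_op_mult[OF V])
qed

lemma local_op_had_fun:
  assumes "a \<notin> B" shows "local_op B (had_fun a)"
  unfolding local_op_def
proof (intro allI impI ext)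
  fix f Z X assume Z: "Z \<subseteq> B"
  have e: "X - {a} - B \<union> Z = X - B \<union> Z - {a}" "insert a X - B \<union> Z = insert a (X - B \<union> Z)"
    "a \<in> X - B \<union> Z \<longleftrightarrow> a \<in> X"
    using assms Z by auto
  show "had_fun a (\<lambda>X. f (X - B \<union> Z)) X = had_fun a f (X - B \<union> Z)"
    unfolding had_fun_def e ..
qed

lemma linear_op_had_fun: "linear_op (had_fun a)"
  unfolding linear_op_def
  by (intro conjI allI ext) (simp_all add: had_fun_def add_divide_distrib diff_divide_distrib algebra_simps)

lemma linear_op_coin_swap: "linear_op (coin_swap n T a P Q)"
  unfolding linear_op_def
proof (intro conjI allI)
  fix f g :: "nat set \<Rightarrow> complex" and k :: complex
  have add: "had_fun a (\<lambda>X. f X + g X) = (\<lambda>X. had_fun a f X + had_fun a g X)"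
    and mul: "had_fun a (\<lambda>X. k * f X) = (\<lambda>X. k * had_fun a f X)" for f g k
    by (rule linear_op_add linear_op_mult, rule linear_op_had_fun)+
  define F where "F f X = (if a \<in> X then - had_fun a f (swap_blk n T Q X) else had_fun a f (swap_blk n T P X))" for f X
  have "F (\<lambda>X. f X + g X) = (\<lambda>X. F f X + F g X)" "F (\<lambda>X. k * f X) = (\<lambda>X. k * F f X)"
    unfolding F_def add mul by (auto simp: fun_eq_iff)
  thus "coin_swap n T a P Q (\<lambda>X. f X + g X) = (\<lambda>X. coin_swap n T a P Q f X + coin_swap n T a P Q g X)"
    "coin_swap n T a P Q (\<lambda>X. k * f X) = (\<lambda>X. k * coin_swap n T a P Q f X)"
    unfolding coin_swap_def F_def[symmetric] by (simp_all only: add mul)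
qed

lemma linear_op_step_fun: "linear_op (step_fun n T a P Q \<theta>)"
proof -
  have add: "coin_swap n T a P Q (\<lambda>X. f X + g X) = (\<lambda>X. coin_swap n T a P Q f X + coin_swap n T a P Q g X)"
    and mul: "coin_swap n T a P Q (\<lambda>X. k * f X) = (\<lambda>X. k * coin_swap n T a P Q f X)" for f g k
    by (rule linear_op_add linear_op_mult, rule linear_op_coin_swap)+
  show ?thesis
    unfolding linear_op_def step_fun_def add mul by (simp add: fun_eq_iff algebra_simps)
qed

lemma local_op_step_fun:
  assumes "a \<notin> B" "B \<inter> blkset n T = {}" "B \<inter> blkset n P = {}" "B \<inter> blkset n Q = {}"
  shows "local_op B (step_fun n T a P Q \<theta>)"
  unfolding local_op_def
proof (intro allI impI ext)
  fix f Z X assume Z: "Z \<subseteq> B"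
  note L = local_opE[OF local_op_had_fun[OF assms(1)] Z]
  define g where "g X = (if a \<in> X then - had_fun a f (swap_blk n T Q X) else had_fun a f (swap_blk n T P X))" for X
  have a: "a \<in> X - B \<union> Z \<longleftrightarrow> a \<in> X" for X using Z assms(1) by auto
  have "(\<lambda>X. if a \<in> X then - had_fun a (\<lambda>X. f (X - B \<union> Z)) (swap_blk n T Q X)
      else had_fun a (\<lambda>X. f (X - B \<union> Z)) (swap_blk n T P X)) = (\<lambda>X. g (X - B \<union> Z))"
    unfolding L g_def a swap_blk_restrict[OF assms(2,3) Z] swap_blk_restrict[OF assms(2,4) Z] ..
  hence "coin_swap n T a P Q (\<lambda>X. f (X - B \<union> Z)) X = coin_swap n T a P Q f (X - B \<union> Z)"
    unfolding coin_swap_def g_def[symmetric] by (simp only: L)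
  thus "step_fun n T a P Q \<theta> (\<lambda>X. f (X - B \<union> Z)) X = step_fun n T a P Q \<theta> f (X - B \<union> Z)"
    by (simp add: step_fun_def)
qed

text \<open>A cell \<open>(a, P, Q, \<theta>)\<close> consists of a coin qubit \<open>a\<close>, a copy of \<open>\<rho>0\<close> starting at qubit \<open>P\<close>,
  a copy of \<open>\<rho>1\<close> starting at qubit \<open>Q\<close>, and a rotation angle.\<close>

type_synonym cell = "nat \<times> nat \<times> nat \<times> real"

fun cell_qubits :: "nat \<Rightarrow> cell \<Rightarrow> nat set" where
  "cell_qubits n (a, P, Q, \<theta>) = insert a (blkset n P \<union> blkset n Q)"

text \<open>The kernel of |0><0| tensor \<rho>0 tensor \<rho>1 on the coin and the two
  registers.\<close>

fun cell_ker :: "nat \<Rightarrow> complex mat \<Rightarrow> complex mat \<Rightarrow> cell \<Rightarrow> nat set \<Rightarrow> nat set \<Rightarrow> complex" where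
  "cell_ker n \<rho>0 \<rho>1 (a, P, Q, \<theta>) X Y = of_bool (a \<notin> X \<and> a \<notin> Y) *
     (\<rho>0 $$ (blk n P X, blk n P Y) * \<rho>1 $$ (blk n Q X, blk n Q Y))"

fun cell_gates :: "nat \<Rightarrow> nat \<Rightarrow> nat \<Rightarrow> cell \<Rightarrow> gate list" where
  "cell_gates n c T (a, P, Q, \<theta>) = step n c T a P Q \<theta>"

fun cell_fun :: "nat \<Rightarrow> nat \<Rightarrow> cell \<Rightarrow> (nat set \<Rightarrow> complex) \<Rightarrow> nat set \<Rightarrow> complex" where
  "cell_fun n T (a, P, Q, \<theta>) \<psi> = step_fun n T a P Q \<theta> \<psi>"

lemma cell_fun_eq: "cell_fun n T (a, P, Q, \<theta>) = step_fun n T a P Q \<theta>"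
  by (rule ext) simp

definition cells_fun :: "nat \<Rightarrow> nat \<Rightarrow> cell list \<Rightarrow> (nat set \<Rightarrow> complex) \<Rightarrow> nat set \<Rightarrow> complex" where
  "cells_fun n T cs \<psi> = fold (cell_fun n T) cs \<psi>"

text \<open>Left multiplication by cos \<theta> + \<i> sin \<theta> (\<rho>0 - \<rho>1)/2. It acts
  on one side only because the Hadamard test reads off the coherence between the branch where
  \<open>c\<close> is 0, in which nothing happens, and the branch where \<open>c\<close> is
  1.\<close>

fun cell_evolve :: "nat \<Rightarrow> complex mat \<Rightarrow> complex mat \<Rightarrow> cell \<Rightarrow> (nat \<Rightarrow> nat \<Rightarrow> complex) \<Rightarrow> nat \<Rightarrow> nat \<Rightarrow> complex" where
  "cell_evolve n \<rho>0 \<rho>1 (a, P, Q, \<theta>) \<xi> x y = complex_of_real (cos \<theta>) * \<xi> x y +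
     \<i> * complex_of_real (sin \<theta>) / 2 * (\<Sum>u<2 ^ n. (\<rho>0 $$ (x, u) - \<rho>1 $$ (x, u)) * \<xi> u y)"

text \<open>\<open>D\<close> collects the qubits that the remaining cells have to avoid.\<close>

fun layout :: "nat \<Rightarrow> nat set \<Rightarrow> cell list \<Rightarrow> bool" where
  "layout n D [] \<longleftrightarrow> True"
| "layout n D ((a, P, Q, \<theta>) # cs) \<longleftrightarrow> a \<notin> blkset n P \<and> a \<notin> blkset n Q \<and> blkset n P \<inter> blkset n Q = {} \<and>
     cell_qubits n (a, P, Q, \<theta>) \<inter> D = {} \<and> layout n (D \<union> cell_qubits n (a, P, Q, \<theta>)) cs"

lemma layout_disjoint: "layout n D cs \<Longrightarrow> C \<in> set cs \<Longrightarrow> cell_qubits n C \<inter> D = {}"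
proof (induction cs arbitrary: D)
  case (Cons C' cs)
  obtain a P Q \<theta> where C': "C' = (a, P, Q, \<theta>)" by (cases C')
  have "cell_qubits n C' \<inter> D = {}" "layout n (D \<union> cell_qubits n C') cs"
    using Cons.prems(1) unfolding C' layout.simps by blast+
  thus ?case using Cons.IH Cons.prems(2) by (cases "C = C'") (blast, simp, blast)
qed simp

lemma finite_cell_qubits [simp]: "finite (cell_qubits n C)"
  by (cases C) auto

lemma cell_ker_cong:
  assumes "X \<inter> cell_qubits n C = X' \<inter> cell_qubits n C" "Y \<inter> cell_qubits n C = Y' \<inter> cell_qubits n C"
  shows "cell_ker n \<rho>0 \<rho>1 C X Y = cell_ker n \<rho>0 \<rho>1 C X' Y'"
proof (cases C)
  case (fields a P Q \<theta>)
  have "a \<in> X \<longleftrightarrow> a \<in> X'" "a \<in> Y \<longleftrightarrow> a \<in> Y'" using assms fields by auto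
  moreover have "blk n P X = blk n P X'" "blk n P Y = blk n P Y'" "blk n Q X = blk n Q X'" "blk n Q Y = blk n Q Y'"
    by (intro blk_cong; use assms fields in \<open>auto simp: set_eq_iff\<close>)+
  ultimately show ?thesis using fields by simp
qed

section \<open>Composition of several cells\<close>

lemma linear_op_cells_fun: "linear_op (cells_fun n T cs)"
proof (induction cs)
  case (Cons C cs)
  have "linear_op (cell_fun n T C)" by (cases C) (simp add: cell_fun_eq linear_op_step_fun)
  from linear_op_comp[OF this Cons] show ?case by (simp add: cells_fun_def)
qed (simp add: cells_fun_def linear_op_def)

lemma local_op_cells_fun:
  assumes "B \<inter> blkset n T = {}" "\<And>C. C \<in> set cs \<Longrightarrow> B \<inter> cell_qubits n C = {}"
  shows "local_op B (cells_fun n T cs)"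
  using assms(2)
proof (induction cs)
  case (Cons C cs)
  obtain a P Q \<theta> where C: "C = (a, P, Q, \<theta>)" by (cases C)
  have st: "local_op B (step_fun n T a P Q \<theta>)"
    using Cons.prems[of C] assms(1) by (intro local_op_step_fun) (auto simp: C)
  have "local_op B (cells_fun n T cs)" using Cons by simp
  from local_op_comp[OF st this] show ?case by (simp add: cells_fun_def C)
qed (simp add: cells_fun_def local_op_def)

text \<open>A step changes only the branch containing \<open>c\<close>, and the later cells see
  \<open>c\<close> merely as a parameter, so the branches never mix. This locality is what lets the
  branchwise description compose.\<close>

lemma vec_acts_cells:
  assumes "layout n D cs" "insert c (blkset n T) \<subseteq> D" "c \<notin> blkset n T"
  shows "vec_acts (concat (map (cell_gates n c T) cs)) \<psi> =
    (\<lambda>X. if c \<in> X then cells_fun n T cs \<psi> X else \<psi> X)"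
  using assms(1,2)
proof (induction cs arbitrary: \<psi> D)
  case (Cons C cs)
  obtain a P Q \<theta> where C: "C = (a, P, Q, \<theta>)" by (cases C)
  let ?\<phi> = "step_fun n T a P Q \<theta> \<psi>"
  have st: "vec_acts (step n c T a P Q \<theta>) \<psi> = (\<lambda>X. if c \<in> X then ?\<phi> X else \<psi> X)"
  proof -
    have L: "a \<notin> blkset n P \<and> a \<notin> blkset n Q \<and> blkset n P \<inter> blkset n Q = {} \<and>
        insert a (blkset n P \<union> blkset n Q) \<inter> D = {}"
      using Cons.prems(1) unfolding C layout.simps cell_qubits.simps by blast
    show ?thesis by (rule vec_acts_step) (use L Cons.prems(2) assms(3) in blast)+
  qed
  have lay: "layout n (D \<union> cell_qubits n C) cs" using Cons.prems(1) unfolding C layout.simps by blast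
  have sub: "insert c (blkset n T) \<subseteq> D \<union> cell_qubits n C" using Cons.prems(2) by blast
  have loc: "local_op {c} (cells_fun n T cs)"
    by (rule local_op_cells_fun) (use assms(3) Cons.prems(2) layout_disjoint[OF lay] in blast)+
  have eq: "cells_fun n T cs f X = cells_fun n T cs (\<lambda>X. f (insert c X)) X" if "c \<in> X" for f X
    using local_opD[OF loc, of "{c}" f X] that by (simp add: insert_absorb)
  have "vec_acts (concat (map (cell_gates n c T) (C # cs))) \<psi> =
    (\<lambda>X. if c \<in> X then cells_fun n T cs (\<lambda>X. if c \<in> X then ?\<phi> X else \<psi> X) X else \<psi> X)"
    using Cons.IH[OF lay sub] by (simp add: C st cong: if_cong)
  also have "\<dots> = (\<lambda>X. if c \<in> X then cells_fun n T cs ?\<phi> X else \<psi> X)"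
  proof
    fix X
    have "cells_fun n T cs (\<lambda>X. if c \<in> X then ?\<phi> X else \<psi> X) X = cells_fun n T cs ?\<phi> X" if c: "c \<in> X"
    proof -
      have "cells_fun n T cs (\<lambda>X. if c \<in> X then ?\<phi> X else \<psi> X) X = cells_fun n T cs (\<lambda>X. ?\<phi> (insert c X)) X"
        by (subst eq[OF c]) simp
      thus ?thesis using eq[OF c, of ?\<phi>] by (rule trans[OF _ sym])
    qed
    thus "(if c \<in> X then cells_fun n T cs (\<lambda>X. if c \<in> X then ?\<phi> X else \<psi> X) X else \<psi> X) =
      (if c \<in> X then cells_fun n T cs ?\<phi> X else \<psi> X)" by presburger
  qed
  finally show ?case by (simp only: cells_fun_def C fold_Cons comp_apply cell_fun_eq)
qed (simp add: cells_fun_def cong: if_cong)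

text \<open>The vanishing condition puts the coin into |0> at the start and
  \<open>a \<notin> Y\<close> projects it onto |0> at the end; each side contributes 1/sqrt
  2.\<close>

lemma coin_swap_ground:
  assumes "\<And>X. a \<in> X \<Longrightarrow> \<phi> X = 0" "a \<notin> Y"
    and a: "a \<notin> blkset n T" "a \<notin> blkset n P" "a \<notin> blkset n Q"
  shows "coin_swap n T a P Q \<phi> Y = (\<phi> (swap_blk n T P Y) - \<phi> (swap_blk n T Q Y)) / 2"
proof -
  have s: "complex_of_real (sqrt 2) * complex_of_real (sqrt 2) = 2" by (simp flip: of_real_mult)
  have sq: "x / complex_of_real (sqrt 2) / complex_of_real (sqrt 2) = x / 2" for x
    by (simp add: s)
  have h: "had_fun a \<phi> X = \<phi> (X - {a}) / sqrt 2" for X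
    by (simp add: had_fun_def assms(1))
  have e: "a \<notin> swap_blk n T P Y" using a assms(2) by (simp del: atLeastLessThan_iff)
  have e2: "a \<notin> swap_blk n T Q Y" using a assms(2) by (simp del: atLeastLessThan_iff)
  have i: "insert a Z - {a} = Z" "Z - {a} = Z" if "a \<notin> Z" for Z using that by auto
  show ?thesis
    using assms(2) sq
    by (simp add: coin_swap_def h had_fun_def[of a "\<lambda>X. if a \<in> X then _ X else _ X"] swap_blk_flip[OF a(1,3)] swap_blk_flip[OF a(1,2)] i e e2 s
      diff_divide_distrib add_divide_distrib)
qed

lemma sum_bilinear:
  fixes a b k :: complex and r s f g :: "nat \<Rightarrow> complex"
  shows "(\<Sum>p<N. \<Sum>q<N. (a * (r p * s q) + b * ((f p * s q - r p * g q) / 2)) * k) =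
    (a * ((\<Sum>p<N. r p) * (\<Sum>q<N. s q)) + b * (((\<Sum>p<N. f p) * (\<Sum>q<N. s q) -
      (\<Sum>p<N. r p) * (\<Sum>q<N. g q)) / 2)) * k"
proof -
  have "(\<Sum>q<N. (a * (r p * s q) + b * ((f p * s q - r p * g q) / 2)) * k) =
    (a * (r p * (\<Sum>q<N. s q)) + b * ((f p * (\<Sum>q<N. s q) - r p * (\<Sum>q<N. g q)) / 2)) * k" for p
    by (simp only: sum_distrib_left[symmetric] sum_distrib_right[symmetric] sum.distrib sum_subtractf
        sum_divide_distrib[symmetric])
  thus ?thesis
    by (simp only: sum_distrib_left[symmetric] sum_distrib_right[symmetric] sum.distrib sum_subtractf
        sum_divide_distrib[symmetric])
qed

text \<open>The mechanism behind density matrix exponentiation: tracing P out of SWAP(T,P) (\<xi>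
  tensor \<rho>) leaves the matrix product \<rho> \<xi>. The register that is not swapped
  contributes its trace 1, and the two swaps enter with opposite signs.\<close>

lemma cell_evolve_sum:
  assumes lay: "layout n D ((a, P, Q, \<theta>) # cs)" and D: "blkset n T \<subseteq> D"
    and tr: "(\<Sum>p<2 ^ n. \<rho>0 $$ (p, p)) = 1" "(\<Sum>p<2 ^ n. \<rho>1 $$ (p, p)) = 1"
  defines "B \<equiv> cell_qubits n (a, P, Q, \<theta>)"
  assumes X: "X \<inter> B = {}"
  shows "(\<Sum>Z\<in>Pow B. step_fun n T a P Q \<theta> (\<lambda>X'. \<xi> (blk n T X') (blk n T (X \<union> Z)) *
      (\<Prod>C\<leftarrow>(a, P, Q, \<theta>) # cs. cell_ker n \<rho>0 \<rho>1 C X' (X \<union> Z))) (Y - B \<union> Z)) =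
    cell_evolve n \<rho>0 \<rho>1 (a, P, Q, \<theta>) \<xi> (blk n T Y) (blk n T X) * (\<Prod>C\<leftarrow>cs. cell_ker n \<rho>0 \<rho>1 C Y X)"
proof -
  let ?P = "blkset n P" and ?Q = "blkset n Q" and ?T = "blkset n T"
  have PQ: "?P \<inter> ?Q = {}" and aP: "a \<notin> ?P" and aQ: "a \<notin> ?Q" and aT: "a \<notin> ?T"
    and TP: "?T \<inter> ?P = {}" and TQ: "?T \<inter> ?Q = {}" and BT: "B \<inter> ?T = {}"
  proof -
    have L: "a \<notin> ?P \<and> a \<notin> ?Q \<and> ?P \<inter> ?Q = {} \<and> insert a (?P \<union> ?Q) \<inter> D = {}"
      using lay unfolding layout.simps cell_qubits.simps by blast
    thus "?P \<inter> ?Q = {}" "a \<notin> ?P" "a \<notin> ?Q" by blast+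
    show "a \<notin> ?T" "?T \<inter> ?P = {}" "?T \<inter> ?Q = {}" "B \<inter> ?T = {}"
      unfolding B_def cell_qubits.simps using L D by blast+
  qed
  have lay': "layout n (D \<union> B) cs" using lay unfolding B_def layout.simps by blast
  have BC: "cell_qubits n C \<inter> B = {}" "cell_qubits n C \<inter> ?T = {}" if "C \<in> set cs" for C
    using layout_disjoint[OF lay' that] D by blast+
  have B: "B = insert a (?P \<union> ?Q)" by (simp add: B_def)
  define R where "R Y = (\<Prod>C\<leftarrow>cs. cell_ker n \<rho>0 \<rho>1 C Y X)" for Y
  define \<phi> where "\<phi> Z X' = \<xi> (blk n T X') (blk n T (X \<union> Z)) *
      (\<Prod>C\<leftarrow>(a, P, Q, \<theta>) # cs. cell_ker n \<rho>0 \<rho>1 C X' (X \<union> Z))" for Z X'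
  have R: "(\<Prod>C\<leftarrow>cs. cell_ker n \<rho>0 \<rho>1 C X' (X \<union> Z)) = R Y'"
    if "Z \<subseteq> B" "\<And>k. k \<notin> B \<union> ?T \<Longrightarrow> k \<in> X' \<longleftrightarrow> k \<in> Y'" for Z X' Y'
    unfolding R_def
  proof (intro arg_cong[where f = prod_list] map_cong refl cell_ker_cong)
    fix C assume C: "C \<in> set cs"
    show "X' \<inter> cell_qubits n C = Y' \<inter> cell_qubits n C" using BC[OF C] that(2) by blast
    show "(X \<union> Z) \<inter> cell_qubits n C = X \<inter> cell_qubits n C" using BC[OF C] that(1) by blast
  qed
  have bT: "blk n T (X \<union> Z) = blk n T X" if "Z \<subseteq> B" for Z
    by (rule blk_cong) (use that BT in blast)
  have bP: "blk n P (X \<union> Z) = blk n P Z" for Z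
    by (rule blk_cong) (use X B in blast)
  have bQ: "blk n Q (X \<union> Z) = blk n Q Z" for Z
    by (rule blk_cong) (use X B in blast)
  have aX: "a \<notin> X" using X B by auto
  have \<phi>: "\<phi> Z X' = of_bool (a \<notin> X' \<and> a \<notin> Z) * (\<xi> (blk n T X') (blk n T X) * (\<rho>0 $$ (blk n P X', blk n P Z) *
      \<rho>1 $$ (blk n Q X', blk n Q Z)) * R Y')"
    if "Z \<subseteq> B" "\<And>k. k \<notin> B \<union> ?T \<Longrightarrow> k \<in> X' \<longleftrightarrow> k \<in> Y'" for Z X' Y'
    unfolding \<phi>_def using R[OF that] bT[OF that(1)] bP bQ aX by simp
  define F where "F Z = step_fun n T a P Q \<theta> (\<phi> Z) (Y - B \<union> Z)" for Z
  \<comment> \<open>These are the diagonal terms whose column index has the coin at 1, where the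
    initial kernel vanishes identically; only coin state 0 survives the partial trace.\<close>
  have F1: "F (insert a Z) = 0" if "Z \<subseteq> B" for Z
  proof -
    have "\<phi> (insert a Z) = (\<lambda>_. 0)"
      using \<phi>[of "insert a Z" X' X' for X'] that by (auto simp: fun_eq_iff B)
    thus ?thesis unfolding F_def using linear_op_zero[OF linear_op_step_fun] by simp
  qed
  define H where "H p q = (cos \<theta> * \<xi> (blk n T Y) (blk n T X) * (\<rho>0 $$ (p, p) * \<rho>1 $$ (q, q)) +
     \<i> * sin \<theta> * (((\<xi> p (blk n T X) * \<rho>0 $$ (blk n T Y, p)) * \<rho>1 $$ (q, q) -
       \<rho>0 $$ (p, p) * (\<xi> q (blk n T X) * \<rho>1 $$ (blk n T Y, q))) / 2)) * R Y" for p q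
  have F0: "F Z = H (blk n P Z) (blk n Q Z)" if Z: "Z \<subseteq> ?P \<union> ?Q" for Z
  proof -
    define Y' where "Y' = Y - B \<union> Z"
    have ZB: "Z \<subseteq> B" and aZ: "a \<notin> Z" and aY': "a \<notin> Y'"
      using Z B aP aQ by (auto simp: Y'_def)
    have b: "blk n T Y' = blk n T Y" "blk n P Y' = blk n P Z" "blk n Q Y' = blk n Q Z"
      by (intro blk_cong; use BT Z B in \<open>auto simp: Y'_def\<close>)+
    have e1: "\<phi> Z Y' = \<xi> (blk n T Y) (blk n T X) * (\<rho>0 $$ (blk n P Z, blk n P Z) * \<rho>1 $$ (blk n Q Z, blk n Q Z)) * R Y"
      by (subst \<phi>[where Y' = Y]) (use ZB aZ aY' b in \<open>auto simp: Y'_def\<close>)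
    have out: "k \<in> swap_blk n T P Y' \<longleftrightarrow> k \<in> Y" "k \<in> swap_blk n T Q Y' \<longleftrightarrow> k \<in> Y" if "k \<notin> B \<union> ?T" for k
    proof -
      have "k \<notin> ?T" "k \<notin> ?P" "k \<notin> ?Q" "k \<notin> B" using that B by blast+
      thus "k \<in> swap_blk n T P Y' \<longleftrightarrow> k \<in> Y" "k \<in> swap_blk n T Q Y' \<longleftrightarrow> k \<in> Y"
        using ZB by (auto simp: Y'_def simp del: atLeastLessThan_iff)
    qed
    have a': "a \<notin> swap_blk n T P Y'" "a \<notin> swap_blk n T Q Y'"
      using aT aP aQ aY' by (simp_all del: atLeastLessThan_iff)
    have QP: "?Q \<inter> ?P = {}" "?Q \<inter> ?T = {}" "?P \<inter> ?T = {}" using PQ TQ TP by blast+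
    have e2: "\<phi> Z (swap_blk n T P Y') = \<xi> (blk n P Z) (blk n T X) *
        (\<rho>0 $$ (blk n T Y, blk n P Z) * \<rho>1 $$ (blk n Q Z, blk n Q Z)) * R Y"
      by (subst \<phi>[OF ZB out(1)]) (use a' aZ b blk_swap_blk[OF TP] blk_swap_blk_outside[OF QP(2,1)] in auto)
    have e3: "\<phi> Z (swap_blk n T Q Y') = \<xi> (blk n Q Z) (blk n T X) *
        (\<rho>0 $$ (blk n P Z, blk n P Z) * \<rho>1 $$ (blk n T Y, blk n Q Z)) * R Y"
      by (subst \<phi>[OF ZB out(2)]) (use a' aZ b blk_swap_blk[OF TQ] blk_swap_blk_outside[OF QP(3) PQ] in auto)
    have gr: "\<phi> Z X' = 0" if "a \<in> X'" for X'
      using \<phi>[OF ZB, of X' X'] that by simp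
    have cs: "coin_swap n T a P Q (\<phi> Z) Y' = (\<phi> Z (swap_blk n T P Y') - \<phi> Z (swap_blk n T Q Y')) / 2"
      by (rule coin_swap_ground[OF _ aY' aT aP aQ]) (rule gr)
    show ?thesis
      unfolding F_def step_fun_def Y'_def[symmetric] cs e1 e2 e3 H_def
      by (simp add: algebra_simps diff_divide_distrib)
  qed
  have "(\<Sum>Z\<in>Pow B. F Z) = (\<Sum>Z\<in>Pow (?P \<union> ?Q). F Z + F (insert a Z))"
  proof -
    have "finite (?P \<union> ?Q)" "a \<notin> ?P \<union> ?Q" using aP aQ by blast+
    thus ?thesis unfolding B by (rule sum_Pow_insert)
  qed
  also have "\<dots> = (\<Sum>Z\<in>Pow (?P \<union> ?Q). H (blk n P Z) (blk n Q Z))"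
  proof (rule sum.cong[OF refl])
    fix Z assume "Z \<in> Pow (?P \<union> ?Q)"
    hence "Z \<subseteq> ?P \<union> ?Q" "Z \<subseteq> B" using B by blast+
    thus "F Z + F (insert a Z) = H (blk n P Z) (blk n Q Z)" using F0 F1 by simp
  qed
  also have "\<dots> = (\<Sum>Z1\<in>Pow ?P. \<Sum>Z2\<in>Pow ?Q. H (blk n P Z1) (blk n Q Z2))"
  proof (subst sum_Pow_Un)
    have b: "blk n P (Z1 \<union> Z2) = blk n P Z1" "blk n Q (Z1 \<union> Z2) = blk n Q Z2" if "Z1 \<subseteq> ?P" "Z2 \<subseteq> ?Q" for Z1 Z2
      by (intro blk_cong; use that PQ in blast)+
    show "(\<Sum>Z1\<in>Pow ?P. \<Sum>Z2\<in>Pow ?Q. H (blk n P (Z1 \<union> Z2)) (blk n Q (Z1 \<union> Z2))) =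
      (\<Sum>Z1\<in>Pow ?P. \<Sum>Z2\<in>Pow ?Q. H (blk n P Z1) (blk n Q Z2))"
      by (intro sum.cong refl) (simp add: b)
  qed (use PQ in auto)
  also have "\<dots> = (\<Sum>p<2 ^ n. \<Sum>q<2 ^ n. H p q)"
    using sum_blk[of "\<lambda>p. \<Sum>Z2\<in>Pow ?Q. H p (blk n Q Z2)" n P] sum_blk[of "H _" n Q] by simp
  also have "\<dots> = (cos \<theta> * \<xi> (blk n T Y) (blk n T X) * ((\<Sum>p<2 ^ n. \<rho>0 $$ (p, p)) * (\<Sum>q<2 ^ n. \<rho>1 $$ (q, q))) +
     \<i> * sin \<theta> * (((\<Sum>p<2 ^ n. \<xi> p (blk n T X) * \<rho>0 $$ (blk n T Y, p)) * (\<Sum>q<2 ^ n. \<rho>1 $$ (q, q)) -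
       (\<Sum>p<2 ^ n. \<rho>0 $$ (p, p)) * (\<Sum>q<2 ^ n. \<xi> q (blk n T X) * \<rho>1 $$ (blk n T Y, q))) / 2)) * R Y"
    unfolding H_def by (rule sum_bilinear)
  also have "\<dots> = cell_evolve n \<rho>0 \<rho>1 (a, P, Q, \<theta>) \<xi> (blk n T Y) (blk n T X) * R Y"
    unfolding tr by (simp add: sum_subtractf left_diff_distrib right_diff_distrib mult_ac)
  finally show ?thesis unfolding F_def \<phi>_def R_def .
qed

fun cells_evolve :: "nat \<Rightarrow> complex mat \<Rightarrow> complex mat \<Rightarrow> cell list \<Rightarrow> (nat \<Rightarrow> nat \<Rightarrow> complex) \<Rightarrow> nat \<Rightarrow> nat \<Rightarrow> complex" where
  "cells_evolve n \<rho>0 \<rho>1 [] \<xi> = \<xi>"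
| "cells_evolve n \<rho>0 \<rho>1 (C # cs) \<xi> = cells_evolve n \<rho>0 \<rho>1 cs (cell_evolve n \<rho>0 \<rho>1 C \<xi>)"

lemma cells_fun_Cons: "cells_fun n T (C # cs) \<psi> = cells_fun n T cs (cell_fun n T C \<psi>)"
  by (simp add: cells_fun_def)

text \<open>Each cell is traced out directly after its own step. Postponing the remaining steps is
  legitimate because they act as the identity on the qubits of that cell (\<open>local_op\<close>)
  and are linear, so they can be pulled out of the partial trace.\<close>

lemma trace_cells:
  assumes "layout n D cs" "blkset n T \<subseteq> D"
    and tr: "(\<Sum>p<2 ^ n. \<rho>0 $$ (p, p)) = 1" "(\<Sum>p<2 ^ n. \<rho>1 $$ (p, p)) = 1"
  shows "(\<Sum>X\<in>Pow (blkset n T \<union> (\<Union>C\<in>set cs. cell_qubits n C)). cells_fun n T cs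
      (\<lambda>X'. \<xi> (blk n T X') (blk n T X) * (\<Prod>C\<leftarrow>cs. cell_ker n \<rho>0 \<rho>1 C X' X)) X) =
    (\<Sum>t<2 ^ n. cells_evolve n \<rho>0 \<rho>1 cs \<xi> t t)"
  using assms(1,2)
proof (induction cs arbitrary: \<xi> D)
  case Nil
  show ?case using sum_blk[of "\<lambda>t. \<xi> t t" n T] by (simp add: cells_fun_def)
next
  case (Cons C cs)
  obtain a P Q \<theta> where C: "C = (a, P, Q, \<theta>)" by (cases C)
  define B where "B = cell_qubits n C"
  define G where "G = blkset n T \<union> (\<Union>C\<in>set cs. cell_qubits n C)"
  have lay: "layout n (D \<union> B) cs" using Cons.prems(1) unfolding B_def C layout.simps by blast
  have BD: "B \<inter> D = {}" using Cons.prems(1) unfolding B_def C layout.simps by blast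
  have BC: "B \<inter> cell_qubits n C' = {}" if "C' \<in> set cs" for C'
    using layout_disjoint[OF lay that] by blast
  have BT: "B \<inter> blkset n T = {}" using BD Cons.prems(2) by blast
  have GB: "G \<inter> B = {}" unfolding G_def using BC BT by blast
  have fin: "finite G" "finite B" by (auto simp: G_def B_def)
  have loc: "local_op B (cells_fun n T cs)" by (rule local_op_cells_fun[OF BT BC])
  define \<phi> where "\<phi> Y X' = \<xi> (blk n T X') (blk n T Y) * (\<Prod>C\<leftarrow>C # cs. cell_ker n \<rho>0 \<rho>1 C X' Y)" for Y X'
  have "(\<Sum>X\<in>Pow (blkset n T \<union> (\<Union>C\<in>set (C # cs). cell_qubits n C)). cells_fun n T (C # cs) (\<phi> X) X) =
    (\<Sum>X\<in>Pow (G \<union> B). cells_fun n T cs (cell_fun n T C (\<phi> X)) X)"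
    unfolding G_def B_def cells_fun_Cons by (intro sum.cong refl) auto
  also have "\<dots> = (\<Sum>X\<in>Pow G. \<Sum>Z\<in>Pow B. cells_fun n T cs (cell_fun n T C (\<phi> (X \<union> Z))) (X \<union> Z))"
    by (rule sum_Pow_Un[OF fin GB])
  also have "\<dots> = (\<Sum>X\<in>Pow G. cells_fun n T cs (\<lambda>X'. cell_evolve n \<rho>0 \<rho>1 C \<xi> (blk n T X') (blk n T X) *
      (\<Prod>C\<leftarrow>cs. cell_ker n \<rho>0 \<rho>1 C X' X)) X)"
  proof (rule sum.cong[OF refl])
    fix X assume "X \<in> Pow G"
    hence XB: "X \<inter> B = {}" using GB by blast
    hence e: "X - B = X" by blast
    have "(\<Sum>Z\<in>Pow B. cells_fun n T cs (cell_fun n T C (\<phi> (X \<union> Z))) (X \<union> Z)) =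
      (\<Sum>Z\<in>Pow B. cells_fun n T cs (\<lambda>X'. cell_fun n T C (\<phi> (X \<union> Z)) (X' - B \<union> Z)) X)"
    proof (rule sum.cong[OF refl])
      fix Z assume "Z \<in> Pow B"
      hence "Z \<subseteq> B" by simp
      from local_opD[OF loc this, of "cell_fun n T C (\<phi> (X \<union> Z))" X]
      show "cells_fun n T cs (cell_fun n T C (\<phi> (X \<union> Z))) (X \<union> Z) =
        cells_fun n T cs (\<lambda>X'. cell_fun n T C (\<phi> (X \<union> Z)) (X' - B \<union> Z)) X"
        unfolding e .
    qed
    also have "\<dots> = cells_fun n T cs (\<lambda>X'. \<Sum>Z\<in>Pow B. cell_fun n T C (\<phi> (X \<union> Z)) (X' - B \<union> Z)) X"
      unfolding linear_op_sum[OF linear_op_cells_fun] ..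
    also have "(\<lambda>X'. \<Sum>Z\<in>Pow B. cell_fun n T C (\<phi> (X \<union> Z)) (X' - B \<union> Z)) =
      (\<lambda>X'. cell_evolve n \<rho>0 \<rho>1 C \<xi> (blk n T X') (blk n T X) * (\<Prod>C\<leftarrow>cs. cell_ker n \<rho>0 \<rho>1 C X' X))"
      unfolding \<phi>_def B_def C cell_fun_eq
      by (rule ext, rule cell_evolve_sum[OF Cons.prems(1)[unfolded C] Cons.prems(2) tr XB[unfolded B_def C]])
    finally show "(\<Sum>Z\<in>Pow B. cells_fun n T cs (cell_fun n T C (\<phi> (X \<union> Z))) (X \<union> Z)) =
      cells_fun n T cs (\<lambda>X'. cell_evolve n \<rho>0 \<rho>1 C \<xi> (blk n T X') (blk n T X) *
      (\<Prod>C\<leftarrow>cs. cell_ker n \<rho>0 \<rho>1 C X' X)) X" .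
  qed
  also have "\<dots> = (\<Sum>t<2 ^ n. cells_evolve n \<rho>0 \<rho>1 cs (cell_evolve n \<rho>0 \<rho>1 C \<xi>) t t)"
    unfolding G_def by (rule Cons.IH[OF lay]) (use Cons.prems(2) in blast)
  finally show ?case unfolding \<phi>_def by simp
qed

text \<open>The second register of the first cell of a test is not used; it is traced out.\<close>

lemma trace_unused:
  assumes lay: "layout n D cs" "blkset n T \<subseteq> D" "blkset n S \<subseteq> D" "blkset n T \<inter> blkset n S = {}"
    and tr: "(\<Sum>p<2 ^ n. \<sigma> $$ (p, p)) = (1 :: complex)"
    and f: "\<And>X Z Y W. Z \<subseteq> blkset n S \<Longrightarrow> W \<subseteq> blkset n S \<Longrightarrow> f (X - blkset n S \<union> Z) (Y - blkset n S \<union> W) = f X Y"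
  defines "G \<equiv> blkset n T \<union> (\<Union>C\<in>set cs. cell_qubits n C)"
  shows "(\<Sum>X\<in>Pow (blkset n S \<union> G). cells_fun n T cs (\<lambda>X'. \<sigma> $$ (blk n S X', blk n S X) * f X' X) X) =
    (\<Sum>X\<in>Pow G. cells_fun n T cs (\<lambda>X'. f X' X) X)"
proof -
  let ?S = "blkset n S"
  have SC: "?S \<inter> cell_qubits n C' = {}" if "C' \<in> set cs" for C'
    using layout_disjoint[OF lay(1) that] lay(3) by blast
  have ST: "?S \<inter> blkset n T = {}" using lay(4) by blast
  have loc: "local_op ?S (cells_fun n T cs)" by (rule local_op_cells_fun[OF ST SC])
  have lin: "linear_op (cells_fun n T cs)" by (rule linear_op_cells_fun)
  have GS: "G \<inter> ?S = {}" unfolding G_def using SC ST by blast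
  have fin: "finite G" by (auto simp: G_def)
  have "(\<Sum>X\<in>Pow (?S \<union> G). cells_fun n T cs (\<lambda>X'. \<sigma> $$ (blk n S X', blk n S X) * f X' X) X) =
    (\<Sum>X\<in>Pow G. \<Sum>Z\<in>Pow ?S. cells_fun n T cs (\<lambda>X'. \<sigma> $$ (blk n S X', blk n S (X \<union> Z)) * f X' (X \<union> Z)) (X \<union> Z))"
    unfolding Un_commute[of ?S G] by (rule sum_Pow_Un[OF fin _ GS]) simp
  also have "\<dots> = (\<Sum>X\<in>Pow G. cells_fun n T cs (\<lambda>X'. f X' X) X)"
  proof (rule sum.cong[OF refl])
    fix X assume "X \<in> Pow G"
    hence e: "X - ?S = X" using GS by blast
    have "cells_fun n T cs (\<lambda>X'. \<sigma> $$ (blk n S X', blk n S (X \<union> Z)) * f X' (X \<union> Z)) (X \<union> Z) =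
      \<sigma> $$ (blk n S Z, blk n S Z) * cells_fun n T cs (\<lambda>X'. f X' X) X" if "Z \<in> Pow ?S" for Z
    proof -
      have Z: "Z \<subseteq> ?S" using that by simp
      have b: "blk n S (X - ?S \<union> Z) = blk n S Z" for X
        by (rule blk_cong) (use Z in blast)
      have b': "blk n S (X \<union> Z) = blk n S Z" "f X' (X \<union> Z) = f X' X" "f (X' - ?S \<union> Z) X = f X' X" for X'
        using b[of X] f[OF Z Z, of X' X] f[of "X' \<inter> ?S" "X' \<inter> ?S"] unfolding e
          apply -
        subgoal by simp
        subgoal using f[of "X' \<inter> ?S" Z X' X] Z e by (simp add: Un_Diff_Int)
        subgoal using f[of Z "{}" X' X] Z e by simp
        done
      have "cells_fun n T cs (\<lambda>X'. \<sigma> $$ (blk n S X', blk n S (X \<union> Z)) * f X' (X \<union> Z)) (X - ?S \<union> Z) =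
        cells_fun n T cs (\<lambda>X'. \<sigma> $$ (blk n S Z, blk n S Z) * f X' X) X"
        unfolding local_opD[OF loc Z] b b' ..
      thus ?thesis unfolding e linear_op_mult[OF lin] .
    qed
    hence "(\<Sum>Z\<in>Pow ?S. cells_fun n T cs (\<lambda>X'. \<sigma> $$ (blk n S X', blk n S (X \<union> Z)) * f X' (X \<union> Z)) (X \<union> Z)) =
      (\<Sum>Z\<in>Pow ?S. \<sigma> $$ (blk n S Z, blk n S Z)) * cells_fun n T cs (\<lambda>X'. f X' X) X"
      by (simp add: sum_distrib_right)
    thus "(\<Sum>Z\<in>Pow ?S. cells_fun n T cs (\<lambda>X'. \<sigma> $$ (blk n S X', blk n S (X \<union> Z)) * f X' (X \<union> Z)) (X \<union> Z)) =
      cells_fun n T cs (\<lambda>X'. f X' X) X"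
      unfolding sum_blk[of "\<lambda>p. \<sigma> $$ (p, p)"] tr by simp
  qed
  finally show ?thesis .
qed

section \<open>The Hadamard test\<close>

text \<open>A phase gate after a Hadamard gate on the control qubit.\<close>

definition prep :: "nat \<Rightarrow> complex \<Rightarrow> gate" where
  "prep c \<zeta> = Gate1 c (Matrix.mat 2 2 (\<lambda>(i, j).
     (if i = 0 then 1 else if j = 0 then \<zeta> else - \<zeta>) / complex_of_real (sqrt 2)))"

lemma valid_prep:
  assumes "c < N" "cmod \<zeta> = 1" shows "valid_gate N (prep c \<zeta>)"
proof -
  let ?U = "Matrix.mat 2 2 (\<lambda>(i, j). (if i = 0 then 1 else if j = 0 then \<zeta> else - \<zeta>) / complex_of_real (sqrt 2))"
  have s: "complex_of_real (sqrt 2) * complex_of_real (sqrt 2) = 2"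
    by (simp flip: of_real_mult)
  have z: "cnj \<zeta> * \<zeta> = 1" using assms(2) complex_norm_square[of \<zeta>] by (simp add: mult.commute)
  have "unitary_mat 2 ?U"
  proof (rule unitary_matI)
    show "mat_adjoint ?U * ?U = 1\<^sub>m 2"
      by (rule eq_matI) (auto simp: scalar_prod_def numeral_2_eq_2 less_Suc_eq s z)
  qed auto
  thus ?thesis using assms by (simp add: prep_def)
qed

definition test_gates :: "nat \<Rightarrow> complex \<Rightarrow> nat \<Rightarrow> nat \<Rightarrow> cell list \<Rightarrow> gate list" where
  "test_gates n \<zeta> c T cs = prep c \<zeta> # concat (map (cell_gates n c T) cs) @ [had c]"

lemma ker_acts_rep:
  assumes "\<And>X Y. s X Y = (\<Sum>v\<leftarrow>vs. v X * cnj (v Y))"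
  shows "ker_acts gs s X Y = (\<Sum>v\<leftarrow>vs. vec_acts gs v X * cnj (vec_acts gs v Y))"
  using assms
proof (induction gs arbitrary: s vs X Y)
  case (Cons g gs)
  have "ker_act g s X Y = (\<Sum>v\<leftarrow>map (vec_act g) vs. v X * cnj (v Y))" for X Y
    unfolding ker_act_eq Cons.prems
    by (induction vs) (simp_all add: distrib_left sum.distrib sum_product vec_act_def mult_ac)
  from Cons.IH[OF this, of X Y] show ?case by (simp add: o_def)
qed simp

text \<open>The Hadamard test, one rank one term at a time. If p and q are the components of the two
  branches of \<open>c\<close> before the last Hadamard gate, the probabilities of 0 and 1 differ by
  twice the real part of q times the conjugate of p, which is the real part of \<zeta> times the
  overlap of v with its evolved version.\<close>

lemma test_expectation:
  assumes lay: "layout n D cs" "insert c (blkset n T) \<subseteq> D" "c \<notin> blkset n T"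
    and G: "finite G" "c \<notin> G"
    and s: "gram s" "\<And>X Y. s (X - {c}) (Y - {c}) = s X Y"
  shows "(\<Sum>X\<in>Pow (insert c G). (if c \<in> X then - 1 else 1) *
      ker_acts (test_gates n \<zeta> c T cs) (\<lambda>X Y. of_bool (c \<notin> X \<and> c \<notin> Y) * s X Y) X X) =
    complex_of_real (Re (\<zeta> * (\<Sum>X\<in>Pow G. cells_fun n T cs (\<lambda>X'. s X' X) X)))"
proof -
  let ?W = "cells_fun n T cs"
  have lin: "linear_op ?W" by (rule linear_op_cells_fun)
  have loc: "local_op {c} ?W"
    by (rule local_op_cells_fun) (use lay layout_disjoint[OF lay(1)] in blast)+
  obtain ws where ws: "\<And>X Y. s X Y = (\<Sum>v\<leftarrow>ws. v X * cnj (v Y))"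
    using s(1) unfolding gram_def by blast
  \<comment> \<open>Although \<open>s\<close> does not depend on \<open>c\<close>, its rank one
    terms may. Evaluating them at \<open>X - {c}\<close> removes this dependence and leaves the sum
    unchanged.\<close>
  define vs where "vs = map (\<lambda>v X. v (X - {c})) ws"
  have vs: "s X Y = (\<Sum>v\<leftarrow>vs. v X * cnj (v Y))" for X Y
    using ws[of "X - {c}" "Y - {c}"] s(2)[of X Y] by (simp add: vs_def o_def)
  have vc: "v (insert c X) = v X" if "v \<in> set vs" for v X
    using that by (auto simp: vs_def)
  define us where "us = map (\<lambda>v X. of_bool (c \<notin> X) * v X) vs"
  have us: "of_bool (c \<notin> X \<and> c \<notin> Y) * s X Y = (\<Sum>v\<leftarrow>us. v X * cnj (v Y))" for X Y
    unfolding vs us_def by (auto simp: o_def)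
  define \<kappa> where "\<kappa> v = vec_acts (test_gates n \<zeta> c T cs) (\<lambda>X. of_bool (c \<notin> X) * v X)" for v
  have K: "ker_acts (test_gates n \<zeta> c T cs) (\<lambda>X Y. of_bool (c \<notin> X \<and> c \<notin> Y) * s X Y) X X =
    (\<Sum>v\<leftarrow>vs. \<kappa> v X * cnj (\<kappa> v X))" for X
    by (subst ker_acts_rep[OF us]) (simp add: us_def \<kappa>_def o_def)
  have sq: "x / complex_of_real (sqrt 2) / complex_of_real (sqrt 2) = x / 2" for x
    by (simp flip: of_real_mult)
  have diff: "\<kappa> v X * cnj (\<kappa> v X) - \<kappa> v (insert c X) * cnj (\<kappa> v (insert c X)) =
      complex_of_real (Re (\<zeta> * (?W v X * cnj (v X))))" if v: "v \<in> set vs" and X: "c \<notin> X" for v X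
  proof -
    define \<eta> where "\<eta> = vec_act (prep c \<zeta>) (\<lambda>X. of_bool (c \<notin> X) * v X)"
    have \<eta>: "\<eta> X = (if c \<in> X then \<zeta> else 1) / complex_of_real (sqrt 2) * v X" for X
      using vc[OF v, of "X - {c}"]
      by (cases "c \<in> X") (auto simp: \<eta>_def vec_act_def prep_def sum_Pow_insert insert_absorb)
    define \<eta>' where "\<eta>' X = (if c \<in> X then ?W \<eta> X else \<eta> X)" for X
    have \<kappa>: "\<kappa> v = had_fun c \<eta>'"
      using vec_acts_cells[OF lay, of \<eta>]
      by (simp add: \<kappa>_def test_gates_def \<eta>_def[symmetric] \<eta>'_def[abs_def])
    have "?W \<eta> (X - {c} \<union> {c}) = ?W (\<lambda>X. \<eta> (X - {c} \<union> {c})) X" by (rule local_opD[OF loc]) simp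
    also have "(\<lambda>X. \<eta> (X - {c} \<union> {c})) = (\<lambda>X. \<zeta> / complex_of_real (sqrt 2) * v X)"
      using vc[OF v] by (auto simp: \<eta> fun_eq_iff)
    finally have 1: "\<eta>' (insert c X) = \<zeta> / complex_of_real (sqrt 2) * ?W v X"
      unfolding linear_op_mult[OF lin] by (simp add: \<eta>'_def)
    have 0: "\<eta>' X = v X / complex_of_real (sqrt 2)" using X by (simp add: \<eta>'_def \<eta>)
    define p q where "p = \<eta>' X" and "q = \<eta>' (insert c X)"
    have h: "\<kappa> v X = (p + q) / complex_of_real (sqrt 2)" "\<kappa> v (insert c X) = (p - q) / complex_of_real (sqrt 2)"
      using X by (simp_all add: \<kappa> had_fun_def p_def q_def)
    have "\<kappa> v X * cnj (\<kappa> v X) - \<kappa> v (insert c X) * cnj (\<kappa> v (insert c X)) =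
      ((p + q) * cnj (p + q) - (p - q) * cnj (p - q)) / complex_of_real (sqrt 2) / complex_of_real (sqrt 2)"
      unfolding h by (simp flip: diff_divide_distrib)
    also have "\<dots> = q * cnj p + cnj (q * cnj p)"
      unfolding sq by (simp add: algebra_simps)
    also have "\<dots> = complex_of_real (2 * Re (q * cnj p))" by (simp only: complex_add_cnj)
    also have "q * cnj p = \<zeta> * (?W v X * cnj (v X)) / complex_of_real (sqrt 2) / complex_of_real (sqrt 2)"
      unfolding p_def q_def 0 1 by simp
    also have "2 * Re \<dots> = Re (\<zeta> * (?W v X * cnj (v X)))"
      unfolding sq by simp
    finally show ?thesis .
  qed
  have "(\<Sum>X\<in>Pow (insert c G). (if c \<in> X then - 1 else 1) *
      ker_acts (test_gates n \<zeta> c T cs) (\<lambda>X Y. of_bool (c \<notin> X \<and> c \<notin> Y) * s X Y) X X) =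
    (\<Sum>X\<in>Pow G. \<Sum>v\<leftarrow>vs. \<kappa> v X * cnj (\<kappa> v X) - \<kappa> v (insert c X) * cnj (\<kappa> v (insert c X)))"
    unfolding K using G by (subst sum_Pow_insert) (auto intro!: sum.cong simp: sum_list_subtractf)
  also have "\<dots> = (\<Sum>X\<in>Pow G. \<Sum>v\<leftarrow>vs. complex_of_real (Re (\<zeta> * (?W v X * cnj (v X)))))"
  proof (intro sum.cong refl arg_cong[where f = sum_list] map_cong)
    fix X v assume "X \<in> Pow G" "v \<in> set vs"
    thus "\<kappa> v X * cnj (\<kappa> v X) - \<kappa> v (insert c X) * cnj (\<kappa> v (insert c X)) =
      complex_of_real (Re (\<zeta> * (?W v X * cnj (v X))))"
      using G by (intro diff) auto
  qed
  also have "\<dots> = (\<Sum>X\<in>Pow G. complex_of_real (Re (\<zeta> * (\<Sum>v\<leftarrow>vs. ?W v X * cnj (v X)))))"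
  proof (intro sum.cong refl)
    fix X
    show "(\<Sum>v\<leftarrow>vs. complex_of_real (Re (\<zeta> * (?W v X * cnj (v X))))) =
      complex_of_real (Re (\<zeta> * (\<Sum>v\<leftarrow>vs. ?W v X * cnj (v X))))"
      by (induction vs) (simp_all add: distrib_left)
  qed
  also have "\<dots> = complex_of_real (Re (\<zeta> * (\<Sum>X\<in>Pow G. \<Sum>v\<leftarrow>vs. ?W v X * cnj (v X))))"
    by (simp add: sum_distrib_left)
  also have "(\<Sum>X\<in>Pow G. \<Sum>v\<leftarrow>vs. ?W v X * cnj (v X)) = (\<Sum>X\<in>Pow G. ?W (\<lambda>X'. s X' X) X)"
  proof (rule sum.cong[OF refl])
    fix X
    have "?W (\<lambda>X'. \<Sum>v\<leftarrow>vs. cnj (v X) * v X') X = (\<Sum>v\<leftarrow>vs. ?W v X * cnj (v X))"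
      unfolding linear_op_sum_list[OF lin] linear_op_mult[OF lin] by (simp add: mult.commute)
    thus "(\<Sum>v\<leftarrow>vs. ?W v X * cnj (v X)) = ?W (\<lambda>X'. s X' X) X"
      by (simp add: vs mult.commute)
  qed
  finally show ?thesis .
qed

section \<open>Spectral decomposition\<close>

lemma mat_adjoint_mult:
  assumes "A \<in> carrier_mat n m" "B \<in> carrier_mat m k"
  shows "mat_adjoint (A * B) = mat_adjoint B * mat_adjoint (A :: complex mat)"
  by (rule eq_matI) (use assms in \<open>auto simp: scalar_prod_def mult.commute\<close>)

lemma mat_adjoint_adjoint [simp]: "mat_adjoint (mat_adjoint A) = (A :: complex mat)"
  by (rule eq_matI) auto

lemma unitary_mult:
  assumes "unitary_mat d U" "unitary_mat d V" shows "unitary_mat d (U * V)"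
proof (rule unitary_matI)
  have c: "U \<in> carrier_mat d d" "V \<in> carrier_mat d d" "mat_adjoint U \<in> carrier_mat d d" "mat_adjoint V \<in> carrier_mat d d"
    using assms mat_adjoint_carrier by (auto simp: unitary_mat_def)
  show "U * V \<in> carrier_mat d d" using c by simp
  have "mat_adjoint (U * V) * (U * V) = mat_adjoint V * (mat_adjoint U * (U * V))"
    unfolding mat_adjoint_mult[OF c(1,2)] by (rule assoc_mult_mat[OF c(4,3) mult_carrier_mat[OF c(1,2)]])
  also have "mat_adjoint U * (U * V) = mat_adjoint U * U * V"
    by (rule assoc_mult_mat[OF c(3,1,2), symmetric])
  also have "mat_adjoint U * U = 1\<^sub>m d" using assms by (simp add: unitary_mat_def)
  also have "1\<^sub>m d * V = V" using c by simp
  also have "mat_adjoint V * V = 1\<^sub>m d" using assms by (simp add: unitary_mat_def)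
  finally show "mat_adjoint (U * V) * (U * V) = 1\<^sub>m d" .
qed

lemma unitary_one: "unitary_mat d (1\<^sub>m d)"
proof -
  have 1: "mat_adjoint (1\<^sub>m d) = (1\<^sub>m d :: complex mat)"
    by (rule eq_matI) simp_all
  show ?thesis unfolding unitary_mat_def 1 by simp
qed

text \<open>Used to split off an eigenvector. \<open>gram_schmidt\<close> keeps the first vector and
  only orthogonalises, hence the division by the lengths and the scalar \<open>k\<close>.\<close>

lemma exists_unitary_first_col:
  assumes v: "(v :: complex Matrix.vec) \<in> carrier_vec d" and v0: "v \<noteq> 0\<^sub>v d" and d: "0 < d"
  shows "\<exists>W k. unitary_mat d W \<and> k \<noteq> 0 \<and> col W 0 = k \<cdot>\<^sub>v v"
proof -
  interpret cof_vec_space d "TYPE(complex)" .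
  define ws where "ws = gram_schmidt d (basis_completion v)"
  note bc = basis_completion[OF v v0]
  note gs = gram_schmidt_result[OF bc(2) bc(4) bc(5) ws_def]
  have len: "length ws = d" using gs(4) bc(6) by simp
  have hd: "hd ws = v"
  proof -
    obtain b bs where b: "basis_completion v = b # bs" using bc(6) d by (cases "basis_completion v") auto
    hence "b = v" using bc(7) by simp
    thus ?thesis using gram_schmidt_hd[OF v, of bs] b unfolding ws_def by simp
  qed
  have wsc: "ws ! i \<in> carrier_vec d" if "i < d" for i using gs(3) len that by auto
  have orth: "ws ! i \<bullet>c ws ! j = 0 \<longleftrightarrow> i \<noteq> j" if "i < d" "j < d" for i j
    using corthogonalD[OF gs(2)] len that by simp
  define r where "r i = Re (ws ! i \<bullet>c ws ! i)" for i
  have sq: "ws ! i \<bullet>c ws ! i = complex_of_real (r i) \<and> 0 < r i" if i: "i < d" for i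
  proof -
    have "0 \<le> ws ! i \<bullet>c ws ! i" by (rule conjugate_square_ge_0_vec)
    moreover have "ws ! i \<bullet>c ws ! i \<noteq> 0" using orth[OF i i] by simp
    ultimately show ?thesis unfolding r_def by (auto simp: less_eq_complex_def complex_eq_iff less_le)
  qed
  define us where "us = map (\<lambda>i. complex_of_real (1 / sqrt (r i)) \<cdot>\<^sub>v ws ! i) [0..<d]"
  define W where "W = mat_of_cols d us"
  have W: "W \<in> carrier_mat d d" by (auto simp: W_def us_def)
  have Wij: "W $$ (i, j) = complex_of_real (1 / sqrt (r j)) * vec_index (ws ! j) i" if "i < d" "j < d" for i j
    using that wsc[of j] by (simp add: W_def us_def mat_of_cols_index)
  have "mat_adjoint W * W = 1\<^sub>m d"
  proof (rule eq_matI)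
    fix i j assume "i < dim_row (1\<^sub>m d)" "j < dim_col (1\<^sub>m d)"
    hence ij: "i < d" "j < d" by auto
    have "(mat_adjoint W * W) $$ (i, j) = (\<Sum>k<d. cnj (W $$ (k, i)) * W $$ (k, j))"
      using ij W by (auto simp: scalar_prod_def lessThan_atLeast0 intro!: sum.cong)
    also have "\<dots> = complex_of_real (1 / sqrt (r i)) * complex_of_real (1 / sqrt (r j)) *
        (\<Sum>k<d. vec_index (ws ! j) k * cnj (vec_index (ws ! i) k))"
      using ij by (simp add: Wij sum_distrib_left mult_ac)
    also have "(\<Sum>k<d. vec_index (ws ! j) k * cnj (vec_index (ws ! i) k)) = ws ! j \<bullet>c ws ! i"
      using wsc[OF ij(1)] wsc[OF ij(2)] by (auto simp: scalar_prod_def lessThan_atLeast0)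
    also have "complex_of_real (1 / sqrt (r i)) * complex_of_real (1 / sqrt (r j)) * (ws ! j \<bullet>c ws ! i) = (if i = j then 1 else 0)"
    proof (cases "i = j")
      case True
      have "1 / sqrt (r j) * (1 / sqrt (r j)) * r j = 1" using sq[OF ij(2)] by simp
      hence "complex_of_real (1 / sqrt (r j) * (1 / sqrt (r j)) * r j) = 1" by simp
      thus ?thesis using True sq[OF ij(2)] by (simp flip: of_real_mult)
    qed (use orth[OF ij(2,1)] in auto)
    finally show "(mat_adjoint W * W) $$ (i, j) = 1\<^sub>m d $$ (i, j)" using ij by simp
  qed (use W in auto)
  hence "unitary_mat d W" by (rule unitary_matI[OF W])
  moreover have "col W 0 = complex_of_real (1 / sqrt (r 0)) \<cdot>\<^sub>v v"
  proof -
    have "ws ! 0 = v" using hd len d by (metis hd_conv_nth length_0_conv less_numeral_extra(3))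
    thus ?thesis using v d W by (intro eq_vecI) (auto simp: Wij)
  qed
  moreover have "complex_of_real (1 / sqrt (r 0)) \<noteq> 0" using sq[OF d] by simp
  ultimately show ?thesis by blast
qed

lemma exists_eigenvector:
  assumes "(A :: complex mat) \<in> carrier_mat d d" "0 < d"
  shows "\<exists>v e. v \<in> carrier_vec d \<and> v \<noteq> 0\<^sub>v d \<and> A *\<^sub>v v = e \<cdot>\<^sub>v v"
proof -
  have "degree (char_poly A) = d" using degree_monic_char_poly[OF assms(1)] by simp
  hence "\<not> constant (poly (char_poly A))" using assms(2) by (simp add: constant_degree)
  then obtain e where "poly (char_poly A) e = 0" using fundamental_theorem_of_algebra by blast
  hence "eigenvalue A e" using eigenvalue_root_char_poly[OF assms(1)] by simp
  thus ?thesis using assms(1) unfolding eigenvalue_def eigenvector_def by auto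
qed

text \<open>Deflation: with an eigenvector as first column of W, the conjugated matrix B has first
  column (e, 0, ..., 0), and by symmetry the same first row, with e real. The remaining block C is
  Hermitian of size d, and W is completed by V' = 1 direct sum V, where V diagonalises C.\<close>

lemma hermitian_diagonalization:
  assumes "A \<in> carrier_mat d d" "mat_adjoint A = A"
  shows "\<exists>U e. unitary_mat d U \<and> A = U * mat_diag d (\<lambda>i. complex_of_real (e i)) * mat_adjoint U"
  using assms
proof (induction d arbitrary: A)
  case 0
  have 1: "unitary_mat 0 (1\<^sub>m 0)" by (rule unitary_one)
  have 2: "A = 1\<^sub>m 0 * mat_diag 0 (\<lambda>i. complex_of_real ((\<lambda>_. 0) i)) * mat_adjoint (1\<^sub>m 0)"
    by (rule eq_matI) (use 0 in simp_all)
  show ?case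
    by (rule exI[where x = "1\<^sub>m 0"], rule exI[where x = "\<lambda>_. 0"], rule conjI[OF 1 2])
next
  case (Suc d)
  let ?n = "Suc d"
  obtain v e where v: "v \<in> carrier_vec ?n" "v \<noteq> 0\<^sub>v ?n" and ev: "A *\<^sub>v v = e \<cdot>\<^sub>v v"
    using exists_eigenvector[OF Suc.prems(1) zero_less_Suc] by blast
  obtain W k where W: "unitary_mat ?n W" and k: "col W 0 = k \<cdot>\<^sub>v v"
    using exists_unitary_first_col[OF v zero_less_Suc] by blast
  have Wc: "W \<in> carrier_mat ?n ?n" and WW: "mat_adjoint W * W = 1\<^sub>m ?n" "W * mat_adjoint W = 1\<^sub>m ?n"
    using W by (auto simp: unitary_mat_def)
  have Wa: "mat_adjoint W \<in> carrier_mat ?n ?n" by (rule mat_adjoint_carrier[OF Wc])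
  note Ac = Suc.prems(1)
  define B where "B = mat_adjoint W * A * W"
  have Bc: "B \<in> carrier_mat ?n ?n" using Wc Wa Ac by (simp add: B_def)
  have Bh: "mat_adjoint B = B"
  proof -
    have "mat_adjoint B = mat_adjoint W * mat_adjoint (mat_adjoint W * A)"
      unfolding B_def by (rule mat_adjoint_mult) (use Wc Wa Ac in auto)
    also have "mat_adjoint (mat_adjoint W * A) = A * W"
      using mat_adjoint_mult[OF Wa Ac] Suc.prems(2) by simp
    finally show ?thesis unfolding B_def using assoc_mult_mat[OF Wa Ac Wc] by simp
  qed
  have B0: "B $$ (i, 0) = (if i = 0 then e else 0)" if i: "i < ?n" for i
  proof -
    have "col B 0 = col (mat_adjoint W * (A * W)) 0" unfolding B_def by (simp only: assoc_mult_mat[OF Wa Ac Wc])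
    also have "\<dots> = mat_adjoint W *\<^sub>v col (A * W) 0" by (rule col_mult2[OF Wa mult_carrier_mat[OF Ac Wc]]) simp
    also have "col (A * W) 0 = A *\<^sub>v col W 0" by (rule col_mult2[OF Ac Wc]) simp
    also have "\<dots> = e \<cdot>\<^sub>v col W 0"
      unfolding k mult_mat_vec[OF Ac v(1)] ev by (simp add: smult_smult_assoc mult.commute)
    also have "mat_adjoint W *\<^sub>v (e \<cdot>\<^sub>v col W 0) = e \<cdot>\<^sub>v (mat_adjoint W *\<^sub>v col W 0)"
      by (rule mult_mat_vec[OF Wa]) (use Wc in \<open>auto intro!: carrier_vecI\<close>)
    also have "mat_adjoint W *\<^sub>v col W 0 = col (mat_adjoint W * W) 0"
      by (rule col_mult2[OF Wa Wc, symmetric]) simp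
    finally have "vec_index (col B 0) i = vec_index (e \<cdot>\<^sub>v col (1\<^sub>m ?n) 0) i" unfolding WW by simp
    thus ?thesis using i Bc by auto
  qed
  have Bsym: "B $$ (i, j) = cnj (B $$ (j, i))" if "i < ?n" "j < ?n" for i j
    using arg_cong[OF Bh, of "\<lambda>M. M $$ (i, j)"] that Bc by simp
  have e: "e = complex_of_real (Re e)"
    using Bsym[of 0 0] B0[of 0] by (simp add: complex_eq_iff)
  define C where "C = Matrix.mat d d (\<lambda>(i, j). B $$ (Suc i, Suc j))"
  have Cc: "C \<in> carrier_mat d d" by (simp add: C_def)
  have "mat_adjoint C = C"
  proof (rule eq_matI)
    fix i j assume "i < dim_row C" "j < dim_col C"
    hence ij: "i < d" "j < d" by (simp_all add: C_def)
    show "mat_adjoint C $$ (i, j) = C $$ (i, j)"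
      using Bsym[of "Suc i" "Suc j"] ij by (simp add: C_def)
  qed (simp_all add: C_def)
  from Suc.IH[OF Cc this] obtain V f where V: "unitary_mat d V"
    and C: "C = V * mat_diag d (\<lambda>i. complex_of_real (f i)) * mat_adjoint V" by blast
  have Vc: "V \<in> carrier_mat d d" and VV: "mat_adjoint V * V = 1\<^sub>m d" using V by (auto simp: unitary_mat_def)
  define V' where "V' = Matrix.mat ?n ?n (\<lambda>(i, j). case (i, j) of (Suc i, Suc j) \<Rightarrow> V $$ (i, j)
    | (0, 0) \<Rightarrow> 1 | _ \<Rightarrow> 0)"
  define g where "g i = (case i of 0 \<Rightarrow> Re e | Suc i \<Rightarrow> f i)" for i
  have V'c: "V' \<in> carrier_mat ?n ?n" by (simp add: V'_def)
  have V'i: "V' $$ (0, 0) = 1" "j < d \<Longrightarrow> V' $$ (0, Suc j) = 0" "j < d \<Longrightarrow> V' $$ (Suc j, 0) = 0"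
    "i < d \<Longrightarrow> j < d \<Longrightarrow> V' $$ (Suc i, Suc j) = V $$ (i, j)" for i j
    by (simp_all add: V'_def)
  have sumV: "(\<Sum>k = 0..<d. cnj (V $$ (k, i)) * V $$ (k, j)) = (if i = j then 1 else 0)" if "i < d" "j < d" for i j
    using arg_cong[OF VV, of "\<lambda>M. M $$ (i, j)"] that Vc by (simp add: scalar_prod_def)
  have "mat_adjoint V' * V' = 1\<^sub>m ?n"
  proof (rule eq_matI)
    fix i j assume "i < dim_row (1\<^sub>m ?n)" "j < dim_col (1\<^sub>m ?n)"
    hence ij: "i < ?n" "j < ?n" by auto
    have "(mat_adjoint V' * V') $$ (i, j) = (\<Sum>k = 0..<?n. cnj (V' $$ (k, i)) * V' $$ (k, j))"
      using ij V'c by (simp add: scalar_prod_def)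
    also have "\<dots> = cnj (V' $$ (0, i)) * V' $$ (0, j) + (\<Sum>k = 0..<d. cnj (V' $$ (Suc k, i)) * V' $$ (Suc k, j))"
      by (simp add: sum.atLeast0_lessThan_Suc_shift del: sum.op_ivl_Suc)
    also have "\<dots> = (if i = j then 1 else 0)"
      using ij sumV by (cases i; cases j) (simp_all add: V'i)
    finally show "(mat_adjoint V' * V') $$ (i, j) = 1\<^sub>m ?n $$ (i, j)" using ij by simp
  qed (use V'c in auto)
  hence V': "unitary_mat ?n V'" by (rule unitary_matI[OF V'c])
  let ?G = "mat_diag ?n (\<lambda>i. complex_of_real (g i))"
  have ent: "(U * mat_diag m h * mat_adjoint U) $$ (i, j) = (\<Sum>k = 0..<m. U $$ (i, k) * h k * cnj (U $$ (j, k)))"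
    if "U \<in> carrier_mat m m" "i < m" "j < m" for U :: "complex mat" and m h i j
    using that by (simp add: mat_diag_mult_right[OF that(1)] scalar_prod_def)
  have Beq: "B = V' * ?G * mat_adjoint V'"
  proof (rule eq_matI)
    fix i j assume "i < dim_row (V' * ?G * mat_adjoint V')" "j < dim_col (V' * ?G * mat_adjoint V')"
    hence ij: "i < ?n" "j < ?n" using V'c by auto
    have CS: "B $$ (Suc i, Suc j) = (\<Sum>k = 0..<d. V $$ (i, k) * complex_of_real (f k) * cnj (V $$ (j, k)))"
      if "i < d" "j < d" for i j
      using arg_cong[OF C, of "\<lambda>M. M $$ (i, j)"] ent[OF Vc that] that by (simp add: C_def)
    have "(V' * ?G * mat_adjoint V') $$ (i, j) = (\<Sum>k = 0..<?n. V' $$ (i, k) * complex_of_real (g k) * cnj (V' $$ (j, k)))"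
      by (rule ent[OF V'c ij])
    also have "\<dots> = V' $$ (i, 0) * complex_of_real (g 0) * cnj (V' $$ (j, 0)) +
        (\<Sum>k = 0..<d. V' $$ (i, Suc k) * complex_of_real (g (Suc k)) * cnj (V' $$ (j, Suc k)))"
      by (simp add: sum.atLeast0_lessThan_Suc_shift del: sum.op_ivl_Suc)
    also have "\<dots> = B $$ (i, j)"
      using ij e[symmetric] B0 Bsym[of 0 j] B0[of j] CS by (cases i; cases j) (simp_all add: V'i g_def)
    finally show "B $$ (i, j) = (V' * ?G * mat_adjoint V') $$ (i, j)" ..
  qed (use Bc V'c in auto)
  have U: "unitary_mat ?n (W * V')" by (rule unitary_mult[OF W V'])
  have V'a: "mat_adjoint V' \<in> carrier_mat ?n ?n" by (rule mat_adjoint_carrier[OF V'c])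
  have Gc: "?G \<in> carrier_mat ?n ?n" by (simp add: mat_diag_dim)
  have "A = W * B * mat_adjoint W"
  proof -
    have "W * B * mat_adjoint W = W * (mat_adjoint W * (A * W)) * mat_adjoint W"
      unfolding B_def using assoc_mult_mat[OF Wa Ac Wc] by simp
    also have "W * (mat_adjoint W * (A * W)) = W * mat_adjoint W * (A * W)"
      by (rule assoc_mult_mat[OF Wc Wa mult_carrier_mat[OF Ac Wc], symmetric])
    also have "\<dots> = A * W" using WW Ac Wc by simp
    also have "A * W * mat_adjoint W = A * (W * mat_adjoint W)"
      by (rule assoc_mult_mat[OF Ac Wc Wa])
    finally show ?thesis using WW Ac by simp
  qed
  also have "\<dots> = (W * V') * ?G * mat_adjoint (W * V')"
  proof -
    have "W * (V' * ?G * mat_adjoint V') = W * (V' * ?G) * mat_adjoint V'"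
      by (rule assoc_mult_mat[OF Wc mult_carrier_mat[OF V'c Gc] V'a, symmetric])
    also have "W * (V' * ?G) = W * V' * ?G" by (rule assoc_mult_mat[OF Wc V'c Gc, symmetric])
    finally have "W * B * mat_adjoint W = W * V' * ?G * mat_adjoint V' * mat_adjoint W" unfolding Beq by simp
    also have "\<dots> = W * V' * ?G * (mat_adjoint V' * mat_adjoint W)"
      by (rule assoc_mult_mat[OF mult_carrier_mat[OF mult_carrier_mat[OF Wc V'c] Gc] V'a Wa])
    also have "mat_adjoint V' * mat_adjoint W = mat_adjoint (W * V')"
      by (rule mat_adjoint_mult[OF Wc V'c, symmetric])
    finally show ?thesis .
  qed
  finally show ?case using U by blast
qed

section \<open>Positive semidefinite matrices\<close>

lemma psd_form:
  assumes "psd_mat d A"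
  shows "0 \<le> (\<Sum>t<d. (\<Sum>u<d. A $$ (t, u) * f u) * cnj (f t))"
proof -
  have A: "A \<in> carrier_mat d d" using assms by (simp add: psd_mat_def)
  have "0 \<le> (A *\<^sub>v Matrix.vec d f) \<bullet>c Matrix.vec d f" using assms by (simp add: psd_mat_def)
  also have "(A *\<^sub>v Matrix.vec d f) \<bullet>c Matrix.vec d f = (\<Sum>t<d. (\<Sum>u<d. A $$ (t, u) * f u) * cnj (f t))"
    using A by (auto simp: scalar_prod_def lessThan_atLeast0 intro!: sum.cong)
  finally show ?thesis .
qed

text \<open>Polarisation: the form is real at the unit vectors, which makes the diagonal real. Its
  reality at e_i + e_j and at e_i + \<i> e_j then fixes the imaginary part of
  \<open>A $$ (i, j) + A $$ (j, i)\<close> and the real part of their difference as zero.\<close>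

lemma psd_hermitian:
  assumes "psd_mat d A" shows "mat_adjoint A = A"
proof (rule eq_matI)
  have A: "A \<in> carrier_mat d d" using assms by (simp add: psd_mat_def)
  fix i j assume "i < dim_row A" "j < dim_col A"
  hence ij: "i < d" "j < d" using A by auto
  have diag: "Im (A $$ (k, k)) = 0" if "k < d" for k
  proof -
    have "0 \<le> (\<Sum>t<d. (\<Sum>u<d. A $$ (t, u) * of_bool (u = k)) * cnj (of_bool (t = k)))"
      by (rule psd_form[OF assms])
    also have "\<dots> = (\<Sum>t<d. if t = k then (\<Sum>u<d. if u = k then A $$ (t, u) else 0) else 0)"
      by (intro sum.cong refl) (auto intro!: sum.cong)
    also have "\<dots> = A $$ (k, k)" using that by simp
    finally show ?thesis by (simp add: less_eq_complex_def)
  qed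
  show "mat_adjoint A $$ (i, j) = A $$ (i, j)"
  proof (cases "i = j")
    case True
    thus ?thesis using diag[OF ij(1)] ij A by (simp add: complex_eq_iff)
  next
    case False
    have S: "(\<Sum>u<d. g u * (of_bool (u = i) + z * of_bool (u = j))) = g i + g j * z" for g :: "nat \<Rightarrow> complex" and z
    proof -
      have "g u * (of_bool (u = i) + z * of_bool (u = j)) = (if u = i then g i else 0) + (if u = j then g j * z else 0)" for u
        using False by auto
      thus ?thesis using ij by (simp add: sum.distrib)
    qed
    have form: "Im (A $$ (i, i) + A $$ (i, j) * z + (A $$ (j, i) + A $$ (j, j) * z) * cnj z) = 0" for z
    proof -
      let ?f = "\<lambda>u. of_bool (u = i) + z * of_bool (u = j) :: complex"
      have 1: "(\<Sum>u<d. A $$ (t, u) * ?f u) = A $$ (t, i) + A $$ (t, j) * z" for t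
        by (rule S)
      have 2: "cnj (?f t) = of_bool (t = i) + cnj z * of_bool (t = j)" for t
        by auto
      have "0 \<le> (\<Sum>t<d. (\<Sum>u<d. A $$ (t, u) * ?f u) * cnj (?f t))" by (rule psd_form[OF assms])
      also have "\<dots> = A $$ (i, i) + A $$ (i, j) * z + (A $$ (j, i) + A $$ (j, j) * z) * cnj z"
        unfolding 1 2 by (rule S)
      finally show ?thesis by (simp add: less_eq_complex_def)
    qed
    show ?thesis
      using form[of 1] form[of \<i>] diag[OF ij(1)] diag[OF ij(2)] ij A by (simp add: complex_eq_iff)
  qed
qed (use assms in \<open>auto simp: psd_mat_def\<close>)

section \<open>Entries, eigenvectors and trace of a unitarily diagonalised matrix\<close>

lemma unitary_entries:
  assumes "unitary_mat d U"
  shows "k < d \<Longrightarrow> l < d \<Longrightarrow> (\<Sum>t<d. cnj (U $$ (t, k)) * U $$ (t, l)) = (if k = l then 1 else 0)"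
    and "x < d \<Longrightarrow> y < d \<Longrightarrow> (\<Sum>k<d. U $$ (x, k) * cnj (U $$ (y, k))) = (if x = y then 1 else 0)"
proof -
  have U: "U \<in> carrier_mat d d" and UU: "mat_adjoint U * U = 1\<^sub>m d" "U * mat_adjoint U = 1\<^sub>m d"
    using assms by (auto simp: unitary_mat_def)
  show "(\<Sum>t<d. cnj (U $$ (t, k)) * U $$ (t, l)) = (if k = l then 1 else 0)" if "k < d" "l < d"
    using arg_cong[OF UU(1), of "\<lambda>M. M $$ (k, l)"] that U by (simp add: scalar_prod_def lessThan_atLeast0)
  show "(\<Sum>k<d. U $$ (x, k) * cnj (U $$ (y, k))) = (if x = y then 1 else 0)" if "x < d" "y < d"
    using arg_cong[OF UU(2), of "\<lambda>M. M $$ (x, y)"] that U by (simp add: scalar_prod_def lessThan_atLeast0)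
qed

lemma diag_conj_entry:
  assumes "U \<in> carrier_mat d d" "x < d" "y < d"
  shows "(U * mat_diag d h * mat_adjoint U) $$ (x, y) = (\<Sum>k<d. U $$ (x, k) * h k * cnj (U $$ (y, k)))"
  using assms by (simp add: mat_diag_mult_right[OF assms(1)] scalar_prod_def lessThan_atLeast0)

lemma diag_conj_eigen:
  assumes "unitary_mat d U" "x < d" "k < d"
  shows "(\<Sum>u<d. (U * mat_diag d h * mat_adjoint U) $$ (x, u) * U $$ (u, k)) = h k * U $$ (x, k)"
proof -
  have U: "U \<in> carrier_mat d d" using assms by (simp add: unitary_mat_def)
  have "(\<Sum>u<d. (U * mat_diag d h * mat_adjoint U) $$ (x, u) * U $$ (u, k)) =
    (\<Sum>u<d. \<Sum>l<d. U $$ (x, l) * h l * (cnj (U $$ (u, l)) * U $$ (u, k)))"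
    using assms by (intro sum.cong refl) (simp add: diag_conj_entry[OF U] sum_distrib_right mult.assoc)
  also have "\<dots> = (\<Sum>l<d. \<Sum>u<d. U $$ (x, l) * h l * (cnj (U $$ (u, l)) * U $$ (u, k)))"
    by (rule sum.swap)
  also have "\<dots> = (\<Sum>l<d. if l = k then U $$ (x, l) * h l else 0)"
    by (intro sum.cong refl) (simp add: unitary_entries(1)[OF assms(1)] assms(3) flip: sum_distrib_left)
  finally show ?thesis using assms(3) by simp
qed

lemma diag_conj_trace:
  assumes "unitary_mat d U"
  shows "mat_trace (U * mat_diag d h * mat_adjoint U) = (\<Sum>k<d. h k)"
proof -
  have U: "U \<in> carrier_mat d d" using assms by (simp add: unitary_mat_def)
  have "mat_trace (U * mat_diag d h * mat_adjoint U) = (\<Sum>x<d. \<Sum>k<d. h k * (cnj (U $$ (x, k)) * U $$ (x, k)))"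
    unfolding mat_trace_def
  proof (rule sum.cong)
    fix x assume "x \<in> {..<d}"
    hence x: "x < d" by simp
    show "(U * mat_diag d h * mat_adjoint U) $$ (x, x) = (\<Sum>k<d. h k * (cnj (U $$ (x, k)) * U $$ (x, k)))"
      unfolding diag_conj_entry[OF U x x] by (simp add: mult_ac)
  qed (use U in simp)
  also have "\<dots> = (\<Sum>k<d. \<Sum>x<d. h k * (cnj (U $$ (x, k)) * U $$ (x, k)))" by (rule sum.swap)
  also have "\<dots> = (\<Sum>k<d. h k)"
    by (intro sum.cong refl) (simp add: unitary_entries(1)[OF assms] flip: sum_distrib_left)
  finally show ?thesis .
qed

text \<open>The form evaluated at an eigenvector is its eigenvalue, which is therefore nonnegative,
  so its square root can be moved into the eigenvector.\<close>

lemma psd_factor: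
  assumes "psd_mat d A"
  shows "\<exists>vs. \<forall>x<d. \<forall>y<d. A $$ (x, y) = (\<Sum>v\<leftarrow>vs. v x * cnj (v y))"
proof -
  have A: "A \<in> carrier_mat d d" using assms by (simp add: psd_mat_def)
  obtain U e where U: "unitary_mat d U" and AU: "A = U * mat_diag d (\<lambda>i. complex_of_real (e i)) * mat_adjoint U"
    using hermitian_diagonalization[OF A psd_hermitian[OF assms]] by blast
  have Uc: "U \<in> carrier_mat d d" using U by (simp add: unitary_mat_def)
  have e: "0 \<le> e k" if k: "k < d" for k
  proof -
    have "0 \<le> (\<Sum>t<d. (\<Sum>u<d. A $$ (t, u) * U $$ (u, k)) * cnj (U $$ (t, k)))"
      by (rule psd_form[OF assms])
    also have "\<dots> = (\<Sum>t<d. complex_of_real (e k) * (cnj (U $$ (t, k)) * U $$ (t, k)))"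
      unfolding AU by (intro sum.cong refl) (simp add: diag_conj_eigen[OF U _ k])
    also have "\<dots> = complex_of_real (e k)"
      using unitary_entries(1)[OF U k k] by (simp flip: sum_distrib_left)
    finally show ?thesis by (simp add: less_eq_complex_def)
  qed
  define vs where "vs = map (\<lambda>k x. complex_of_real (sqrt (e k)) * U $$ (x, k)) [0..<d]"
  have "A $$ (x, y) = (\<Sum>v\<leftarrow>vs. v x * cnj (v y))" if "x < d" "y < d" for x y
  proof -
    have "A $$ (x, y) = (\<Sum>k<d. U $$ (x, k) * complex_of_real (e k) * cnj (U $$ (y, k)))"
      unfolding AU by (rule diag_conj_entry[OF Uc that])
    also have "\<dots> = (\<Sum>k<d. complex_of_real (sqrt (e k)) * U $$ (x, k) * cnj (complex_of_real (sqrt (e k)) * U $$ (y, k)))"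
    proof (intro sum.cong refl)
      fix k assume "k \<in> {..<d}"
      hence "complex_of_real (e k) = complex_of_real (sqrt (e k)) * complex_of_real (sqrt (e k))"
        using e[of k] by (simp flip: of_real_mult)
      thus "U $$ (x, k) * complex_of_real (e k) * cnj (U $$ (y, k)) =
        complex_of_real (sqrt (e k)) * U $$ (x, k) * cnj (complex_of_real (sqrt (e k)) * U $$ (y, k))"
        by (simp add: mult_ac)
    qed
    also have "\<dots> = (\<Sum>v\<leftarrow>vs. v x * cnj (v y))"
      by (simp add: vs_def o_def interv_sum_list_conv_sum_set_nat lessThan_atLeast0)
    finally show ?thesis .
  qed
  thus ?thesis by blast
qed

lemma gram_density:
  assumes "density_mat (2 ^ n) \<rho>"
  shows "gram (\<lambda>X Y. \<rho> $$ (blk n P X, blk n P Y))"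
proof -
  obtain vs where vs: "\<forall>x<2 ^ n. \<forall>y<2 ^ n. \<rho> $$ (x, y) = (\<Sum>v\<leftarrow>vs. v x * cnj (v y))"
    using psd_factor[of "2 ^ n" \<rho>] assms by (auto simp: density_mat_def)
  show ?thesis
    unfolding gram_def by (rule exI[of _ "map (\<lambda>v X. v (blk n P X)) vs"]) (simp add: vs o_def)
qed

lemma density_trace:
  "density_mat (2 ^ n) \<rho> \<Longrightarrow> (\<Sum>p<2 ^ n. \<rho> $$ (p, p)) = 1"
  by (auto simp: density_mat_def psd_mat_def mat_trace_def)

section \<open>Evolution in an eigenbasis of the difference of the states\<close>

definition amp :: "real list \<Rightarrow> real \<Rightarrow> complex" where
  "amp \<theta>s l = (\<Prod>\<theta>\<leftarrow>\<theta>s. complex_of_real (cos \<theta>) + \<i> * complex_of_real (sin \<theta>) * complex_of_real l / 2)"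

definition cell_angle :: "cell \<Rightarrow> real" where
  "cell_angle C = snd (snd (snd C))"

text \<open>\<open>amp\<close> is the factor that an eigenvector of \<rho>0 - \<rho>1 collects from
  a list of angles. The hypothesis reads \<xi> = U diag(h) w; the evolution multiplies from the left
  and hence changes only h.\<close>

lemma cells_evolve_eigen:
  fixes U :: "complex mat"
  assumes eig: "\<And>x k. x < 2 ^ n \<Longrightarrow> k < 2 ^ n \<Longrightarrow>
      (\<Sum>u<2 ^ n. (\<rho>0 $$ (x, u) - \<rho>1 $$ (x, u)) * U $$ (u, k)) = complex_of_real (l k) * U $$ (x, k)"
    and "\<And>x y. x < 2 ^ n \<Longrightarrow> y < 2 ^ n \<Longrightarrow> \<xi> x y = (\<Sum>k<2 ^ n. U $$ (x, k) * h k * w k y)"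
    and "x < 2 ^ n" "y < 2 ^ n"
  shows "cells_evolve n \<rho>0 \<rho>1 cs \<xi> x y =
    (\<Sum>k<2 ^ n. U $$ (x, k) * (h k * amp (map cell_angle cs) (l k)) * w k y)"
  using assms(2-4)
proof (induction cs arbitrary: \<xi> h x y)
  case Nil
  thus ?case by (simp add: amp_def)
next
  case (Cons C cs)
  obtain a P Q \<theta> where C: "C = (a, P, Q, \<theta>)" by (cases C)
  let ?z = "\<lambda>k. complex_of_real (cos \<theta>) + \<i> * complex_of_real (sin \<theta>) * complex_of_real (l k) / 2"
  have "cell_evolve n \<rho>0 \<rho>1 C \<xi> x y = (\<Sum>k<2 ^ n. U $$ (x, k) * (h k * ?z k) * w k y)"
    if xy: "x < 2 ^ n" "y < 2 ^ n" for x y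
  proof -
    have "(\<Sum>u<2 ^ n. (\<rho>0 $$ (x, u) - \<rho>1 $$ (x, u)) * \<xi> u y) =
      (\<Sum>u<2 ^ n. \<Sum>k<2 ^ n. (\<rho>0 $$ (x, u) - \<rho>1 $$ (x, u)) * U $$ (u, k) * (h k * w k y))"
      using xy by (intro sum.cong refl) (simp add: Cons.prems(1) sum_distrib_left mult.assoc)
    also have "\<dots> = (\<Sum>k<2 ^ n. \<Sum>u<2 ^ n. (\<rho>0 $$ (x, u) - \<rho>1 $$ (x, u)) * U $$ (u, k) * (h k * w k y))"
      by (rule sum.swap)
    also have "\<dots> = (\<Sum>k<2 ^ n. complex_of_real (l k) * U $$ (x, k) * (h k * w k y))"
      by (intro sum.cong refl) (simp add: eig[OF xy(1)] flip: sum_distrib_right)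
    finally have 1: "(\<Sum>u<2 ^ n. (\<rho>0 $$ (x, u) - \<rho>1 $$ (x, u)) * \<xi> u y) =
      (\<Sum>k<2 ^ n. complex_of_real (l k) * U $$ (x, k) * (h k * w k y))" .
    show ?thesis
      unfolding C cell_evolve.simps 1 Cons.prems(1)[OF xy] sum_distrib_left sum.distrib[symmetric]
      by (intro sum.cong refl) (simp add: algebra_simps)
  qed
  note IH = Cons.IH[OF this Cons.prems(2,3)]
  have "amp (map cell_angle (C # cs)) (l k) = ?z k * amp (map cell_angle cs) (l k)" for k
    by (simp add: amp_def cell_angle_def C)
  thus ?case using IH unfolding cells_evolve.simps by (simp only: mult.assoc)
qed

text \<open>The numbers \<open>p i\<close> and \<open>q i\<close> are the diagonal entries of the
  two states in an eigenbasis of their difference. The states need not commute: a test takes the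
  trace of a state times a function of \<rho>0 - \<rho>1, and such a trace sees only these
  diagonals.\<close>

lemma density_spectral:
  assumes d0: "density_mat (2 ^ n) \<rho>0" and d1: "density_mat (2 ^ n) \<rho>1"
  obtains l p q :: "nat \<Rightarrow> real" where
    "\<And>i. i < 2 ^ n \<Longrightarrow> 0 \<le> p i" "\<And>i. i < 2 ^ n \<Longrightarrow> 0 \<le> q i" "\<And>i. i < 2 ^ n \<Longrightarrow> l i = p i - q i"
    "(\<Sum>i<2 ^ n. p i) = 1" "(\<Sum>i<2 ^ n. q i) = 1"
    "\<And>a. l_distance a \<rho>0 \<rho>1 = 1/2 * (\<Sum>i<2 ^ n. \<bar>l i\<bar> powr a) powr (1/a)"
    "\<And>cs. (\<Sum>t<2 ^ n. cells_evolve n \<rho>0 \<rho>1 cs (\<lambda>x y. \<rho>0 $$ (x, y)) t t) =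
      (\<Sum>i<2 ^ n. complex_of_real (p i) * amp (map cell_angle cs) (l i))"
    "\<And>cs. (\<Sum>t<2 ^ n. cells_evolve n \<rho>0 \<rho>1 cs (\<lambda>x y. \<rho>1 $$ (x, y)) t t) =
      (\<Sum>i<2 ^ n. complex_of_real (q i) * amp (map cell_angle cs) (l i))"
proof -
  let ?d = "2 ^ n :: nat"
  define A where "A = \<rho>0 - \<rho>1"
  have psd: "psd_mat ?d \<rho>0" "psd_mat ?d \<rho>1" using d0 d1 by (auto simp: density_mat_def)
  have c: "\<rho>0 \<in> carrier_mat ?d ?d" "\<rho>1 \<in> carrier_mat ?d ?d" using psd by (auto simp: psd_mat_def)
  have Ac: "A \<in> carrier_mat ?d ?d" unfolding A_def by (rule minus_carrier_mat[OF c(2)])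
  have Ai: "A $$ (x, y) = \<rho>0 $$ (x, y) - \<rho>1 $$ (x, y)" if "x < ?d" "y < ?d" for x y
    using that c by (simp add: A_def)
  have Ah: "mat_adjoint A = A"
  proof (rule eq_matI)
    fix i j assume "i < dim_row A" "j < dim_col A"
    hence ij: "i < ?d" "j < ?d" using Ac by auto
    have "cnj (\<rho> $$ (j, i)) = \<rho> $$ (i, j)" if "psd_mat ?d \<rho>" for \<rho>
    proof -
      have "\<rho> \<in> carrier_mat ?d ?d" using that by (simp add: psd_mat_def)
      hence "dim_row \<rho> = ?d" "dim_col \<rho> = ?d" by auto
      thus ?thesis using arg_cong[OF psd_hermitian[OF that], of "\<lambda>M. M $$ (i, j)"] ij by simp
    qed
    thus "mat_adjoint A $$ (i, j) = A $$ (i, j)" using ij Ac psd by (simp add: Ai)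
  qed (use Ac in auto)
  obtain U l where U: "unitary_mat ?d U" and AU: "A = U * mat_diag ?d (\<lambda>i. complex_of_real (l i)) * mat_adjoint U"
    using hermitian_diagonalization[OF Ac Ah] by blast
  have Uc: "U \<in> carrier_mat ?d ?d" and UU: "mat_adjoint U * U = 1\<^sub>m ?d" using U by (auto simp: unitary_mat_def)
  have Ua: "mat_adjoint U \<in> carrier_mat ?d ?d" by (rule mat_adjoint_carrier[OF Uc])
  have Dc: "mat_diag ?d h \<in> carrier_mat ?d ?d" for h :: "nat \<Rightarrow> complex" by (simp add: mat_diag_dim)
  have eig: "(\<Sum>u<?d. (\<rho>0 $$ (x, u) - \<rho>1 $$ (x, u)) * U $$ (u, k)) = complex_of_real (l k) * U $$ (x, k)"
    if "x < ?d" "k < ?d" for x k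
    using diag_conj_eigen[OF U that, of "\<lambda>i. complex_of_real (l i)"] that
    unfolding AU[symmetric] by (simp add: Ai)
  define P where "P \<rho> k = (\<Sum>t<?d. (\<Sum>u<?d. \<rho> $$ (t, u) * U $$ (u, k)) * cnj (U $$ (t, k)))" for \<rho> k
  have P0: "P \<rho> k = complex_of_real (Re (P \<rho> k)) \<and> 0 \<le> Re (P \<rho> k)" if "psd_mat ?d \<rho>" for \<rho> k
    using psd_form[OF that, of "\<lambda>u. U $$ (u, k)"] unfolding P_def[symmetric]
    by (simp add: less_eq_complex_def complex_eq_iff)
  have P1: "(\<Sum>k<?d. P \<rho> k) = 1" if "density_mat ?d \<rho>" for \<rho>
  proof -
    have "(\<Sum>k<?d. P \<rho> k) = (\<Sum>k<?d. \<Sum>t<?d. \<Sum>u<?d. \<rho> $$ (t, u) * (U $$ (u, k) * cnj (U $$ (t, k))))"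
      by (simp add: P_def sum_distrib_right mult.assoc)
    also have "\<dots> = (\<Sum>t<?d. \<Sum>k<?d. \<Sum>u<?d. \<rho> $$ (t, u) * (U $$ (u, k) * cnj (U $$ (t, k))))"
      by (rule sum.swap)
    also have "\<dots> = (\<Sum>t<?d. \<Sum>u<?d. \<Sum>k<?d. \<rho> $$ (t, u) * (U $$ (u, k) * cnj (U $$ (t, k))))"
      by (intro sum.cong refl sum.swap)
    also have "\<dots> = (\<Sum>t<?d. \<Sum>u<?d. if u = t then \<rho> $$ (t, u) else 0)"
      by (intro sum.cong refl) (simp add: unitary_entries(2)[OF U] flip: sum_distrib_left)
    also have "\<dots> = 1" using density_trace[OF that] by simp
    finally show ?thesis .
  qed
  have Pl: "l k = Re (P \<rho>0 k) - Re (P \<rho>1 k)" if k: "k < ?d" for k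
  proof -
    have "P \<rho>0 k - P \<rho>1 k = (\<Sum>t<?d. (\<Sum>u<?d. (\<rho>0 $$ (t, u) - \<rho>1 $$ (t, u)) * U $$ (u, k)) * cnj (U $$ (t, k)))"
      by (simp add: P_def sum_subtractf left_diff_distrib)
    also have "\<dots> = (\<Sum>t<?d. complex_of_real (l k) * (cnj (U $$ (t, k)) * U $$ (t, k)))"
      using k by (intro sum.cong refl) (simp add: eig)
    also have "\<dots> = complex_of_real (l k)"
      using unitary_entries(1)[OF U k k] by (simp flip: sum_distrib_left)
    finally show ?thesis by (metis Re_complex_of_real minus_complex.simps(1))
  qed
  have ev: "(\<Sum>t<?d. cells_evolve n \<rho>0 \<rho>1 cs (\<lambda>x y. \<rho> $$ (x, y)) t t) =
      (\<Sum>i<?d. complex_of_real (Re (P \<rho> i)) * amp (map cell_angle cs) (l i))" if \<rho>: "psd_mat ?d \<rho>" for \<rho> cs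
  proof -
    \<comment> \<open>Taking for w the adjoint of U times \<rho> meets the hypothesis of
      \<open>cells_evolve_eigen\<close> with h = 1, also when \<rho> is not diagonal in this
      basis.\<close>
    define w where "w k y = (\<Sum>u<?d. cnj (U $$ (u, k)) * \<rho> $$ (u, y))" for k y
    have start: "\<rho> $$ (x, y) = (\<Sum>k<?d. U $$ (x, k) * 1 * w k y)" if "x < ?d" "y < ?d" for x y
    proof -
      have "(\<Sum>k<?d. U $$ (x, k) * 1 * w k y) = (\<Sum>k<?d. \<Sum>u<?d. U $$ (x, k) * cnj (U $$ (u, k)) * \<rho> $$ (u, y))"
        by (simp add: w_def sum_distrib_left mult.assoc)
      also have "\<dots> = (\<Sum>u<?d. \<Sum>k<?d. U $$ (x, k) * cnj (U $$ (u, k)) * \<rho> $$ (u, y))" by (rule sum.swap)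
      also have "\<dots> = (\<Sum>u<?d. if x = u then \<rho> $$ (u, y) else 0)"
        using that by (intro sum.cong refl) (simp add: unitary_entries(2)[OF U] flip: sum_distrib_right)
      finally show ?thesis using that by simp
    qed
    have "(\<Sum>t<?d. cells_evolve n \<rho>0 \<rho>1 cs (\<lambda>x y. \<rho> $$ (x, y)) t t) =
      (\<Sum>t<?d. \<Sum>k<?d. U $$ (t, k) * (1 * amp (map cell_angle cs) (l k)) * w k t)"
      by (intro sum.cong refl cells_evolve_eigen[OF eig start]) auto
    also have "\<dots> = (\<Sum>k<?d. \<Sum>t<?d. U $$ (t, k) * (1 * amp (map cell_angle cs) (l k)) * w k t)"
      by (rule sum.swap)
    also have "\<dots> = (\<Sum>k<?d. P \<rho> k * amp (map cell_angle cs) (l k))"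
    proof (intro sum.cong refl)
      fix k
      have "(\<Sum>t<?d. U $$ (t, k) * (1 * amp (map cell_angle cs) (l k)) * w k t) =
        (\<Sum>t<?d. \<Sum>u<?d. \<rho> $$ (u, t) * U $$ (t, k) * cnj (U $$ (u, k))) * amp (map cell_angle cs) (l k)"
        by (simp add: w_def sum_distrib_left sum_distrib_right mult_ac)
      also have "(\<Sum>t<?d. \<Sum>u<?d. \<rho> $$ (u, t) * U $$ (t, k) * cnj (U $$ (u, k))) =
        (\<Sum>u<?d. \<Sum>t<?d. \<rho> $$ (u, t) * U $$ (t, k) * cnj (U $$ (u, k)))" by (rule sum.swap)
      also have "\<dots> = P \<rho> k" by (simp add: P_def sum_distrib_right)
      finally show "(\<Sum>t<?d. U $$ (t, k) * (1 * amp (map cell_angle cs) (l k)) * w k t) =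
        P \<rho> k * amp (map cell_angle cs) (l k)" .
    qed
    finally show ?thesis using P0[OF \<rho>] by simp
  qed
  have dist: "l_distance a \<rho>0 \<rho>1 = 1/2 * (\<Sum>i<?d. \<bar>l i\<bar> powr a) powr (1/a)" for a
  proof -
    let ?D = "mat_diag ?d (\<lambda>i. complex_of_real (l i))"
    have "A * A = U * (?D * ?D) * mat_adjoint U"
    proof -
      have "A * A = U * ?D * mat_adjoint U * (U * ?D * mat_adjoint U)" using AU by simp
      also have "\<dots> = U * ?D * (mat_adjoint U * (U * ?D * mat_adjoint U))"
        by (rule assoc_mult_mat[OF mult_carrier_mat[OF Uc Dc] Ua mult_carrier_mat[OF mult_carrier_mat[OF Uc Dc] Ua]])
      also have "mat_adjoint U * (U * ?D * mat_adjoint U) = mat_adjoint U * (U * ?D) * mat_adjoint U"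
        by (rule assoc_mult_mat[OF Ua mult_carrier_mat[OF Uc Dc] Ua, symmetric])
      also have "mat_adjoint U * (U * ?D) = mat_adjoint U * U * ?D"
        by (rule assoc_mult_mat[OF Ua Uc Dc, symmetric])
      also have "\<dots> = ?D" unfolding UU by (rule left_mult_one_mat[OF Dc])
      also have "U * ?D * (?D * mat_adjoint U) = U * ?D * ?D * mat_adjoint U"
        by (rule assoc_mult_mat[OF mult_carrier_mat[OF Uc Dc] Dc Ua, symmetric])
      also have "U * ?D * ?D = U * (?D * ?D)" by (rule assoc_mult_mat[OF Uc Dc Dc])
      finally show ?thesis .
    qed
    also have "?D * ?D = mat_diag ?d (\<lambda>i. complex_of_real ((l i)\<^sup>2))"
      by (simp add: mat_diag_diag power2_eq_square)
    finally have AA: "mat_adjoint A * A = U * mat_diag ?d (\<lambda>i. complex_of_real ((l i)\<^sup>2)) * mat_adjoint U"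
      unfolding Ah .
    have dimA: "dim_row (mat_adjoint A * A) = ?d" using Ac by simp
    let ?B = "U * mat_diag ?d (\<lambda>i. complex_of_real \<bar>l i\<bar>) * mat_adjoint U"
    have "is_mat_fun sqrt (mat_adjoint A * A) ?B"
      unfolding is_mat_fun_def dimA
      by (rule exI[of _ U], rule exI[of _ "\<lambda>i. (l i)\<^sup>2"]) (use U AA in simp)
    hence abs: "mat_abs A = ?B" unfolding mat_abs_def by (rule mat_fun_eqI)
    have dimB: "dim_row ?B = ?d" using Uc by simp
    have "is_mat_fun (\<lambda>x. x powr a) ?B (U * mat_diag ?d (\<lambda>i. complex_of_real (\<bar>l i\<bar> powr a)) * mat_adjoint U)"
      unfolding is_mat_fun_def dimB
      by (rule exI[of _ U], rule exI[of _ "\<lambda>i. \<bar>l i\<bar>"]) (use U in simp)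
    hence "mat_powr (mat_abs A) a = U * mat_diag ?d (\<lambda>i. complex_of_real (\<bar>l i\<bar> powr a)) * mat_adjoint U"
      unfolding abs mat_powr_def by (rule mat_fun_eqI)
    thus ?thesis unfolding l_distance_def A_def[symmetric] by (simp add: diag_conj_trace[OF U])
  qed
  have sums: "(\<Sum>i<?d. Re (P \<rho> i)) = 1" if "density_mat ?d \<rho>" for \<rho>
    using arg_cong[OF P1[OF that], of Re] by simp
  show thesis
    by (rule that[of "\<lambda>i. Re (P \<rho>0 i)" "\<lambda>i. Re (P \<rho>1 i)" l])
      (use P0 psd Pl sums d0 d1 dist ev in auto)
qed

section \<open>The initial state\<close>

lemma conf_div: "conf (i div 2 ^ m) = {k. m + k \<in> conf i}"
  by (auto simp: conf_def bit_iff_odd div_mult2_eq power_add)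

lemma conf_mod: "conf (i mod 2 ^ m) = conf i \<inter> {..<m}"
  by (auto simp: conf_def bit_take_bit_iff simp flip: take_bit_eq_mod)

lemma blk_conf_div: "blk n P (conf (i div 2 ^ m)) = blk n (m + P) (conf i)"
  unfolding blk_def conf_div by (simp add: add.assoc)

lemma blk_conf_mod: "P + n \<le> m \<Longrightarrow> blk n P (conf (i mod 2 ^ m)) = blk n P (conf i)"
  unfolding conf_mod by (rule blk_cong) auto

lemma div_eq_blk: "i < 2 ^ (n + m) \<Longrightarrow> i div 2 ^ m = blk n m (conf i)"
proof (rule inj_conf)
  assume "i < 2 ^ (n + m)"
  hence "conf i \<subseteq> {..<n + m}" by (simp only: conf_less_iff)
  thus "conf (i div 2 ^ m) = conf (blk n m (conf i))" unfolding conf_div conf_blk by auto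
qed

lemma kron_carrier:
  assumes "A \<in> carrier_mat a a" "B \<in> carrier_mat b b" shows "kron A B \<in> carrier_mat (a * b) (a * b)"
  using assms by (auto simp: kron_def)

lemma kron_index:
  assumes "A \<in> carrier_mat a a" "B \<in> carrier_mat b b" "i < a * b" "j < a * b"
  shows "kron A B $$ (i, j) = A $$ (i div b, j div b) * B $$ (i mod b, j mod b)"
  using assms by (auto simp: kron_def)

lemma kron_pow_entries:
  assumes A: "A \<in> carrier_mat (2 ^ n) (2 ^ n)"
  shows "kron_pow A k \<in> carrier_mat (2 ^ (n * k)) (2 ^ (n * k))"
    and "i < 2 ^ (n * k) \<Longrightarrow> j < 2 ^ (n * k) \<Longrightarrow>
      kron_pow A k $$ (i, j) = (\<Prod>l<k. A $$ (blk n (n * l) (conf i), blk n (n * l) (conf j)))"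
proof (induction k arbitrary: i j)
  case (Suc k)
  {
    case 1
    show ?case using kron_carrier[OF A Suc.IH(1)] by (simp add: power_add)
  next
    case 2
    have e: "2 ^ n * 2 ^ (n * k) = (2 :: nat) ^ (n + n * k)" by (simp add: power_add)
    have ij: "i < 2 ^ (n + n * k)" "j < 2 ^ (n + n * k)" using 2 by simp_all
    have "kron_pow A (Suc k) $$ (i, j) = A $$ (i div 2 ^ (n * k), j div 2 ^ (n * k)) *
        kron_pow A k $$ (i mod 2 ^ (n * k), j mod 2 ^ (n * k))"
      unfolding kron_pow.simps using ij by (intro kron_index[OF A Suc.IH(1)]) (simp_all only: e)
    also have "kron_pow A k $$ (i mod 2 ^ (n * k), j mod 2 ^ (n * k)) =
      (\<Prod>l<k. A $$ (blk n (n * l) (conf (i mod 2 ^ (n * k))), blk n (n * l) (conf (j mod 2 ^ (n * k)))))"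
      by (rule Suc.IH(2)) simp_all
    also have "\<dots> = (\<Prod>l<k. A $$ (blk n (n * l) (conf i), blk n (n * l) (conf j)))"
    proof (intro prod.cong refl)
      fix l assume "l \<in> {..<k}"
      hence "n * Suc l \<le> n * k" by (intro mult_le_mono2) simp
      hence "n * l + n \<le> n * k" by simp
      thus "A $$ (blk n (n * l) (conf (i mod 2 ^ (n * k))), blk n (n * l) (conf (j mod 2 ^ (n * k)))) =
        A $$ (blk n (n * l) (conf i), blk n (n * l) (conf j))"
        by (simp add: blk_conf_mod)
    qed
    finally show ?case by (simp add: div_eq_blk[OF ij(1)] div_eq_blk[OF ij(2)])
  }
qed simp_all

text \<open>The offsets are dictated by the tensor order of the initial state, whose rightmost
  factor has the lowest qubits: K coins first, then the K copies of \<rho>1, then the K copies of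
  \<rho>0.\<close>

definition cell_at :: "nat \<Rightarrow> nat \<Rightarrow> nat \<Rightarrow> real \<Rightarrow> cell" where
  "cell_at n K l \<theta> = (l, K + n * K + n * l, K + n * l, \<theta>)"

text \<open>The initial state groups the copies by kind, the tests group them by cell. For entries,
  which are products of numbers, this is a mere reordering of factors.\<close>

lemma initial_state_kernel:
  assumes "\<rho>0 \<in> carrier_mat (2 ^ n) (2 ^ n)" "\<rho>1 \<in> carrier_mat (2 ^ n) (2 ^ n)"
    and "copies0 Q = K" "copies1 Q = K" "ancillas Q = K"
  shows "represents (num_qubits n Q) (initial_state Q \<rho>0 \<rho>1)
    (\<lambda>X Y. \<Prod>l<K. cell_ker n \<rho>0 \<rho>1 (cell_at n K l 0) X Y)"
proof -
  let ?m = "n * K"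
  have ket: "ket0_proj \<in> carrier_mat (2 ^ 1) (2 ^ 1)" by (simp add: ket0_proj_def)
  note k0 = kron_pow_entries[OF assms(1), where k = K] and k1 = kron_pow_entries[OF assms(2), where k = K]
    and ka = kron_pow_entries[OF ket, where k = K, unfolded mult_1]
  have c01: "kron (kron_pow \<rho>0 K) (kron_pow \<rho>1 K) \<in> carrier_mat (2 ^ (?m + ?m)) (2 ^ (?m + ?m))"
    using kron_carrier[OF k0(1) k1(1)] by (simp add: power_add)
  have c: "initial_state Q \<rho>0 \<rho>1 \<in> carrier_mat (2 ^ (?m + ?m + K)) (2 ^ (?m + ?m + K))"
    unfolding initial_state_def assms(3-5) using kron_carrier[OF c01 ka(1)] by (simp add: power_add)
  have N: "num_qubits n Q = ?m + ?m + K" by (simp add: num_qubits_def assms(3-5))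
  have "initial_state Q \<rho>0 \<rho>1 $$ (x, y) = (\<Prod>l<K. cell_ker n \<rho>0 \<rho>1 (cell_at n K l 0) (conf x) (conf y))"
    if xy: "x < 2 ^ (?m + ?m + K)" "y < 2 ^ (?m + ?m + K)" for x y
  proof -
    have e: "2 ^ (?m + ?m) * 2 ^ K = (2 :: nat) ^ (?m + ?m + K)" "2 ^ ?m * 2 ^ ?m = (2 :: nat) ^ (?m + ?m)"
      by (simp_all add: power_add)
    have lt: "z div 2 ^ K < 2 ^ (?m + ?m)" "z div 2 ^ K div 2 ^ ?m < 2 ^ ?m" if "z < 2 ^ (?m + ?m + K)" for z :: nat
    proof -
      show *: "z div 2 ^ K < 2 ^ (?m + ?m)"
        using that unfolding e(1)[symmetric] by (rule less_mult_imp_div_less)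
      show "z div 2 ^ K div 2 ^ ?m < 2 ^ ?m"
        using * unfolding e(2)[symmetric] by (rule less_mult_imp_div_less)
    qed
    have "initial_state Q \<rho>0 \<rho>1 $$ (x, y) = kron (kron_pow \<rho>0 K) (kron_pow \<rho>1 K) $$ (x div 2 ^ K, y div 2 ^ K) *
        kron_pow ket0_proj K $$ (x mod 2 ^ K, y mod 2 ^ K)"
      unfolding initial_state_def assms(3-5) using xy by (intro kron_index[OF c01 ka(1)]) (simp_all only: e)
    also have "kron (kron_pow \<rho>0 K) (kron_pow \<rho>1 K) $$ (x div 2 ^ K, y div 2 ^ K) =
      kron_pow \<rho>0 K $$ (x div 2 ^ K div 2 ^ ?m, y div 2 ^ K div 2 ^ ?m) *
      kron_pow \<rho>1 K $$ (x div 2 ^ K mod 2 ^ ?m, y div 2 ^ K mod 2 ^ ?m)"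
      using lt(1)[OF xy(1)] lt(1)[OF xy(2)] by (intro kron_index[OF k0(1) k1(1)]) (simp_all only: e)
    also have "kron_pow \<rho>0 K $$ (x div 2 ^ K div 2 ^ ?m, y div 2 ^ K div 2 ^ ?m) =
      (\<Prod>l<K. \<rho>0 $$ (blk n (K + ?m + n * l) (conf x), blk n (K + ?m + n * l) (conf y)))"
      using lt(2)[OF xy(1)] lt(2)[OF xy(2)] by (subst k0(2)) (simp_all add: blk_conf_div add.assoc)
    also have "kron_pow \<rho>1 K $$ (x div 2 ^ K mod 2 ^ ?m, y div 2 ^ K mod 2 ^ ?m) =
      (\<Prod>l<K. \<rho>1 $$ (blk n (K + n * l) (conf x), blk n (K + n * l) (conf y)))"
    proof (subst k1(2))
      show "(\<Prod>l<K. \<rho>1 $$ (blk n (n * l) (conf (x div 2 ^ K mod 2 ^ ?m)), blk n (n * l) (conf (y div 2 ^ K mod 2 ^ ?m)))) =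
        (\<Prod>l<K. \<rho>1 $$ (blk n (K + n * l) (conf x), blk n (K + n * l) (conf y)))"
      proof (intro prod.cong refl)
        fix l assume "l \<in> {..<K}"
        hence "n * Suc l \<le> n * K" by (intro mult_le_mono2) simp
        hence "n * l + n \<le> n * K" by simp
        thus "\<rho>1 $$ (blk n (n * l) (conf (x div 2 ^ K mod 2 ^ ?m)), blk n (n * l) (conf (y div 2 ^ K mod 2 ^ ?m))) =
          \<rho>1 $$ (blk n (K + n * l) (conf x), blk n (K + n * l) (conf y))"
          by (simp add: blk_conf_mod blk_conf_div)
      qed
    qed simp_all
    also have "kron_pow ket0_proj K $$ (x mod 2 ^ K, y mod 2 ^ K) = (\<Prod>l<K. of_bool (l \<notin> conf x \<and> l \<notin> conf y))"
    proof (subst ka(2))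
      show "(\<Prod>l<K. ket0_proj $$ (blk 1 l (conf (x mod 2 ^ K)), blk 1 l (conf (y mod 2 ^ K)))) =
        (\<Prod>l<K. of_bool (l \<notin> conf x \<and> l \<notin> conf y))"
      proof (intro prod.cong refl)
        fix l assume l: "l \<in> {..<K}"
        have b: "blk 1 l X = of_bool (l \<in> X)" for X
        proof -
          have "{k. k < 1 \<and> l + k \<in> X} = (if l \<in> X then {0} else {})" by auto
          thus ?thesis unfolding blk_def by (simp add: set_encode_def)
        qed
        show "ket0_proj $$ (blk 1 l (conf (x mod 2 ^ K)), blk 1 l (conf (y mod 2 ^ K))) =
          of_bool (l \<notin> conf x \<and> l \<notin> conf y)"
          unfolding conf_mod b using l by (auto simp: ket0_proj_def)
      qed
    qed simp_all
    finally show ?thesis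
      by (simp add: cell_at_def prod.distrib mult_ac)
  qed
  thus ?thesis unfolding represents_def N using c by simp
qed

section \<open>Disjointness of the cells\<close>

lemma cell_at_disjoint:
  assumes "l < K" "m < K" "l \<noteq> m"
  shows "cell_qubits n (cell_at n K l \<theta>) \<inter> cell_qubits n (cell_at n K m \<theta>') = {}"
proof -
  have 1: "n * a + n \<le> n * b" if "a < b" for a b :: nat
    using mult_le_mono2[of "Suc a" b n] that by simp
  have 2: "n * l + n \<le> n * m \<or> n * m + n \<le> n * l" using 1[of l m] 1[of m l] assms(3) by linarith
  have 3: "n * l + n \<le> n * K" "n * m + n \<le> n * K" using 1 assms by auto
  have "\<not> (k \<in> cell_qubits n (cell_at n K l \<theta>) \<and> k \<in> cell_qubits n (cell_at n K m \<theta>'))" for k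
    using assms 2 3 unfolding cell_at_def cell_qubits.simps insert_iff Un_iff atLeastLessThan_iff by linarith
  thus ?thesis by blast
qed

lemma cell_at_inner:
  assumes "l < K"
  shows "l \<notin> blkset n (K + n * K + n * l)" "l \<notin> blkset n (K + n * l)"
    "blkset n (K + n * K + n * l) \<inter> blkset n (K + n * l) = {}"
proof -
  have "n * l + n \<le> n * K" using mult_le_mono2[of "Suc l" K n] assms by simp
  hence "\<not> (k \<in> blkset n (K + n * K + n * l) \<and> k \<in> blkset n (K + n * l))" for k
    unfolding atLeastLessThan_iff by linarith
  thus "blkset n (K + n * K + n * l) \<inter> blkset n (K + n * l) = {}" by blast
  show "l \<notin> blkset n (K + n * K + n * l)" "l \<notin> blkset n (K + n * l)"
    using assms unfolding atLeastLessThan_iff by linarith+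
qed

lemma cell_at_bound:
  assumes "l < K" "k \<in> cell_qubits n (cell_at n K l \<theta>)" shows "k < n * K + n * K + K"
proof -
  have "n * l + n \<le> n * K" using mult_le_mono2[of "Suc l" K n] assms by simp
  thus ?thesis using assms unfolding cell_at_def cell_qubits.simps insert_iff Un_iff atLeastLessThan_iff by linarith
qed

lemma layout_cell_at:
  assumes "distinct (map fst js)" "\<And>j. j \<in> set js \<Longrightarrow> fst j < K"
    and "\<And>j. j \<in> set js \<Longrightarrow> cell_qubits n (cell_at n K (fst j) 0) \<inter> D = {}"
  shows "layout n D (map (\<lambda>(l, \<theta>). cell_at n K l \<theta>) js)"
  using assms
proof (induction js arbitrary: D)
  case (Cons j js)
  obtain l \<theta> where j: "j = (l, \<theta>)" by (cases j)
  have l: "l < K" using Cons.prems(2)[of j] j by simp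
  have q: "cell_qubits n (cell_at n K m \<theta>) = cell_qubits n (cell_at n K m 0)" for m \<theta>
    by (simp add: cell_at_def)
  have 1: "layout n (D \<union> cell_qubits n (cell_at n K l \<theta>)) (map (\<lambda>(l, \<theta>). cell_at n K l \<theta>) js)"
  proof (rule Cons.IH)
    fix j' assume j': "j' \<in> set js"
    have "fst j' \<noteq> l" using Cons.prems(1) j j' by (auto simp: image_iff)
    moreover have "fst j' < K" using Cons.prems(2) j' by simp
    ultimately have "cell_qubits n (cell_at n K (fst j') 0) \<inter> cell_qubits n (cell_at n K l \<theta>) = {}"
      using cell_at_disjoint l by blast
    moreover have "cell_qubits n (cell_at n K (fst j') 0) \<inter> D = {}"
      by (rule Cons.prems(3)) (use j' in simp)
    ultimately show "cell_qubits n (cell_at n K (fst j') 0) \<inter> (D \<union> cell_qubits n (cell_at n K l \<theta>)) = {}" by blast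
  qed (use Cons.prems in auto)
  have 2: "cell_qubits n (cell_at n K l \<theta>) \<inter> D = {}"
    using Cons.prems(3)[OF list.set_intros(1)] q[of l \<theta>] by (simp only: j fst_conv)
  show ?case
    using 1 2 cell_at_inner[OF l, of n] unfolding j list.map case_prod_conv cell_at_def layout.simps by blast
qed simp

section \<open>Chebyshev's inequality for a product distribution\<close>

text \<open>Summing over the last block first kills the terms linear in \<open>y k\<close>, so the
  variances of the blocks add.\<close>

lemma product_moments:
  fixes p y :: "nat \<Rightarrow> nat set \<Rightarrow> real"
  assumes "\<And>t. t < k \<Longrightarrow> finite (B t)" "\<And>t u. t < k \<Longrightarrow> u < k \<Longrightarrow> t \<noteq> u \<Longrightarrow> B t \<inter> B u = {}"
    and "\<And>t. t < k \<Longrightarrow> (\<Sum>X\<in>Pow (B t). p t X) = 1"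
    and "\<And>t. t < k \<Longrightarrow> (\<Sum>X\<in>Pow (B t). p t X * y t X) = 0"
  defines "P \<equiv> \<lambda>X. \<Prod>t<k. p t (X \<inter> B t)" and "S \<equiv> \<lambda>X. \<Sum>t<k. y t (X \<inter> B t)"
  shows "(\<Sum>X\<in>Pow (\<Union>t<k. B t). P X) = 1 \<and>
    (\<Sum>X\<in>Pow (\<Union>t<k. B t). P X * S X) = 0 \<and>
    (\<Sum>X\<in>Pow (\<Union>t<k. B t). P X * (S X)\<^sup>2) = (\<Sum>t<k. \<Sum>X\<in>Pow (B t). p t X * (y t X)\<^sup>2)"
  unfolding P_def S_def using assms(1-4)
proof (induction k)
  case (Suc k)
  let ?U = "\<Union>t<k. B t"
  define P where "P X = (\<Prod>t<k. p t (X \<inter> B t))" for X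
  define S where "S X = (\<Sum>t<k. y t (X \<inter> B t))" for X
  have fin: "finite ?U" "finite (B k)" using Suc.prems(1) by auto
  have dis1: "B t \<inter> B k = {}" if "t < k" for t by (rule Suc.prems(2)) (use that in auto)
  hence dis: "?U \<inter> B k = {}" by blast
  have U: "(\<Union>t<Suc k. B t) = ?U \<union> B k" by (auto simp: lessThan_Suc)
  have r: "(X \<union> Y) \<inter> B t = X \<inter> B t" if "t < k" "Y \<subseteq> B k" for X Y t
    using dis1[OF that(1)] that(2) by blast
  have rk: "(X \<union> Y) \<inter> B k = Y" if "X \<subseteq> ?U" "Y \<subseteq> B k" for X Y
    using dis that by blast
  have PS: "(\<Prod>t<Suc k. p t ((X \<union> Y) \<inter> B t)) = P X * p k Y" "(\<Sum>t<Suc k. y t ((X \<union> Y) \<inter> B t)) = S X + y k Y"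
    if "X \<subseteq> ?U" "Y \<subseteq> B k" for X Y
    using r[OF _ that(2)] rk[OF that] by (simp_all add: P_def S_def)
  have IH: "(\<Sum>X\<in>Pow ?U. P X) = 1" "(\<Sum>X\<in>Pow ?U. P X * S X) = 0"
    "(\<Sum>X\<in>Pow ?U. P X * (S X)\<^sup>2) = (\<Sum>t<k. \<Sum>X\<in>Pow (B t). p t X * (y t X)\<^sup>2)"
    unfolding P_def S_def using Suc by auto
  have k: "(\<Sum>Y\<in>Pow (B k). p k Y) = 1" "(\<Sum>Y\<in>Pow (B k). p k Y * y k Y) = 0"
    using Suc.prems(3,4) by auto
  have split: "(\<Sum>X\<in>Pow (\<Union>t<Suc k. B t). f (\<Prod>t<Suc k. p t (X \<inter> B t)) (\<Sum>t<Suc k. y t (X \<inter> B t))) =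
    (\<Sum>X\<in>Pow ?U. \<Sum>Y\<in>Pow (B k). f (P X * p k Y) (S X + y k Y))" for f :: "real \<Rightarrow> real \<Rightarrow> real"
    unfolding U by (subst sum_Pow_Un[OF fin dis], intro sum.cong refl) (simp only: PS Pow_iff)
  show ?case
  proof (intro conjI)
    show "(\<Sum>X\<in>Pow (\<Union>t<Suc k. B t). \<Prod>t<Suc k. p t (X \<inter> B t)) = 1"
      unfolding split[of "\<lambda>a b. a"] using IH(1) k(1) by (simp flip: sum_distrib_left)
    have "(\<Sum>Y\<in>Pow (B k). P X * p k Y * (S X + y k Y)) = P X * S X" for X
    proof -
      have "(\<Sum>Y\<in>Pow (B k). P X * p k Y * (S X + y k Y)) =
        P X * S X * (\<Sum>Y\<in>Pow (B k). p k Y) + P X * (\<Sum>Y\<in>Pow (B k). p k Y * y k Y)"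
        unfolding sum_distrib_left sum.distrib[symmetric] by (intro sum.cong refl) (simp add: algebra_simps)
      thus ?thesis using k by simp
    qed
    thus "(\<Sum>X\<in>Pow (\<Union>t<Suc k. B t). (\<Prod>t<Suc k. p t (X \<inter> B t)) * (\<Sum>t<Suc k. y t (X \<inter> B t))) = 0"
      unfolding split[of "\<lambda>a b. a * b"] using IH(2) by simp
    have "(\<Sum>Y\<in>Pow (B k). P X * p k Y * (S X + y k Y)\<^sup>2) = P X * (S X)\<^sup>2 + P X * (\<Sum>Y\<in>Pow (B k). p k Y * (y k Y)\<^sup>2)" for X
    proof -
      have "(\<Sum>Y\<in>Pow (B k). P X * p k Y * (S X + y k Y)\<^sup>2) = P X * (S X)\<^sup>2 * (\<Sum>Y\<in>Pow (B k). p k Y) +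
        2 * P X * S X * (\<Sum>Y\<in>Pow (B k). p k Y * y k Y) + P X * (\<Sum>Y\<in>Pow (B k). p k Y * (y k Y)\<^sup>2)"
        unfolding sum_distrib_left sum.distrib[symmetric]
        by (intro sum.cong refl) (simp add: algebra_simps power2_eq_square)
      thus ?thesis using k by simp
    qed
    thus "(\<Sum>X\<in>Pow (\<Union>t<Suc k. B t). (\<Prod>t<Suc k. p t (X \<inter> B t)) * (\<Sum>t<Suc k. y t (X \<inter> B t))\<^sup>2) =
        (\<Sum>t<Suc k. \<Sum>X\<in>Pow (B t). p t X * (y t X)\<^sup>2)"
      unfolding split[of "\<lambda>a b. a * b\<^sup>2"] using IH(1,3) by (simp add: sum.distrib flip: sum_distrib_right)
  qed
qed simp_all

text \<open>A sign with mean e has variance 1 - e^2, so the sum of k independent signs has variance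
  at most k.\<close>

lemma product_chebyshev:
  fixes p s :: "nat \<Rightarrow> nat set \<Rightarrow> real" and e :: "nat \<Rightarrow> real"
  assumes fin: "\<And>t. t < k \<Longrightarrow> finite (B t)" and dis: "\<And>t u. t < k \<Longrightarrow> u < k \<Longrightarrow> t \<noteq> u \<Longrightarrow> B t \<inter> B u = {}"
    and nonneg: "\<And>t X. t < k \<Longrightarrow> 0 \<le> p t X"
    and one: "\<And>t. t < k \<Longrightarrow> (\<Sum>X\<in>Pow (B t). p t X) = 1"
    and ex: "\<And>t. t < k \<Longrightarrow> (\<Sum>X\<in>Pow (B t). p t X * s t X) = e t"
    and s: "\<And>t X. t < k \<Longrightarrow> (s t X)\<^sup>2 = 1"
    and r: "0 < r"
  shows "1 - k / r\<^sup>2 \<le> (\<Sum>X | X \<in> Pow (\<Union>t<k. B t) \<and> \<bar>(\<Sum>t<k. s t (X \<inter> B t)) - (\<Sum>t<k. e t)\<bar> \<le> r. \<Prod>t<k. p t (X \<inter> B t))"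
proof -
  define P where "P X = (\<Prod>t<k. p t (X \<inter> B t))" for X
  define S where "S X = (\<Sum>t<k. s t (X \<inter> B t) - e t)" for X
  let ?U = "Pow (\<Union>t<k. B t)"
  have finU: "finite ?U" using fin by auto
  have P0: "0 \<le> P X" for X unfolding P_def by (intro prod_nonneg) (simp add: nonneg)
  have y0: "(\<Sum>X\<in>Pow (B t). p t X * (s t X - e t)) = 0" if "t < k" for t
    using one[OF that] ex[OF that] by (simp add: right_diff_distrib sum_subtractf flip: sum_distrib_right)
  have v: "(\<Sum>X\<in>Pow (B t). p t X * (s t X - e t)\<^sup>2) \<le> 1" if "t < k" for t
  proof -
    have "(\<Sum>X\<in>Pow (B t). p t X * (s t X - e t)\<^sup>2) =
      (\<Sum>X\<in>Pow (B t). p t X * (s t X)\<^sup>2) - 2 * e t * (\<Sum>X\<in>Pow (B t). p t X * s t X) + (e t)\<^sup>2 * (\<Sum>X\<in>Pow (B t). p t X)"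
      unfolding sum_distrib_left sum.distrib[symmetric] sum_subtractf[symmetric]
      by (intro sum.cong refl) (simp add: algebra_simps power2_eq_square)
    also have "\<dots> = 1 - (e t)\<^sup>2" using one[OF that] ex[OF that] s[OF that] by (simp add: power2_eq_square)
    finally show ?thesis by simp
  qed
  have m1: "(\<Sum>X\<in>?U. P X) = 1"
    unfolding P_def by (rule product_moments[OF fin dis one y0, THEN conjunct1])
  have "(\<Sum>X\<in>?U. P X * (S X)\<^sup>2) = (\<Sum>t<k. \<Sum>X\<in>Pow (B t). p t X * (s t X - e t)\<^sup>2)"
    unfolding P_def S_def by (rule product_moments[OF fin dis one y0, THEN conjunct2, THEN conjunct2])
  also have "\<dots> \<le> (\<Sum>t<k. 1)" by (intro sum_mono v) simp
  finally have m2: "(\<Sum>X\<in>?U. P X * (S X)\<^sup>2) \<le> k" by simp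
  have "(\<Sum>X\<in>?U. P X) - (\<Sum>X | X \<in> ?U \<and> \<bar>S X\<bar> \<le> r. P X) = (\<Sum>X | X \<in> ?U \<and> \<not> \<bar>S X\<bar> \<le> r. P X)"
    using sum.Int_Diff[OF finU, of P "{X. \<bar>S X\<bar> \<le> r}"] by (simp add: Int_def Diff_eq set_diff_eq)
  also have "\<dots> \<le> (\<Sum>X | X \<in> ?U \<and> \<not> \<bar>S X\<bar> \<le> r. P X * (S X)\<^sup>2 / r\<^sup>2)"
  proof (rule sum_mono)
    fix X assume "X \<in> {X. X \<in> ?U \<and> \<not> \<bar>S X\<bar> \<le> r}"
    hence "r \<le> \<bar>S X\<bar>" by simp
    from power_mono[OF this, of 2] have "r\<^sup>2 \<le> (S X)\<^sup>2" using r by simp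
    hence "P X * 1 \<le> P X * ((S X)\<^sup>2 / r\<^sup>2)" using r P0 by (intro mult_left_mono) auto
    thus "P X \<le> P X * (S X)\<^sup>2 / r\<^sup>2" by simp
  qed
  also have "\<dots> \<le> (\<Sum>X\<in>?U. P X * (S X)\<^sup>2 / r\<^sup>2)"
    by (rule sum_mono2[OF finU]) (use P0 in auto)
  also have "\<dots> = (\<Sum>X\<in>?U. P X * (S X)\<^sup>2) / r\<^sup>2" by (simp add: sum_divide_distrib)
  also have "\<dots> \<le> k / r\<^sup>2" by (rule divide_right_mono[OF m2]) simp
  finally have "1 - k / r\<^sup>2 \<le> (\<Sum>X | X \<in> ?U \<and> \<bar>S X\<bar> \<le> r. P X)" using m1 by linarith
  thus ?thesis unfolding P_def S_def by (simp add: sum_subtractf)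
qed

section \<open>The algorithm\<close>

lemma length_cswap: "length (cswap n a P Q) = 7 * n"
  by (simp add: cswap_def length_concat o_def fredkin_def toffoli_def sum_list_triv)

text \<open>Four controlled swaps with seven gates per qubit (five for the Toffoli gate, two CNOT
  gates), four Hadamard gates and one rotation.\<close>

lemma length_step: "length (step n c T a P Q \<theta>) = 28 * n + 5"
  by (simp add: step_def length_cswap)

section \<open>Validity and support of the gates of a test\<close>

lemma fredkin_valid:
  assumes "g \<in> set (fredkin a p q)" "a < N" "p < N" "q < N" "a \<noteq> p" "a \<noteq> q" "p \<noteq> q"
  shows "valid_gate N g \<and> gate_qubits g \<subseteq> {a, p, q}"
proof -
  have "valid_gate N (ctrl c q 0 1)" if "c < N" "q < N" "c \<noteq> q" for c q
    by (rule valid_ctrl) (use that in auto)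
  moreover have "valid_gate N (ctrl c q ((1 + \<i>) / 2) ((1 - \<i>) / 2))" "valid_gate N (ctrl c q ((1 - \<i>) / 2) ((1 + \<i>) / 2))"
    if "c < N" "q < N" "c \<noteq> q" for c q
    by (rule valid_ctrl; use that in \<open>simp add: field_simps\<close>)+
  ultimately show ?thesis using assms(2-7) assms(1) unfolding fredkin_def toffoli_def by auto
qed

lemma cswap_valid:
  assumes g: "g \<in> set (cswap n a P Q)" and N: "insert a (blkset n P \<union> blkset n Q) \<subseteq> {..<N}"
    and d: "a \<notin> blkset n P" "a \<notin> blkset n Q" "blkset n P \<inter> blkset n Q = {}"
  shows "valid_gate N g \<and> gate_qubits g \<subseteq> insert a (blkset n P \<union> blkset n Q)"
proof -
  obtain k where k: "k < n" and gk: "g \<in> set (fredkin a (P + k) (Q + k))"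
    using g by (auto simp: cswap_def)
  have m: "P + k \<in> blkset n P" "Q + k \<in> blkset n Q" using k by auto
  have "valid_gate N g \<and> gate_qubits g \<subseteq> {a, P + k, Q + k}"
  proof (rule fredkin_valid[OF gk])
    show "a < N" "P + k < N" "Q + k < N" using N m by blast+
    show "a \<noteq> P + k" "a \<noteq> Q + k" "P + k \<noteq> Q + k" using d(1,2) m blkset_disjD(1)[OF d(3) k] by metis+
  qed
  thus ?thesis using m by blast
qed

lemma step_valid:
  assumes g: "g \<in> set (step n c T a P Q \<theta>)"
    and N: "insert c (insert a (blkset n T \<union> (blkset n P \<union> blkset n Q))) \<subseteq> {..<N}"
    and d: "blkset n P \<inter> blkset n Q = {}" "blkset n T \<inter> blkset n P = {}"
    and a: "a \<notin> blkset n T" "a \<notin> blkset n P" "a \<notin> blkset n Q" "c \<noteq> a"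
  shows "valid_gate N g \<and> gate_qubits g \<subseteq> insert c (insert a (blkset n T \<union> (blkset n P \<union> blkset n Q)))"
proof -
  have cN: "c < N" and aN: "a < N" using N by blast+
  have 1: "valid_gate N g \<and> gate_qubits g \<subseteq> insert a (blkset n P \<union> blkset n Q)" if "g \<in> set (cswap n a P Q)"
    by (rule cswap_valid[OF that _ a(2,3) d(1)]) (use N in blast)
  have 2: "valid_gate N g \<and> gate_qubits g \<subseteq> insert a (blkset n T \<union> blkset n P)" if "g \<in> set (cswap n a T P)"
    by (rule cswap_valid[OF that _ a(1,2) d(2)]) (use N in blast)
  have 3: "valid_gate N (had a)" by (rule valid_had[OF aN])
  have 4: "valid_gate N (ctrl c a (complex_of_real (cos \<theta>)) (\<i> * complex_of_real (sin \<theta>)))"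
  proof (rule valid_ctrl[OF cN aN a(4)])
    have "(complex_of_real (cos \<theta>))\<^sup>2 + (complex_of_real (sin \<theta>))\<^sup>2 = 1"
      by (simp flip: of_real_power of_real_add)
    thus "complex_of_real (cos \<theta>) * cnj (complex_of_real (cos \<theta>)) +
      \<i> * complex_of_real (sin \<theta>) * cnj (\<i> * complex_of_real (sin \<theta>)) = 1"
      by (simp add: power2_eq_square complex_eq_iff)
  qed simp
  consider "g \<in> set (cswap n a P Q)" | "g \<in> set (cswap n a T P)" | "g = had a"
    | "g = ctrl c a (complex_of_real (cos \<theta>)) (\<i> * complex_of_real (sin \<theta>))"
    using g unfolding step_def set_append list.set by blast
  thus ?thesis
  proof cases
    case 1 thus ?thesis using \<open>g \<in> set (cswap n a P Q) \<Longrightarrow> _\<close> by blast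
  next
    case 2 thus ?thesis using \<open>g \<in> set (cswap n a T P) \<Longrightarrow> _\<close> by blast
  next
    case 3 thus ?thesis using \<open>valid_gate N (had a)\<close> by simp
  next
    case 4 thus ?thesis using \<open>valid_gate N (ctrl c a _ _)\<close> by simp
  qed
qed

lemma test_gates_valid:
  assumes g: "g \<in> set (test_gates n \<zeta> c T cs)" and z: "cmod \<zeta> = 1"
    and lay: "layout n D cs" "insert c (blkset n T) \<subseteq> D" "c \<notin> blkset n T"
    and N: "insert c (blkset n T \<union> (\<Union>C\<in>set cs. cell_qubits n C)) \<subseteq> {..<N}"
  shows "valid_gate N g \<and> gate_qubits g \<subseteq> insert c (blkset n T \<union> (\<Union>C\<in>set cs. cell_qubits n C))"
proof -
  have cN: "c < N" using N by blast
  consider "g = prep c \<zeta>" | "g = had c" | C where "C \<in> set cs" "g \<in> set (cell_gates n c T C)"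
    using g unfolding test_gates_def by auto
  thus ?thesis
  proof cases
    case 1
    thus ?thesis using valid_prep[OF cN z] by (simp add: prep_def)
  next
    case 2
    thus ?thesis using valid_had[OF cN] by simp
  next
    case 3
    obtain a P Q \<theta> where C: "C = (a, P, Q, \<theta>)" by (cases C)
    have in_lay: "a \<notin> blkset n P \<and> a \<notin> blkset n Q \<and> blkset n P \<inter> blkset n Q = {} \<and> cell_qubits n C \<inter> D = {}"
      using lay(1) 3(1)
    proof (induction cs arbitrary: D)
      case (Cons C' cs)
      obtain a' P' Q' \<theta>' where C': "C' = (a', P', Q', \<theta>')" by (cases C')
      show ?case
      proof (cases "C = C'")
        case True
        thus ?thesis using Cons.prems(1) C' C unfolding layout.simps by auto
      next
        case False
        have "layout n (D \<union> cell_qubits n C') cs" using Cons.prems(1) unfolding C' layout.simps by blast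
        from Cons.IH[OF this] show ?thesis using Cons.prems(2) False by auto
      qed
    qed simp
    have "cell_qubits n C \<subseteq> (\<Union>C\<in>set cs. cell_qubits n C)" using 3(1) by blast
    hence sub: "insert a (blkset n P \<union> blkset n Q) \<subseteq> (\<Union>C\<in>set cs. cell_qubits n C)"
      unfolding C cell_qubits.simps .
    have "valid_gate N g \<and> gate_qubits g \<subseteq> insert c (insert a (blkset n T \<union> (blkset n P \<union> blkset n Q)))"
    proof (rule step_valid[of g n c T a P Q \<theta>])
      show "g \<in> set (step n c T a P Q \<theta>)" using 3(2) C by simp
      show "insert c (insert a (blkset n T \<union> (blkset n P \<union> blkset n Q))) \<subseteq> {..<N}"
        using N sub by blast
      show "blkset n P \<inter> blkset n Q = {}" "a \<notin> blkset n P" "a \<notin> blkset n Q" using in_lay by blast+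
      show "blkset n T \<inter> blkset n P = {}" "a \<notin> blkset n T" "c \<noteq> a"
        using in_lay lay(2) unfolding C cell_qubits.simps by blast+
    qed
    thus ?thesis using sub by blast
  qed
qed

definition reg :: "nat \<Rightarrow> nat \<Rightarrow> nat \<Rightarrow> bool \<Rightarrow> nat" where
  "reg n K l b = (if b then K + n * l else K + n * K + n * l)"

definition alg_cells :: "nat \<Rightarrow> nat \<Rightarrow> nat \<Rightarrow> nat \<Rightarrow> real list \<Rightarrow> cell list" where
  "alg_cells n K M t \<theta>s = map (\<lambda>(l, \<theta>). cell_at n K l \<theta>) (zip [Suc (t * Suc M)..<t * Suc M + Suc M] \<theta>s)"

definition alg_test :: "nat \<Rightarrow> nat \<Rightarrow> nat \<Rightarrow> nat \<Rightarrow> complex \<Rightarrow> real list \<Rightarrow> gate list" where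
  "alg_test n K M t \<zeta> \<theta>s = test_gates n \<zeta> (t * Suc M) (reg n K (t * Suc M) (odd t)) (alg_cells n K M t \<theta>s)"

definition alg_qubits :: "nat \<Rightarrow> nat \<Rightarrow> nat \<Rightarrow> nat \<Rightarrow> nat set" where
  "alg_qubits n K M t = (\<Union>l\<in>{t * Suc M..<t * Suc M + Suc M}. cell_qubits n (cell_at n K l 0))"

definition alg_ker :: "nat \<Rightarrow> nat \<Rightarrow> nat \<Rightarrow> complex mat \<Rightarrow> complex mat \<Rightarrow> nat \<Rightarrow> nat set \<Rightarrow> nat set \<Rightarrow> complex" where
  "alg_ker n K M \<rho>0 \<rho>1 t X Y = (\<Prod>l\<in>{t * Suc M..<t * Suc M + Suc M}. cell_ker n \<rho>0 \<rho>1 (cell_at n K l 0) X Y)"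

text \<open>Test \<open>t\<close> uses the cells \<open>t * Suc M, \<dots>, t * Suc M + M\<close>: the first one provides the control qubit and
  the tested register, which is a copy of \<open>\<rho>0\<close> for even and of \<open>\<rho>1\<close> for odd \<open>t\<close>.\<close>

definition alg :: "nat \<Rightarrow> nat \<Rightarrow> nat \<Rightarrow> (nat \<Rightarrow> complex) \<Rightarrow> (nat \<Rightarrow> real list) \<Rightarrow> (real \<Rightarrow> real) \<Rightarrow> sample_algorithm" where
  "alg n N M \<zeta> \<theta> g = (let K = 2 * N * Suc M in \<lparr>copies0 = K, copies1 = K, ancillas = K,
     gates = concat (map (\<lambda>t. alg_test n K M t (\<zeta> (t div 2)) (\<theta> (t div 2))) [0..<2 * N]),
     estimate = (\<lambda>x. g ((\<Sum>t<2 * N. (if odd t then - 1 else 1) * (if bit x (t * Suc M) then - 1 else 1)) / real N))\<rparr>)"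

section \<open>The tests as disjoint normalised blocks\<close>

lemma sum_Pow_UN_prod:
  fixes f :: "nat \<Rightarrow> nat set \<Rightarrow> complex"
  assumes "finite I" "\<And>i. i \<in> I \<Longrightarrow> finite (B i)" "\<And>i j. i \<in> I \<Longrightarrow> j \<in> I \<Longrightarrow> i \<noteq> j \<Longrightarrow> B i \<inter> B j = {}"
  shows "(\<Sum>X\<in>Pow (\<Union>i\<in>I. B i). \<Prod>i\<in>I. f i (X \<inter> B i)) = (\<Prod>i\<in>I. \<Sum>X\<in>Pow (B i). f i X)"
  using assms
proof (induction I rule: finite_induct)
  case (insert i I)
  let ?U = "\<Union>i\<in>I. B i"
  have d: "B j \<inter> B i = {}" if "j \<in> I" for j
    by (rule insert.prems(2)) (use that insert.hyps in auto)
  have dU: "?U \<inter> B i = {}" using d by blast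
  have fin: "finite ?U" "finite (B i)" using insert by auto
  have IH: "(\<Sum>X\<in>Pow ?U. \<Prod>i\<in>I. f i (X \<inter> B i)) = (\<Prod>i\<in>I. \<Sum>X\<in>Pow (B i). f i X)"
    by (rule insert.IH) (use insert.prems in auto)
  have U: "(\<Union>i\<in>insert i I. B i) = ?U \<union> B i" by auto
  have "(\<Sum>X\<in>Pow (\<Union>i\<in>insert i I. B i). \<Prod>j\<in>insert i I. f j (X \<inter> B j)) =
    (\<Sum>X\<in>Pow ?U. \<Sum>Y\<in>Pow (B i). (\<Prod>j\<in>I. f j (X \<inter> B j)) * f i Y)"
    unfolding U
  proof (subst sum_Pow_Un[OF fin dU], intro sum.cong refl)
    fix X Y assume "X \<in> Pow ?U" "Y \<in> Pow (B i)"
    hence "(X \<union> Y) \<inter> B i = Y" "\<And>j. j \<in> I \<Longrightarrow> (X \<union> Y) \<inter> B j = X \<inter> B j"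
      using d dU by blast+
    thus "(\<Prod>j\<in>insert i I. f j ((X \<union> Y) \<inter> B j)) = (\<Prod>j\<in>I. f j (X \<inter> B j)) * f i Y"
      using insert.hyps by (simp add: mult.commute)
  qed
  also have "\<dots> = (\<Prod>j\<in>insert i I. \<Sum>X\<in>Pow (B j). f j X)"
    using insert.hyps by (simp add: IH mult.commute flip: sum_distrib_left sum_distrib_right)
  finally show ?case .
qed simp

lemma cell_trace:
  assumes "l < K" "(\<Sum>p<2 ^ n. \<rho>0 $$ (p, p)) = 1" "(\<Sum>p<2 ^ n. \<rho>1 $$ (p, p)) = 1"
  shows "(\<Sum>X\<in>Pow (cell_qubits n (cell_at n K l 0)). cell_ker n \<rho>0 \<rho>1 (cell_at n K l 0) X X) = 1"
proof -
  let ?P = "blkset n (K + n * K + n * l)" and ?Q = "blkset n (K + n * l)"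
  note d = cell_at_inner[OF assms(1), of n]
  let ?f = "cell_ker n \<rho>0 \<rho>1 (cell_at n K l 0)"
  have "(\<Sum>X\<in>Pow (cell_qubits n (cell_at n K l 0)). ?f X X) = (\<Sum>X\<in>Pow (?P \<union> ?Q). ?f X X + ?f (insert l X) (insert l X))"
    unfolding cell_at_def cell_qubits.simps by (rule sum_Pow_insert) (use d in blast)+
  also have "\<dots> = (\<Sum>X\<in>Pow (?P \<union> ?Q). \<rho>0 $$ (blk n (K + n * K + n * l) X, blk n (K + n * K + n * l) X) *
      \<rho>1 $$ (blk n (K + n * l) X, blk n (K + n * l) X))"
  proof (intro sum.cong refl)
    fix X assume "X \<in> Pow (?P \<union> ?Q)"
    hence "l \<notin> X" using d by blast
    thus "?f X X + ?f (insert l X) (insert l X) = \<rho>0 $$ (blk n (K + n * K + n * l) X, blk n (K + n * K + n * l) X) *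
      \<rho>1 $$ (blk n (K + n * l) X, blk n (K + n * l) X)" by (simp add: cell_at_def)
  qed
  also have "\<dots> = (\<Sum>X\<in>Pow ?P. \<Sum>Y\<in>Pow ?Q. \<rho>0 $$ (blk n (K + n * K + n * l) X, blk n (K + n * K + n * l) X) *
      \<rho>1 $$ (blk n (K + n * l) Y, blk n (K + n * l) Y))"
  proof (subst sum_Pow_Un[OF _ _ d(3)], simp, simp, intro sum.cong refl)
    fix X Y assume "X \<in> Pow ?P" "Y \<in> Pow ?Q"
    hence "blk n (K + n * K + n * l) (X \<union> Y) = blk n (K + n * K + n * l) X" "blk n (K + n * l) (X \<union> Y) = blk n (K + n * l) Y"
      by (intro blk_cong; use d(3) in blast)+
    thus "\<rho>0 $$ (blk n (K + n * K + n * l) (X \<union> Y), blk n (K + n * K + n * l) (X \<union> Y)) *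
      \<rho>1 $$ (blk n (K + n * l) (X \<union> Y), blk n (K + n * l) (X \<union> Y)) =
      \<rho>0 $$ (blk n (K + n * K + n * l) X, blk n (K + n * K + n * l) X) *
      \<rho>1 $$ (blk n (K + n * l) Y, blk n (K + n * l) Y)" by simp
  qed
  also have "\<dots> = (\<Sum>X\<in>Pow ?P. \<rho>0 $$ (blk n (K + n * K + n * l) X, blk n (K + n * K + n * l) X)) *
      (\<Sum>Y\<in>Pow ?Q. \<rho>1 $$ (blk n (K + n * l) Y, blk n (K + n * l) Y))"
    by (simp add: sum_product)
  also have "\<dots> = 1" using assms(2,3) sum_blk[of "\<lambda>p. \<rho>0 $$ (p, p)"] sum_blk[of "\<lambda>p. \<rho>1 $$ (p, p)"] by simp
  finally show ?thesis .
qed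

lemma alg_qubits_disjoint:
  assumes "t * Suc M + Suc M \<le> K" "u * Suc M + Suc M \<le> K" "t \<noteq> u"
  shows "alg_qubits n K M t \<inter> alg_qubits n K M u = {}"
proof -
  have 1: "a * Suc M + Suc M \<le> b * Suc M" if "a < b" for a b
    using mult_le_mono1[of "Suc a" b "Suc M"] that by simp
  have "t * Suc M + Suc M \<le> u * Suc M \<or> u * Suc M + Suc M \<le> t * Suc M"
    using 1[of t u] 1[of u t] assms(3) by linarith
  hence "l \<noteq> m" if "l \<in> {t * Suc M..<t * Suc M + Suc M}" "m \<in> {u * Suc M..<u * Suc M + Suc M}" for l m
    using that by auto
  hence "cell_qubits n (cell_at n K l 0) \<inter> cell_qubits n (cell_at n K m 0) = {}"
    if "l \<in> {t * Suc M..<t * Suc M + Suc M}" "m \<in> {u * Suc M..<u * Suc M + Suc M}" for l m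
    using that assms by (intro cell_at_disjoint) auto
  thus ?thesis unfolding alg_qubits_def by blast
qed

lemma alg_ker_restrict:
  "alg_ker n K M \<rho>0 \<rho>1 t (X \<inter> alg_qubits n K M t) (Y \<inter> alg_qubits n K M t) = alg_ker n K M \<rho>0 \<rho>1 t X Y"
  unfolding alg_ker_def by (intro prod.cong refl cell_ker_cong) (auto simp: alg_qubits_def)

lemma gram_cell_ker:
  assumes "density_mat (2 ^ n) \<rho>0" "density_mat (2 ^ n) \<rho>1"
  shows "gram (cell_ker n \<rho>0 \<rho>1 C)"
proof (cases C)
  case (fields a P Q \<theta>)
  have "gram (\<lambda>X Y. of_bool (a \<notin> X \<and> a \<notin> Y) :: complex)"
    unfolding gram_def by (rule exI[of _ "[\<lambda>X. of_bool (a \<notin> X)]"]) auto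
  from gram_mult[OF this gram_mult[OF gram_density[OF assms(1), of P] gram_density[OF assms(2), of Q]]]
  show ?thesis unfolding fields by (simp add: cell_ker.simps[abs_def])
qed

lemma gram_alg_ker:
  assumes "density_mat (2 ^ n) \<rho>0" "density_mat (2 ^ n) \<rho>1"
  shows "gram (alg_ker n K M \<rho>0 \<rho>1 t)"
  unfolding alg_ker_def[abs_def] by (intro gram_prod gram_cell_ker assms)

lemma alg_cells_facts:
  fixes n K t :: nat
  assumes "length \<theta>s = M"
  defines "cs \<equiv> alg_cells n K M t \<theta>s"
  shows "(\<Union>C\<in>set cs. cell_qubits n C) = (\<Union>l\<in>{Suc (t * Suc M)..<t * Suc M + Suc M}. cell_qubits n (cell_at n K l 0))"
    and "(\<Prod>C\<leftarrow>cs. cell_ker n \<rho>0 \<rho>1 C X Y) = (\<Prod>l\<in>{Suc (t * Suc M)..<t * Suc M + Suc M}. cell_ker n \<rho>0 \<rho>1 (cell_at n K l 0) X Y)"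
    and "map cell_angle cs = \<theta>s"
    and "length cs = M"
proof -
  let ?ls = "[Suc (t * Suc M)..<t * Suc M + Suc M]"
  have len: "length ?ls = length \<theta>s" using assms(1) by simp
  have fst: "map fst (zip ?ls \<theta>s) = ?ls" and snd: "map snd (zip ?ls \<theta>s) = \<theta>s"
    using len by (simp_all add: map_fst_zip map_snd_zip)
  have "(\<Union>C\<in>set cs. cell_qubits n C) = (\<Union>j\<in>set (zip ?ls \<theta>s). cell_qubits n (cell_at n K (fst j) 0))"
    unfolding cs_def alg_cells_def by (auto simp: case_prod_unfold cell_at_def)
  also have "\<dots> = (\<Union>l\<in>set (map fst (zip ?ls \<theta>s)). cell_qubits n (cell_at n K l 0))" by simp
  finally show "(\<Union>C\<in>set cs. cell_qubits n C) = (\<Union>l\<in>{Suc (t * Suc M)..<t * Suc M + Suc M}. cell_qubits n (cell_at n K l 0))"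
    unfolding fst set_upt .
  have "map (\<lambda>C. cell_ker n \<rho>0 \<rho>1 C X Y) cs = map (\<lambda>l. cell_ker n \<rho>0 \<rho>1 (cell_at n K l 0) X Y) (map fst (zip ?ls \<theta>s))"
    unfolding cs_def alg_cells_def map_map
    by (rule map_cong[OF refl]) (simp add: case_prod_unfold cell_at_def)
  thus "(\<Prod>C\<leftarrow>cs. cell_ker n \<rho>0 \<rho>1 C X Y) = (\<Prod>l\<in>{Suc (t * Suc M)..<t * Suc M + Suc M}. cell_ker n \<rho>0 \<rho>1 (cell_at n K l 0) X Y)"
    unfolding fst by (simp only: prod.distinct_set_conv_list[OF distinct_upt, symmetric] set_upt)
  have "map cell_angle cs = map snd (zip ?ls \<theta>s)"
    unfolding cs_def alg_cells_def map_map by (rule map_cong[OF refl]) (auto simp: cell_angle_def cell_at_def)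
  thus "map cell_angle cs = \<theta>s" unfolding snd .
  thus "length cs = M" using assms(1) by (metis length_map)
qed

lemma gram_prod_list: "(\<And>C. C \<in> set cs \<Longrightarrow> gram (s C)) \<Longrightarrow> gram (\<lambda>X Y. \<Prod>C\<leftarrow>cs. s C X Y)"
  by (induction cs) (auto intro: gram_one gram_mult)

lemma alg_layout:
  assumes len: "length \<theta>s = M" and tK: "t * Suc M + Suc M \<le> K"
  shows "layout n (cell_qubits n (cell_at n K (t * Suc M) 0)) (alg_cells n K M t \<theta>s)"
proof -
  let ?ls = "[Suc (t * Suc M)..<t * Suc M + Suc M]"
  have fst: "map fst (zip ?ls \<theta>s) = ?ls" using len by (simp add: map_fst_zip)
  have m: "fst j \<in> set ?ls" if "j \<in> set (zip ?ls \<theta>s)" for j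
    using that by (metis fst image_eqI list.set_map)
  have m': "t * Suc M < fst j" "fst j < K" if "j \<in> set (zip ?ls \<theta>s)" for j
    using m[OF that] tK unfolding set_upt atLeastLessThan_iff by linarith+
  show ?thesis unfolding alg_cells_def
  proof (rule layout_cell_at)
    show "distinct (map fst (zip ?ls \<theta>s))" unfolding fst by simp
    show "fst j < K" if "j \<in> set (zip ?ls \<theta>s)" for j by (rule m'(2)[OF that])
    show "cell_qubits n (cell_at n K (fst j) 0) \<inter> cell_qubits n (cell_at n K (t * Suc M) 0) = {}"
      if "j \<in> set (zip ?ls \<theta>s)" for j
    proof (rule cell_at_disjoint)
      show "t * Suc M < K" using m'[OF that] by linarith
      show "fst j \<noteq> t * Suc M" using m'(1)[OF that] by linarith
    qed (rule m'(2)[OF that])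
  qed
qed

lemma alg_qubits_split:
  assumes "length \<theta>s = M"
  shows "alg_qubits n K M t = insert (t * Suc M) (blkset n (reg n K (t * Suc M) (\<not> b)) \<union>
    (blkset n (reg n K (t * Suc M) b) \<union> (\<Union>C\<in>set (alg_cells n K M t \<theta>s). cell_qubits n C)))"
proof -
  have "{t * Suc M..<t * Suc M + Suc M} = insert (t * Suc M) {Suc (t * Suc M)..<t * Suc M + Suc M}" by auto
  thus ?thesis unfolding alg_qubits_def alg_cells_facts(1)[OF assms]
    by (cases b) (auto simp: cell_at_def reg_def simp del: atLeastLessThan_iff)
qed

text \<open>The initial kernel of a test factors into the control at 0, the register S of the first
  cell that is not tested, the tested register T, and the remaining cells.
  \<open>test_expectation\<close> handles the control, \<open>trace_unused\<close> removes S, and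
  \<open>trace_cells\<close> removes the cells.\<close>

lemma alg_test_expectation:
  assumes d0: "density_mat (2 ^ n) \<rho>0" and d1: "density_mat (2 ^ n) \<rho>1"
    and len: "length \<theta>s = M" and tK: "t * Suc M + Suc M \<le> K"
  defines "\<rho> \<equiv> if odd t then \<rho>1 else \<rho>0"
  shows "(\<Sum>X\<in>Pow (alg_qubits n K M t). (if t * Suc M \<in> X then - 1 else 1) *
      ker_acts (alg_test n K M t \<zeta> \<theta>s) (alg_ker n K M \<rho>0 \<rho>1 t) X X) =
    complex_of_real (Re (\<zeta> * (\<Sum>i<2 ^ n. cells_evolve n \<rho>0 \<rho>1 (alg_cells n K M t \<theta>s) (\<lambda>x y. \<rho> $$ (x, y)) i i)))"
proof -
  define c where "c = t * Suc M"
  define cs where "cs = alg_cells n K M t \<theta>s"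
  define T where "T = reg n K c (odd t)"
  define S where "S = reg n K c (\<not> odd t)"
  define \<sigma> where "\<sigma> = (if odd t then \<rho>0 else \<rho>1)"
  define G where "G = blkset n T \<union> (\<Union>C\<in>set cs. cell_qubits n C)"
  define D where "D = cell_qubits n (cell_at n K c 0)"
  have cK: "c < K" using tK by (simp add: c_def)
  note inner = cell_at_inner[OF cK, of n]
  have lay: "layout n D cs" unfolding D_def c_def cs_def by (rule alg_layout[OF len tK])
  have TS: "blkset n T \<subseteq> D" "blkset n S \<subseteq> D" "c \<in> D" "blkset n T \<inter> blkset n S = {}" "c \<notin> blkset n T" "c \<notin> blkset n S"
    using inner unfolding T_def S_def D_def reg_def cell_at_def cell_qubits.simps by (cases "odd t"; auto simp del: atLeastLessThan_iff)+
  have dr: "density_mat (2 ^ n) \<rho>" "density_mat (2 ^ n) \<sigma>" using d0 d1 by (auto simp: \<rho>_def \<sigma>_def)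
  define f where "f X Y = \<rho> $$ (blk n T X, blk n T Y) * (\<Prod>C\<leftarrow>cs. cell_ker n \<rho>0 \<rho>1 C X Y)" for X Y
  define s where "s X Y = \<sigma> $$ (blk n S X, blk n S Y) * f X Y" for X Y
  have CD: "cell_qubits n C \<inter> D = {}" if "C \<in> set cs" for C by (rule layout_disjoint[OF lay that])
  have gf: "gram f"
    unfolding f_def by (intro gram_mult gram_density dr gram_prod_list gram_cell_ker d0 d1)
  have gs: "gram s" unfolding s_def by (intro gram_mult gram_density dr gf)
  have indep: "f X Y = f X' Y'"
    if "X \<inter> G = X' \<inter> G" "Y \<inter> G = Y' \<inter> G" for X Y X' Y'
  proof -
    have "blk n T X = blk n T X'" "blk n T Y = blk n T Y'"
      by (intro blk_cong; use that in \<open>unfold G_def, blast\<close>)+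
    moreover have "(\<Prod>C\<leftarrow>cs. cell_ker n \<rho>0 \<rho>1 C X Y) = (\<Prod>C\<leftarrow>cs. cell_ker n \<rho>0 \<rho>1 C X' Y')"
      by (intro arg_cong[where f = prod_list] map_cong refl cell_ker_cong; use that in \<open>unfold G_def, blast\<close>)
    ultimately show ?thesis by (simp add: f_def)
  qed
  have cG: "c \<notin> G" unfolding G_def using TS CD by blast
  have SG: "blkset n S \<inter> G = {}" unfolding G_def using TS CD by blast
  have split: "alg_ker n K M \<rho>0 \<rho>1 t X Y = of_bool (c \<notin> X \<and> c \<notin> Y) * s X Y" for X Y
  proof -
    have I: "{t * Suc M..<t * Suc M + Suc M} = insert c {Suc c..<t * Suc M + Suc M}" by (auto simp: c_def)
    have "alg_ker n K M \<rho>0 \<rho>1 t X Y = cell_ker n \<rho>0 \<rho>1 (cell_at n K c 0) X Y *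
        (\<Prod>l\<in>{Suc c..<t * Suc M + Suc M}. cell_ker n \<rho>0 \<rho>1 (cell_at n K l 0) X Y)"
      unfolding alg_ker_def I by (rule prod.insert) auto
    also have "(\<Prod>l\<in>{Suc c..<t * Suc M + Suc M}. cell_ker n \<rho>0 \<rho>1 (cell_at n K l 0) X Y) = (\<Prod>C\<leftarrow>cs. cell_ker n \<rho>0 \<rho>1 C X Y)"
      unfolding cs_def alg_cells_facts(2)[OF len] c_def ..
    finally show ?thesis
      by (simp add: s_def f_def cell_at_def T_def S_def reg_def \<rho>_def \<sigma>_def mult_ac)
  qed
  have sc: "s (X - {c}) (Y - {c}) = s X Y" for X Y
  proof -
    have "f (X - {c}) (Y - {c}) = f X Y" by (rule indep) (use cG in blast)+
    moreover have "blk n S (X - {c}) = blk n S X" "blk n S (Y - {c}) = blk n S Y"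
      by (intro blk_cong; use TS in blast)+
    ultimately show ?thesis by (simp add: s_def)
  qed
  have lay2: "insert c (blkset n T) \<subseteq> D" using TS by blast
  have fin: "finite (blkset n S \<union> G)" by (simp add: G_def)
  have cSG: "c \<notin> blkset n S \<union> G" using cG TS by blast
  have q: "alg_qubits n K M t = insert c (blkset n S \<union> G)"
    unfolding c_def S_def T_def G_def cs_def by (rule alg_qubits_split[OF len])
  have "(\<Sum>X\<in>Pow (alg_qubits n K M t). (if t * Suc M \<in> X then - 1 else 1) *
      ker_acts (alg_test n K M t \<zeta> \<theta>s) (alg_ker n K M \<rho>0 \<rho>1 t) X X) =
    (\<Sum>X\<in>Pow (insert c (blkset n S \<union> G)). (if c \<in> X then - 1 else 1) *
      ker_acts (test_gates n \<zeta> c T cs) (\<lambda>X Y. of_bool (c \<notin> X \<and> c \<notin> Y) * s X Y) X X)"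
    unfolding q alg_test_def c_def[symmetric] T_def[symmetric] cs_def[symmetric] split[abs_def] ..
  also have "\<dots> = complex_of_real (Re (\<zeta> * (\<Sum>X\<in>Pow (blkset n S \<union> G). cells_fun n T cs (\<lambda>X'. s X' X) X)))"
    by (rule test_expectation[OF lay lay2 TS(5) fin cSG gs sc])
  also have "(\<Sum>X\<in>Pow (blkset n S \<union> G). cells_fun n T cs (\<lambda>X'. s X' X) X) =
    (\<Sum>X\<in>Pow G. cells_fun n T cs (\<lambda>X'. f X' X) X)"
    unfolding s_def G_def
  proof (rule trace_unused[OF lay TS(1,2,4) density_trace[OF dr(2)]])
    fix X Z Y W :: "nat set" assume "Z \<subseteq> blkset n S" "W \<subseteq> blkset n S"
    thus "f (X - blkset n S \<union> Z) (Y - blkset n S \<union> W) = f X Y"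
      by (intro indep) (use SG in blast)+
  qed
  also have "\<dots> = (\<Sum>i<2 ^ n. cells_evolve n \<rho>0 \<rho>1 cs (\<lambda>x y. \<rho> $$ (x, y)) i i)"
    unfolding f_def G_def
    using trace_cells[OF lay TS(1) density_trace[OF d0] density_trace[OF d1], of "\<lambda>x y. \<rho> $$ (x, y)"] by simp
  finally show ?thesis unfolding cs_def .
qed

lemma alg_trace:
  assumes d0: "density_mat (2 ^ n) \<rho>0" and d1: "density_mat (2 ^ n) \<rho>1"
    and tK: "t * Suc M + Suc M \<le> K"
  shows "(\<Sum>X\<in>Pow (alg_qubits n K M t). alg_ker n K M \<rho>0 \<rho>1 t X X) = 1"
proof -
  let ?I = "{t * Suc M..<t * Suc M + Suc M}"
  have "(\<Sum>X\<in>Pow (alg_qubits n K M t). alg_ker n K M \<rho>0 \<rho>1 t X X) =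
    (\<Sum>X\<in>Pow (\<Union>l\<in>?I. cell_qubits n (cell_at n K l 0)).
      \<Prod>l\<in>?I. cell_ker n \<rho>0 \<rho>1 (cell_at n K l 0) (X \<inter> cell_qubits n (cell_at n K l 0)) (X \<inter> cell_qubits n (cell_at n K l 0)))"
    unfolding alg_qubits_def alg_ker_def by (intro sum.cong prod.cong refl cell_ker_cong) auto
  also have "\<dots> = (\<Prod>l\<in>?I. \<Sum>X\<in>Pow (cell_qubits n (cell_at n K l 0)). cell_ker n \<rho>0 \<rho>1 (cell_at n K l 0) X X)"
  proof (rule sum_Pow_UN_prod)
    show "cell_qubits n (cell_at n K i 0) \<inter> cell_qubits n (cell_at n K j 0) = {}"
      if "i \<in> ?I" "j \<in> ?I" "i \<noteq> j" for i j
      by (rule cell_at_disjoint) (use that tK in auto)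
  qed auto
  also have "\<dots> = (\<Prod>l\<in>?I. 1)"
    by (intro prod.cong refl cell_trace density_trace d0 d1) (use tK in auto)
  finally show ?thesis by simp
qed

text \<open>Since the blocks of the tests exhaust the register, the Born distribution of the final
  state is the product of the block distributions, with nothing left to marginalise.\<close>

lemma alg_qubits_cover:
  assumes n: "1 \<le> n" and K: "K = k * Suc M"
  shows "(\<Union>t<k. alg_qubits n K M t) = {..<n * K + n * K + K}"
proof -
  have 1: "(\<Union>t<k. alg_qubits n K M t) = (\<Union>l<K. cell_qubits n (cell_at n K l 0))"
  proof -
    have "(\<Union>t<k. {t * Suc M..<t * Suc M + Suc M}) = {..<K}"
    proof (intro equalityI subsetI)
      fix l assume "l \<in> (\<Union>t<k. {t * Suc M..<t * Suc M + Suc M})"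
      then obtain t where t: "t < k" "l < t * Suc M + Suc M" by auto
      have "Suc t * Suc M \<le> k * Suc M" by (rule mult_le_mono1) (use t in simp)
      thus "l \<in> {..<K}" using t K by simp
    next
      fix l assume "l \<in> {..<K}"
      hence "l div Suc M < k" unfolding K by (simp add: less_mult_imp_div_less del: mult_Suc_right)
      moreover have "l div Suc M * Suc M \<le> l" "l < l div Suc M * Suc M + Suc M"
        using div_mult_mod_eq[of l "Suc M"] mod_less_divisor[of "Suc M" l] by linarith+
      ultimately show "l \<in> (\<Union>t<k. {t * Suc M..<t * Suc M + Suc M})" by auto
    qed
    thus ?thesis unfolding alg_qubits_def by blast
  qed
  have "q \<in> (\<Union>l<K. cell_qubits n (cell_at n K l 0))" if q: "q < n * K + n * K + K" for q
  proof -
    have dm: "(x::nat) div n < K \<and> n * (x div n) \<le> x \<and> x < n * (x div n) + n" if "x < n * K" for x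
    proof -
      have "x div n < K" using that by (simp add: less_mult_imp_div_less mult.commute)
      moreover have "x = n * (x div n) + x mod n" by simp
      moreover have "x mod n < n" using n by simp
      ultimately show ?thesis by linarith
    qed
    consider "q < K" | "K \<le> q" "q < K + n * K" | "K + n * K \<le> q" "q < K + n * K + n * K" using q by linarith
    thus ?thesis
    proof cases
      case 1
      thus ?thesis by (auto simp: cell_at_def)
    next
      case 2
      have "q - K < n * K" using 2 by linarith
      note dm[OF this]
      hence "(q - K) div n < K" "q \<in> blkset n (K + n * ((q - K) div n))"
        using 2(1) unfolding atLeastLessThan_iff by linarith+
      thus ?thesis by (auto simp: cell_at_def simp del: atLeastLessThan_iff)
    next
      case 3
      have "q - (K + n * K) < n * K" using 3 by linarith
      note dm[OF this]
      hence "(q - (K + n * K)) div n < K" "q \<in> blkset n (K + n * K + n * ((q - (K + n * K)) div n))"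
        using 3(1) unfolding atLeastLessThan_iff by linarith+
      thus ?thesis by (auto simp: cell_at_def simp del: atLeastLessThan_iff)
    qed
  qed
  moreover have "q < n * K + n * K + K" if "q \<in> (\<Union>l<K. cell_qubits n (cell_at n K l 0))" for q
    using that cell_at_bound by blast
  ultimately show ?thesis unfolding 1 by blast
qed

section \<open>Error probability and resources of the algorithm\<close>

lemma alg_fields:
  "copies0 (alg n N M \<zeta> \<theta> g) = 2 * N * Suc M" "copies1 (alg n N M \<zeta> \<theta> g) = 2 * N * Suc M"
  "ancillas (alg n N M \<zeta> \<theta> g) = 2 * N * Suc M"
  "gates (alg n N M \<zeta> \<theta> g) =
     concat (map (\<lambda>t. alg_test n (2 * N * Suc M) M t (\<zeta> (t div 2)) (\<theta> (t div 2))) [0..<2 * N])"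
  "estimate (alg n N M \<zeta> \<theta> g) =
     (\<lambda>x. g ((\<Sum>t<2 * N. (if odd t then - 1 else 1) * (if bit x (t * Suc M) then - 1 else 1)) / real N))"
  by (simp_all add: alg_def Let_def)

lemma alg_num_qubits: "num_qubits n (alg n N M \<zeta> \<theta> g) = n * (2 * N * Suc M) + n * (2 * N * Suc M) + 2 * N * Suc M"
  unfolding num_qubits_def alg_fields ..

lemma alg_range: "t < 2 * N \<Longrightarrow> t * Suc M + Suc M \<le> 2 * N * Suc M"
  using mult_le_mono1[of "Suc t" "2 * N" "Suc M"] by simp

lemma alg_test_valid:
  assumes g: "g \<in> set (alg_test n K M t \<zeta> \<theta>s)" and z: "cmod \<zeta> = 1" and len: "length \<theta>s = M"
    and tK: "t * Suc M + Suc M \<le> K"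
  shows "valid_gate (n * K + n * K + K) g \<and> gate_qubits g \<subseteq> alg_qubits n K M t"
proof -
  let ?c = "t * Suc M" and ?T = "reg n K (t * Suc M) (odd t)" and ?N = "n * K + n * K + K"
  let ?U = "insert ?c (blkset n ?T \<union> (\<Union>C\<in>set (alg_cells n K M t \<theta>s). cell_qubits n C))"
  have cK: "?c < K" using tK by simp
  note inner = cell_at_inner[OF cK, of n]
  have q: "?U \<subseteq> alg_qubits n K M t"
    unfolding alg_qubits_split[OF len, where b = "odd t"] by blast
  have b: "alg_qubits n K M t \<subseteq> {..<?N}"
  proof
    fix k assume "k \<in> alg_qubits n K M t"
    then obtain l where "l \<in> {t * Suc M..<t * Suc M + Suc M}" "k \<in> cell_qubits n (cell_at n K l 0)"
      unfolding alg_qubits_def by blast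
    moreover from this have "l < K" using tK by simp
    ultimately show "k \<in> {..<?N}" using cell_at_bound by simp
  qed
  have "valid_gate ?N g \<and> gate_qubits g \<subseteq> ?U"
  proof (rule test_gates_valid[OF g[unfolded alg_test_def] z alg_layout[OF len tK]])
    show "insert ?c (blkset n ?T) \<subseteq> cell_qubits n (cell_at n K ?c 0)"
      by (cases "odd t") (auto simp: cell_at_def reg_def)
    show "?c \<notin> blkset n ?T" using inner unfolding reg_def by (cases "odd t") (simp_all del: atLeastLessThan_iff)
    show "?U \<subseteq> {..<?N}" using q b by blast
  qed
  thus ?thesis using q by blast
qed

lemma length_alg_test: "length \<theta>s = M \<Longrightarrow> length (alg_test n K M t \<zeta> \<theta>s) = M * (28 * n + 5) + 2"
proof -
  assume len: "length \<theta>s = M"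
  have "length (cell_gates n c T C) = 28 * n + 5" for c T C by (cases C) (simp add: length_step)
  hence "length (concat (map (cell_gates n c T) cs)) = length cs * (28 * n + 5)" for c T cs
    by (induction cs) auto
  thus ?thesis using alg_cells_facts(4)[OF len] by (simp add: alg_test_def test_gates_def)
qed

lemma sum_pairs: "(\<Sum>t<2 * N. f t) = (\<Sum>i<N. f (2 * i) + f (Suc (2 * i)) :: real)"
  by (induction N) auto

text \<open>Tests 2i and 2i + 1 share phase and angles but probe \<rho>0 and \<rho>1. Counting the
  second one negatively, their expectations add up to a sum weighted by
  \<open>p k - q k = l k\<close>, so the average over i has the required mean. The function
  \<open>g\<close> is classical postprocessing, which enters only through \<open>P\<close>.\<close>

lemma alg_output:
  fixes l p q :: "nat \<Rightarrow> real"
  assumes n: "1 \<le> n" and N: "1 \<le> N" and z: "\<And>i. i < N \<Longrightarrow> cmod (\<zeta> i) = 1" and len: "\<And>i. i < N \<Longrightarrow> length (\<theta> i) = M"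
    and kap: "0 < \<kappa>" "6 \<le> N * \<kappa>\<^sup>2"
    and d0: "density_mat (2 ^ n) \<rho>0" and d1: "density_mat (2 ^ n) \<rho>1"
    and ev0: "\<And>cs. (\<Sum>t<2 ^ n. cells_evolve n \<rho>0 \<rho>1 cs (\<lambda>x y. \<rho>0 $$ (x, y)) t t) =
      (\<Sum>i<2 ^ n. complex_of_real (p i) * amp (map cell_angle cs) (l i))"
    and ev1: "\<And>cs. (\<Sum>t<2 ^ n. cells_evolve n \<rho>0 \<rho>1 cs (\<lambda>x y. \<rho>1 $$ (x, y)) t t) =
      (\<Sum>i<2 ^ n. complex_of_real (q i) * amp (map cell_angle cs) (l i))"
    and l: "\<And>i. i < 2 ^ n \<Longrightarrow> l i = p i - q i"
    and P: "\<And>y. \<bar>y - (\<Sum>k<2 ^ n. l k * ((\<Sum>i<N. Re (\<zeta> i * amp (\<theta> i) (l k))) / N))\<bar> \<le> \<kappa> \<Longrightarrow> P (g y)"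
  shows "2/3 \<le> output_prob n (alg n N M \<zeta> \<theta> g) \<rho>0 \<rho>1 P"
proof -
  define K where "K = 2 * N * Suc M"
  let ?Q = "alg n N M \<zeta> \<theta> g"
  let ?nq = "n * K + n * K + K"
  let ?B = "alg_qubits n K M" and ?s = "alg_ker n K M \<rho>0 \<rho>1"
  let ?gs = "\<lambda>t. alg_test n K M t (\<zeta> (t div 2)) (\<theta> (t div 2))"
  have tK: "t * Suc M + Suc M \<le> K" if "t < 2 * N" for t unfolding K_def by (rule alg_range[OF that])
  have t2: "t div 2 < N" if "t < 2 * N" for t using that by auto
  define F where "F t = ker_acts (?gs t) (?s t)" for t
  have finB: "finite (?B t)" for t by (simp add: alg_qubits_def)
  have disB: "?B t \<inter> ?B u = {}" if "t < 2 * N" "u < 2 * N" "t \<noteq> u" for t u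
    by (rule alg_qubits_disjoint) (use tK that in auto)
  have cover: "(\<Union>t<2 * N. ?B t) = {..<?nq}" by (rule alg_qubits_cover[OF n]) (simp add: K_def)
  have gval: "valid_gate ?nq g' \<and> gate_qubits g' \<subseteq> ?B t" if "t < 2 * N" "g' \<in> set (?gs t)" for t g'
    by (rule alg_test_valid[OF that(2) z len tK]) (use that t2 in auto)
  have gF: "gram (F t)" for t unfolding F_def by (intro gram_ker_acts gram_alg_ker d0 d1)
  have car: "\<rho>0 \<in> carrier_mat (2 ^ n) (2 ^ n)" "\<rho>1 \<in> carrier_mat (2 ^ n) (2 ^ n)"
    using d0 d1 by (auto simp: density_mat_def psd_mat_def)
  have nq: "num_qubits n ?Q = ?nq" unfolding alg_num_qubits K_def ..
  have "represents ?nq (final_state n ?Q \<rho>0 \<rho>1)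
    (ker_acts (gates ?Q) (\<lambda>X Y. \<Prod>l<K. cell_ker n \<rho>0 \<rho>1 (cell_at n K l 0) X Y))"
    unfolding final_state_def nq
  proof (rule represents_run_gates)
    show "represents ?nq (initial_state ?Q \<rho>0 \<rho>1) (\<lambda>X Y. \<Prod>l<K. cell_ker n \<rho>0 \<rho>1 (cell_at n K l 0) X Y)"
      unfolding nq[symmetric] by (rule initial_state_kernel[OF car]) (simp_all only: alg_fields K_def)
    fix g' assume "g' \<in> set (gates ?Q)"
    then obtain t where "t < 2 * N" "g' \<in> set (?gs t)" unfolding alg_fields K_def by auto
    from gval[OF this] show "gate_qubits g' \<subseteq> {..<?nq}" by (blast dest: valid_gate_qubits)
  qed
  also have "(\<lambda>X Y. \<Prod>l<K. cell_ker n \<rho>0 \<rho>1 (cell_at n K l 0) X Y) =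
    (\<lambda>X Y. \<Prod>t<2 * N. ?s t (X \<inter> ?B t) (Y \<inter> ?B t))"
    unfolding alg_ker_restrict unfolding alg_ker_def K_def
    by (simp only: prod.nat_group)
  also have "gates ?Q = concat (map ?gs [0..<2 * N])" unfolding alg_fields K_def ..
  also have "ker_acts (concat (map ?gs [0..<2 * N])) (\<lambda>X Y. \<Prod>t<2 * N. ?s t (X \<inter> ?B t) (Y \<inter> ?B t)) =
    (\<lambda>X Y. \<Prod>t<2 * N. F t (X \<inter> ?B t) (Y \<inter> ?B t))"
    unfolding F_def by (rule ker_acts_concat_prod) (use gval disB in auto)
  finally have rep: "represents ?nq (final_state n ?Q \<rho>0 \<rho>1) (\<lambda>X Y. \<Prod>t<2 * N. F t (X \<inter> ?B t) (Y \<inter> ?B t))" .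
  define pr where "pr t X = Re (F t X X)" for t X
  have Fr: "F t X X = complex_of_real (pr t X)" for t X
    using gram_cnj[OF gF, of t X X] by (simp add: pr_def complex_eq_iff)
  have pr0: "0 \<le> pr t X" for t X unfolding pr_def by (rule gram_diag_nonneg[OF gF])
  define sg where "sg t X = (if odd t then - 1 else 1) * (if t * Suc M \<in> X then - 1 else 1 :: real)" for t X
  define e where "e t = (if odd t then - (\<Sum>k<2 ^ n. q k * Re (\<zeta> (t div 2) * amp (\<theta> (t div 2)) (l k)))
    else (\<Sum>k<2 ^ n. p k * Re (\<zeta> (t div 2) * amp (\<theta> (t div 2)) (l k))))" for t
  have cT: "t * Suc M \<in> ?B t" for t unfolding alg_qubits_def by (auto simp: cell_at_def)
  have one: "(\<Sum>X\<in>Pow (?B t). pr t X) = 1" if "t < 2 * N" for t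
  proof -
    have "(\<Sum>X\<in>Pow (?B t). F t X X) = (\<Sum>X\<in>Pow (?B t). ?s t X X)"
      unfolding F_def by (rule ker_acts_trace[OF gval[OF that] finB])
    also have "\<dots> = 1" by (rule alg_trace[OF d0 d1 tK[OF that]])
    finally show ?thesis by (simp add: Fr flip: of_real_sum)
  qed
  have ex: "(\<Sum>X\<in>Pow (?B t). pr t X * sg t X) = e t" if t: "t < 2 * N" for t
  proof -
    let ?v = "\<lambda>k. if odd t then q k else p k"
    have ang: "map cell_angle (alg_cells n K M t (\<theta> (t div 2))) = \<theta> (t div 2)"
      by (rule alg_cells_facts(3)[OF len[OF t2[OF t]]])
    have "(\<Sum>X\<in>Pow (?B t). (if t * Suc M \<in> X then - 1 else 1) * F t X X) =
      complex_of_real (Re (\<zeta> (t div 2) * (\<Sum>i<2 ^ n. cells_evolve n \<rho>0 \<rho>1 (alg_cells n K M t (\<theta> (t div 2)))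
        (\<lambda>x y. (if odd t then \<rho>1 else \<rho>0) $$ (x, y)) i i)))"
      unfolding F_def by (rule alg_test_expectation[OF d0 d1 len[OF t2[OF t]] tK[OF t]])
    also have "(\<Sum>i<2 ^ n. cells_evolve n \<rho>0 \<rho>1 (alg_cells n K M t (\<theta> (t div 2)))
        (\<lambda>x y. (if odd t then \<rho>1 else \<rho>0) $$ (x, y)) i i) =
      (\<Sum>k<2 ^ n. complex_of_real (?v k) * amp (\<theta> (t div 2)) (l k))"
      using ev0 ev1 by (cases "odd t") (simp_all add: ang)
    also have "Re (\<zeta> (t div 2) * \<dots>) = (\<Sum>k<2 ^ n. ?v k * Re (\<zeta> (t div 2) * amp (\<theta> (t div 2)) (l k)))"
      by (simp add: sum_distrib_left algebra_simps)
    also have "(\<Sum>X\<in>Pow (?B t). (if t * Suc M \<in> X then - 1 else 1) * F t X X) =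
      complex_of_real (\<Sum>X\<in>Pow (?B t). (if t * Suc M \<in> X then - 1 else 1) * pr t X)"
      unfolding of_real_sum by (intro sum.cong refl) (simp add: Fr)
    finally have "(\<Sum>X\<in>Pow (?B t). (if t * Suc M \<in> X then - 1 else 1) * pr t X) =
      (\<Sum>k<2 ^ n. ?v k * Re (\<zeta> (t div 2) * amp (\<theta> (t div 2)) (l k)))"
      by (simp only: of_real_eq_iff)
    moreover have "(\<Sum>X\<in>Pow (?B t). pr t X * sg t X) = (if odd t then - 1 else 1) *
        (\<Sum>X\<in>Pow (?B t). (if t * Suc M \<in> X then - 1 else 1) * pr t X)"
      unfolding sum_distrib_left sg_def by (intro sum.cong refl) simp
    ultimately show ?thesis unfolding e_def by auto
  qed
  have sume: "(\<Sum>t<2 * N. e t) = N * (\<Sum>k<2 ^ n. l k * ((\<Sum>i<N. Re (\<zeta> i * amp (\<theta> i) (l k))) / N))"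
  proof -
    have "(\<Sum>t<2 * N. e t) = (\<Sum>i<N. \<Sum>k<2 ^ n. l k * Re (\<zeta> i * amp (\<theta> i) (l k)))"
      unfolding sum_pairs by (intro sum.cong refl)
        (simp add: e_def l left_diff_distrib sum_subtractf)
    also have "\<dots> = (\<Sum>k<2 ^ n. l k * (\<Sum>i<N. Re (\<zeta> i * amp (\<theta> i) (l k))))"
      unfolding sum_distrib_left by (rule sum.swap)
    also have "\<dots> = N * (\<Sum>k<2 ^ n. l k * ((\<Sum>i<N. Re (\<zeta> i * amp (\<theta> i) (l k))) / N))"
      unfolding sum_distrib_left[of "real N"] using N by (intro sum.cong refl) simp
    finally show ?thesis .
  qed
  have rpos: "0 < N * \<kappa>" using N kap by simp
  have est: "(\<Sum>t<2 * N. (if odd t then - 1 else 1) * (if bit x (t * Suc M) then - 1 else 1 :: real)) =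
    (\<Sum>t<2 * N. sg t (conf x \<inter> ?B t))" for x
    by (intro sum.cong refl) (use cT in \<open>auto simp: sg_def conf_def\<close>)
  \<comment> \<open>The constant 6: there are 2N signs and the tolerance for their sum is N\<kappa>,
    so the failure probability is at most 2/(N\<kappa>^2), and this must not exceed 1/3.\<close>
  have "2/3 \<le> 1 - (2 * N) / (N * \<kappa>)\<^sup>2"
  proof -
    have "(2 * N) / (N * \<kappa>)\<^sup>2 = 2 / (N * \<kappa>\<^sup>2)" using N kap by (simp add: power_mult_distrib power2_eq_square)
    also have "\<dots> \<le> 2 / 6" using kap by (intro divide_left_mono) auto
    finally show ?thesis by simp
  qed
  also have "1 - (2 * N) / (N * \<kappa>)\<^sup>2 \<le> (\<Sum>X | X \<in> Pow (\<Union>t<2 * N. ?B t) \<and>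
      \<bar>(\<Sum>t<2 * N. sg t (X \<inter> ?B t)) - (\<Sum>t<2 * N. e t)\<bar> \<le> N * \<kappa>. \<Prod>t<2 * N. pr t (X \<inter> ?B t))"
    using product_chebyshev[of "2 * N" ?B pr sg e "N * \<kappa>", OF finB disB pr0 one ex _ rpos]
    by (simp add: sg_def)
  also have "\<dots> \<le> (\<Sum>X | X \<in> Pow {..<?nq} \<and> P (g ((\<Sum>t<2 * N. sg t (X \<inter> ?B t)) / N)). \<Prod>t<2 * N. pr t (X \<inter> ?B t))"
  proof (rule sum_mono2)
    show "{X. X \<in> Pow (\<Union>t<2 * N. ?B t) \<and> \<bar>(\<Sum>t<2 * N. sg t (X \<inter> ?B t)) - (\<Sum>t<2 * N. e t)\<bar> \<le> N * \<kappa>} \<subseteq>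
      {X. X \<in> Pow {..<?nq} \<and> P (g ((\<Sum>t<2 * N. sg t (X \<inter> ?B t)) / N))}"
    proof (rule subsetI, unfold mem_Collect_eq, intro conjI)
      fix X assume *: "X \<in> Pow (\<Union>t<2 * N. ?B t) \<and> \<bar>(\<Sum>t<2 * N. sg t (X \<inter> ?B t)) - (\<Sum>t<2 * N. e t)\<bar> \<le> N * \<kappa>"
      thus "X \<in> Pow {..<?nq}" unfolding cover by blast
      let ?S = "\<Sum>t<2 * N. sg t (X \<inter> ?B t)" and ?m = "\<Sum>k<2 ^ n. l k * ((\<Sum>i<N. Re (\<zeta> i * amp (\<theta> i) (l k))) / N)"
      have "N * \<bar>?S / N - ?m\<bar> = \<bar>N * (?S / N - ?m)\<bar>" by (simp add: abs_mult)
      also have "N * (?S / N - ?m) = ?S - N * ?m" using N by (simp add: right_diff_distrib)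
      finally have "N * \<bar>?S / N - ?m\<bar> \<le> N * \<kappa>" using * unfolding sume by simp
      hence "\<bar>?S / N - ?m\<bar> \<le> \<kappa>" using N by simp
      thus "P (g (?S / N))" by (rule P)
    qed
  qed (simp_all add: prod_nonneg pr0)
  also have "\<dots> = output_prob n ?Q \<rho>0 \<rho>1 P"
  proof -
    have "output_prob n ?Q \<rho>0 \<rho>1 P = (\<Sum>x | x \<in> {..<2 ^ ?nq} \<and> P (estimate ?Q x). Re (final_state n ?Q \<rho>0 \<rho>1 $$ (x, x)))"
      unfolding output_prob_def nq by simp
    also have "\<dots> = (\<Sum>x<2 ^ ?nq. if P (estimate ?Q x) then Re (final_state n ?Q \<rho>0 \<rho>1 $$ (x, x)) else 0)"
      by (rule sum.inter_filter) simp
    also have "\<dots> = (\<Sum>x<2 ^ ?nq. if P (g ((\<Sum>t<2 * N. sg t (conf x \<inter> ?B t)) / N))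
        then \<Prod>t<2 * N. pr t (conf x \<inter> ?B t) else 0)"
    proof (intro sum.cong refl)
      fix x assume "x \<in> {..<(2::nat) ^ ?nq}"
      hence "final_state n ?Q \<rho>0 \<rho>1 $$ (x, x) = (\<Prod>t<2 * N. F t (conf x \<inter> ?B t) (conf x \<inter> ?B t))"
        using rep unfolding represents_def by simp
      also have "\<dots> = complex_of_real (\<Prod>t<2 * N. pr t (conf x \<inter> ?B t))" unfolding Fr of_real_prod ..
      finally have fs: "final_state n ?Q \<rho>0 \<rho>1 $$ (x, x) = complex_of_real (\<Prod>t<2 * N. pr t (conf x \<inter> ?B t))" .
      show "(if P (estimate ?Q x) then Re (final_state n ?Q \<rho>0 \<rho>1 $$ (x, x)) else 0) =
        (if P (g ((\<Sum>t<2 * N. sg t (conf x \<inter> ?B t)) / N)) then \<Prod>t<2 * N. pr t (conf x \<inter> ?B t) else 0)"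
        unfolding alg_fields est fs Re_complex_of_real ..
    qed
    also have "\<dots> = (\<Sum>X\<in>Pow {..<?nq}. if P (g ((\<Sum>t<2 * N. sg t (X \<inter> ?B t)) / N))
        then \<Prod>t<2 * N. pr t (X \<inter> ?B t) else 0)"
      by (rule sum_conf)
    also have "\<dots> = (\<Sum>X | X \<in> Pow {..<?nq} \<and> P (g ((\<Sum>t<2 * N. sg t (X \<inter> ?B t)) / N)). \<Prod>t<2 * N. pr t (X \<inter> ?B t))"
      by (rule sum.inter_filter[symmetric]) simp
    finally show ?thesis by simp
  qed
  finally show ?thesis .
qed

lemma alg_resources:
  assumes z: "\<And>i. i < N \<Longrightarrow> cmod (\<zeta> i) = 1" and len: "\<And>i. i < N \<Longrightarrow> length (\<theta> i) = M"
  shows "valid_algorithm n (alg n N M \<zeta> \<theta> g)"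
    and "sample_count (alg n N M \<zeta> \<theta> g) = 4 * N * Suc M"
    and "gate_count (alg n N M \<zeta> \<theta> g) = 2 * N * (M * (28 * n + 5) + 2)"
proof -
  show "sample_count (alg n N M \<zeta> \<theta> g) = 4 * N * Suc M" unfolding sample_count_def alg_fields by simp
  show "valid_algorithm n (alg n N M \<zeta> \<theta> g)"
    unfolding valid_algorithm_def alg_num_qubits
  proof
    fix g' assume "g' \<in> set (gates (alg n N M \<zeta> \<theta> g))"
    then obtain t where t: "t < 2 * N" "g' \<in> set (alg_test n (2 * N * Suc M) M t (\<zeta> (t div 2)) (\<theta> (t div 2)))"
      unfolding alg_fields by auto
    have "t div 2 < N" using t by auto
    thus "valid_gate (n * (2 * N * Suc M) + n * (2 * N * Suc M) + 2 * N * Suc M) g'"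
      using alg_test_valid[OF t(2) z len alg_range[OF t(1)]] by blast
  qed
  have "length (alg_test n K M t (\<zeta> (t div 2)) (\<theta> (t div 2))) = M * (28 * n + 5) + 2" if "t < 2 * N" for t K
    by (rule length_alg_test[OF len]) (use that in auto)
  hence "map (\<lambda>t. length (alg_test n (2 * N * Suc M) M t (\<zeta> (t div 2)) (\<theta> (t div 2)))) [0..<2 * N] =
    map (\<lambda>t. M * (28 * n + 5) + 2) [0..<2 * N]"
    by (intro map_cong refl) auto
  thus "gate_count (alg n N M \<zeta> \<theta> g) = 2 * N * (M * (28 * n + 5) + 2)"
    unfolding gate_count_def alg_fields length_concat map_map o_def by (simp only: sum_list_triv length_map length_upt) simp
qed

section \<open>Approximation by trigonometric functions\<close>

definition sinc :: "real \<Rightarrow> real" where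
  "sinc u = (if u = 0 then 1 else sin u / u)"

lemma sinc_mult: "u * sinc u = sin u"
  by (simp add: sinc_def)

lemma sinc_minus [simp]: "sinc (- u) = sinc u"
  by (simp add: sinc_def)

lemma abs_sinc_le_1: "\<bar>sinc u\<bar> \<le> 1"
proof (cases "u = 0")
  case False
  have "\<bar>sin u\<bar> \<le> \<bar>u\<bar>" by (rule abs_sin_x_le_abs_x)
  thus ?thesis using False by (simp add: sinc_def)
qed (simp add: sinc_def)

lemma continuous_on_sinc: "continuous_on UNIV sinc"
proof (rule continuous_at_imp_continuous_on, rule ballI)
  fix u :: real
  show "isCont sinc u"
  proof (cases "u = 0")
    case True
    have "((\<lambda>x. sin x / x) \<longlongrightarrow> 1) (at (0::real))"
      using DERIV_sin[of 0] by (simp add: has_field_derivative_iff)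
    hence "(sinc \<longlongrightarrow> 1) (at 0)"
      by (rule Lim_transform_eventually) (auto simp: eventually_at sinc_def intro!: exI[of _ 1])
    thus ?thesis unfolding True by (simp add: isCont_def sinc_def)
  next
    case False
    have "isCont (\<lambda>x. sin x / x) u" using False by (intro continuous_intros)
    moreover have "\<forall>\<^sub>F x in nhds u. sin x / x = sinc x"
      using eventually_nhds_in_open[of "- {0}" u] False by (auto elim!: eventually_mono simp: sinc_def)
    ultimately show ?thesis using isCont_cong[of "\<lambda>x. sin x / x" sinc u] by blast
  qed
qed

lemma continuous_on_sinc' [continuous_intros]: "continuous_on S f \<Longrightarrow> continuous_on S (\<lambda>x. sinc (f x))"
  using continuous_on_compose2[OF continuous_on_sinc] by auto

text \<open>\<open>sinc\<close> is an average of cosines of frequency at most 1;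
  \<open>osc_sinc\<close> draws its frequency bound from this.\<close>

lemma has_integral_sinc: "((\<lambda>s. cos (s * u)) has_integral sinc u) {0..1}"
proof (cases "u = 0")
  case False
  have "((\<lambda>s. cos (s * u)) has_integral (sin (1 * u) / u - sin (0 * u) / u)) {0..1}"
    by (rule fundamental_theorem_of_calculus)
      (use False in \<open>auto intro!: derivative_eq_intros simp flip: has_real_derivative_iff_has_vector_derivative\<close>)
  thus ?thesis using False by (simp add: sinc_def)
qed (use has_integral_const_real[of 1 0 1] in \<open>simp add: sinc_def\<close>)

text \<open>A function \<open>k\<close> oscillates with frequency at most \<open>\<Omega>\<close> if every linear functional that is bounded
  by \<open>B\<close> on the characters of frequency at most \<open>W\<close> is bounded by \<open>B\<close> on their products with \<open>k\<close>,
  as long as the total frequency stays below \<open>W\<close>. This is the polar form of being in the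
  closed absolutely convex hull of the characters.\<close>

definition osc :: "real \<Rightarrow> (real \<Rightarrow> complex) \<Rightarrow> bool" where
  "osc \<Omega> k \<longleftrightarrow> (\<forall>W X \<mu> B. finite X \<longrightarrow>
     (\<forall>\<omega>. \<bar>\<omega>\<bar> \<le> W \<longrightarrow> cmod (\<Sum>x\<in>X. \<mu> x * cis (\<omega> * x)) \<le> B) \<longrightarrow>
     (\<forall>\<omega>. \<bar>\<omega>\<bar> \<le> W - \<Omega> \<longrightarrow> cmod (\<Sum>x\<in>X. \<mu> x * cis (\<omega> * x) * k x) \<le> B))"

lemma oscD:
  assumes "osc \<Omega> k" "finite X" "\<And>\<omega>. \<bar>\<omega>\<bar> \<le> W \<Longrightarrow> cmod (\<Sum>x\<in>X. \<mu> x * cis (\<omega> * x)) \<le> B" "\<bar>\<omega>\<bar> \<le> W - \<Omega>"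
  shows "cmod (\<Sum>x\<in>X. \<mu> x * cis (\<omega> * x) * k x) \<le> B"
  using assms unfolding osc_def by blast

lemma osc_one: "0 \<le> \<Omega> \<Longrightarrow> osc \<Omega> (\<lambda>_. 1)"
  unfolding osc_def by auto

text \<open>Multiplying the weights by \<open>k\<close> turns the given functional into one that is
  bounded by B up to frequency W - \<Omega>, and to this functional the second hypothesis
  applies.\<close>

lemma osc_mult:
  assumes "osc \<Omega> k" "osc \<Omega>' k'"
  shows "osc (\<Omega> + \<Omega>') (\<lambda>x. k x * k' x)"
  unfolding osc_def
proof (intro allI impI)
  fix W X \<mu> B \<omega> assume X: "finite X" and B: "\<forall>\<omega>. \<bar>\<omega>\<bar> \<le> W \<longrightarrow> cmod (\<Sum>x\<in>X. \<mu> x * cis (\<omega> * x)) \<le> B"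
    and w: "\<bar>\<omega>\<bar> \<le> W - (\<Omega> + \<Omega>')"
  have "cmod (\<Sum>x\<in>X. \<mu> x * k x * cis (\<omega> * x)) \<le> B" if "\<bar>\<omega>\<bar> \<le> W - \<Omega>" for \<omega>
    using oscD[OF assms(1) X _ that] B by (simp add: mult_ac)
  hence "cmod (\<Sum>x\<in>X. \<mu> x * k x * cis (\<omega> * x) * k' x) \<le> B"
    by (rule oscD[OF assms(2) X, where W = "W - \<Omega>"]) (use w in auto)
  thus "cmod (\<Sum>x\<in>X. \<mu> x * cis (\<omega> * x) * (k x * k' x)) \<le> B"
    by (simp add: mult_ac)
qed

lemma osc_power: "osc \<Omega> k \<Longrightarrow> osc (real m * \<Omega>) (\<lambda>x. k x ^ m)"
proof (induction m)
  case (Suc m)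
  from osc_mult[OF Suc.prems Suc.IH[OF Suc.prems]] show ?case by (simp add: algebra_simps)
qed (simp add: osc_one)

lemma osc_mono:
  assumes "osc \<Omega> k" "\<Omega> \<le> \<Omega>'" shows "osc \<Omega>' k"
  unfolding osc_def
proof (intro allI impI)
  fix W X \<mu> B \<omega> assume "finite X" "\<forall>\<omega>. \<bar>\<omega>\<bar> \<le> W \<longrightarrow> cmod (\<Sum>x\<in>X. \<mu> x * cis (\<omega> * x)) \<le> B" "\<bar>\<omega>\<bar> \<le> W - \<Omega>'"
  thus "cmod (\<Sum>x\<in>X. \<mu> x * cis (\<omega> * x) * k x) \<le> B"
    by (intro oscD[OF assms(1), where W = W]) (use assms(2) in auto)
qed

lemma osc_cos_sin:
  shows "osc \<bar>t\<bar> (\<lambda>x. complex_of_real (cos (t * x)))" "osc \<bar>t\<bar> (\<lambda>x. complex_of_real (sin (t * x)))"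
proof -
  have 1: "cis (\<omega> * x) * complex_of_real (cos (t * x)) = (cis ((\<omega> + t) * x) + cis ((\<omega> - t) * x)) / 2"
    and 2: "cis (\<omega> * x) * complex_of_real (sin (t * x)) = (cis ((\<omega> + t) * x) - cis ((\<omega> - t) * x)) / (2 * \<i>)" for \<omega> x
    by (simp_all add: complex_eq_iff distrib_right left_diff_distrib cos_add sin_add cos_diff sin_diff)
  {
    fix W X \<mu> B \<omega> assume X: "finite X" and B: "\<forall>\<omega>. \<bar>\<omega>\<bar> \<le> W \<longrightarrow> cmod (\<Sum>x\<in>X. \<mu> x * cis (\<omega> * x)) \<le> B"
      and w: "\<bar>\<omega>\<bar> \<le> W - \<bar>t\<bar>"
    let ?p = "\<Sum>x\<in>X. \<mu> x * cis ((\<omega> + t) * x)" and ?m = "\<Sum>x\<in>X. \<mu> x * cis ((\<omega> - t) * x)"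
    have b: "cmod ?p \<le> B" "cmod ?m \<le> B" using B w by auto
    have e: "(\<Sum>x\<in>X. \<mu> x * cis (\<omega> * x) * complex_of_real (cos (t * x))) = (?p + ?m) / 2"
      "(\<Sum>x\<in>X. \<mu> x * cis (\<omega> * x) * complex_of_real (sin (t * x))) = (?p - ?m) / (2 * \<i>)"
      unfolding mult.assoc 1 2 times_divide_eq_right sum_divide_distrib[symmetric] distrib_left right_diff_distrib
        sum.distrib sum_subtractf by (rule refl)+
    have "cmod ((?p + ?m) / 2) \<le> B" "cmod ((?p - ?m) / (2 * \<i>)) \<le> B"
      using norm_triangle_ineq[of ?p ?m] norm_triangle_ineq4[of ?p ?m] b by (simp_all add: norm_divide norm_mult)
    hence "cmod (\<Sum>x\<in>X. \<mu> x * cis (\<omega> * x) * complex_of_real (cos (t * x))) \<le> B"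
      "cmod (\<Sum>x\<in>X. \<mu> x * cis (\<omega> * x) * complex_of_real (sin (t * x))) \<le> B" unfolding e by simp_all
  }
  thus "osc \<bar>t\<bar> (\<lambda>x. complex_of_real (cos (t * x)))" "osc \<bar>t\<bar> (\<lambda>x. complex_of_real (sin (t * x)))"
    unfolding osc_def by blast+
qed

lemma osc_sinc: "osc \<bar>t\<bar> (\<lambda>x. complex_of_real (sinc (t * x)))"
  unfolding osc_def
proof (intro allI impI)
  fix W X \<mu> B \<omega> assume X: "finite X" and B: "\<forall>\<omega>. \<bar>\<omega>\<bar> \<le> W \<longrightarrow> cmod (\<Sum>x\<in>X. \<mu> x * cis (\<omega> * x)) \<le> B"
    and w: "\<bar>\<omega>\<bar> \<le> W - \<bar>t\<bar>"
  define F where "F s = (\<Sum>x\<in>X. \<mu> x * cis (\<omega> * x) * complex_of_real (cos (s * (t * x))))" for s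
  have "((\<lambda>s. complex_of_real (cos (s * (t * x)))) has_integral complex_of_real (sinc (t * x))) {0..1}" for x
    using has_integral_linear[OF has_integral_sinc bounded_linear_of_real, of "t * x"] by (simp add: o_def)
  hence int: "(F has_integral (\<Sum>x\<in>X. \<mu> x * cis (\<omega> * x) * complex_of_real (sinc (t * x)))) {0..1}"
    unfolding F_def by (intro has_integral_sum X has_integral_mult_right)
  have Fb: "cmod (F s) \<le> B" if "s \<in> {0..1}" for s
  proof -
    have "osc \<bar>s * t\<bar> (\<lambda>x. complex_of_real (cos (s * t * x)))" by (rule osc_cos_sin)
    moreover have "\<bar>s * t\<bar> \<le> \<bar>t\<bar>" using that by (simp add: abs_mult mult_left_le_one_le)
    ultimately have o: "osc \<bar>t\<bar> (\<lambda>x. complex_of_real (cos (s * t * x)))" by (rule osc_mono)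
    show ?thesis using oscD[OF o X _ w, of \<mu> B] B unfolding F_def by (simp add: mult.assoc)
  qed
  have "0 \<le> B" using norm_ge_zero[of "F 0"] Fb[of 0] by (meson atLeastAtMost_iff order_refl order_trans zero_le_one)
  from has_integral_bound[OF this, of F _ 0 1] int Fb
  show "cmod (\<Sum>x\<in>X. \<mu> x * cis (\<omega> * x) * complex_of_real (sinc (t * x))) \<le> B" by (simp add: cbox_interval)
qed

lemma exp_quadratic_bound: "\<bar>u\<bar> \<le> 1 \<Longrightarrow> exp u \<le> 1 + u + (u::real)\<^sup>2"
proof (cases "0 \<le> u")
  case True
  thus "\<bar>u\<bar> \<le> 1 \<Longrightarrow> ?thesis" using exp_bound by simp
next
  case False
  assume "\<bar>u\<bar> \<le> 1"
  define v where "v = - u"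
  have v: "0 < v" "v \<le> 1" using False \<open>\<bar>u\<bar> \<le> 1\<close> by (auto simp: v_def)
  \<comment> \<open>For negative arguments the bound follows from exp v \<ge> 1 + v, because 1 - v +
    v^2 is at least 1/(1 + v).\<close>
  have "1 \<le> (1 + v) * (1 - v + v\<^sup>2)"
  proof -
    have "(1 + v) * (1 - v + v\<^sup>2) = 1 + v ^ 3" by (simp add: algebra_simps power2_eq_square power3_eq_cube)
    thus ?thesis using v by simp
  qed
  also have "\<dots> \<le> exp v * (1 - v + v\<^sup>2)"
  proof (rule mult_right_mono)
    show "1 + v \<le> exp v" by (rule exp_ge_add_one_self)
    show "0 \<le> 1 - v + v\<^sup>2" using v by simp
  qed
  finally have "exp (- v) * 1 \<le> exp (- v) * (exp v * (1 - v + v\<^sup>2))" by (intro mult_left_mono) auto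
  thus ?thesis by (simp add: v_def mult.assoc[symmetric] flip: exp_add)
qed

text \<open>Frank--Wolfe style derandomisation of Maurey's lemma: the potential is a sum of hyperbolic
  cosines over the grid \<open>X\<close>, and the hull condition provides a function of the family along
  which its linear part does not grow.\<close>

lemma greedy_step:
  fixes F :: "(real \<Rightarrow> real) set"
  assumes X: "finite X" and bd: "\<And>\<phi> x. \<phi> \<in> F \<Longrightarrow> x \<in> X \<Longrightarrow> \<bar>\<phi> x - g x\<bar> \<le> 2"
    and hull: "\<And>\<mu> B. (\<And>\<phi>. \<phi> \<in> F \<Longrightarrow> (\<Sum>x\<in>X. \<mu> x * \<phi> x) \<le> B) \<Longrightarrow> (\<Sum>x\<in>X. \<mu> x * g x) \<le> B"
    and l: "0 < l" "l \<le> 1/2"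
    and Xne: "X \<noteq> {}"
  shows "\<exists>\<phi>\<in>F. (\<Sum>x\<in>X. exp (l * (S x + \<phi> x - g x)) + exp (- (l * (S x + \<phi> x - g x)))) \<le>
    (1 + 5 * l\<^sup>2) * (\<Sum>x\<in>X. exp (l * S x) + exp (- (l * S x)))"
proof -
  define P where "P = (\<Sum>x\<in>X. exp (l * S x) + exp (- (l * S x)))"
  have P: "0 < P" unfolding P_def by (intro sum_pos X Xne add_pos_pos) auto
  define d where "d x = exp (l * S x) - exp (- (l * S x))" for x
  \<comment> \<open>A minimiser over F need not exist, so a slack \<open>l * P\<close> is granted.
    It adds 1 to the 4 that comes from (l v)^2 \<le> 4 l^2 below and so produces the constant
    5.\<close>
  have "\<exists>\<phi>\<in>F. (\<Sum>x\<in>X. d x * \<phi> x) < (\<Sum>x\<in>X. d x * g x) + l * P"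
  proof (rule ccontr)
    assume "\<not> ?thesis"
    hence "(\<Sum>x\<in>X. - d x * \<phi> x) \<le> - ((\<Sum>x\<in>X. d x * g x) + l * P)" if "\<phi> \<in> F" for \<phi>
      using that by (auto simp: sum_negf not_less)
    from hull[OF this] have "l * P \<le> 0" by (simp add: sum_negf)
    thus False using l P by (simp add: mult_le_0_iff)
  qed
  then obtain \<phi> where \<phi>: "\<phi> \<in> F" and lin: "(\<Sum>x\<in>X. d x * \<phi> x) < (\<Sum>x\<in>X. d x * g x) + l * P" by blast
  define v where "v x = \<phi> x - g x" for x
  have "(\<Sum>x\<in>X. exp (l * (S x + \<phi> x - g x)) + exp (- (l * (S x + \<phi> x - g x)))) \<le>
    (\<Sum>x\<in>X. (1 + 4 * l\<^sup>2) * (exp (l * S x) + exp (- (l * S x))) + l * (d x * v x))"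
  proof (rule sum_mono)
    fix x assume x: "x \<in> X"
    have v: "\<bar>v x\<bar> \<le> 2" using bd[OF \<phi> x] by (simp add: v_def)
    have lv: "\<bar>l * v x\<bar> \<le> 1"
      using mult_mono[of l "1/2" "\<bar>v x\<bar>" 2] v l by (simp add: abs_mult)
    have sq: "(l * v x)\<^sup>2 \<le> 4 * l\<^sup>2"
      using power_mono[OF v, of 2] l by (simp add: power_mult_distrib mult.commute)
    have "exp (l * S x) * exp (l * v x) \<le> exp (l * S x) * (1 + l * v x + 4 * l\<^sup>2)"
      using exp_quadratic_bound[OF lv] sq by (intro mult_left_mono) auto
    moreover have "exp (- (l * S x)) * exp (- (l * v x)) \<le> exp (- (l * S x)) * (1 - l * v x + 4 * l\<^sup>2)"
      using exp_quadratic_bound[of "- (l * v x)"] lv sq by (intro mult_left_mono) auto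
    moreover have "exp (l * (S x + \<phi> x - g x)) = exp (l * S x) * exp (l * v x)"
      "exp (- (l * (S x + \<phi> x - g x))) = exp (- (l * S x)) * exp (- (l * v x))"
      unfolding v_def by (simp_all add: algebra_simps flip: exp_add)
    ultimately show "exp (l * (S x + \<phi> x - g x)) + exp (- (l * (S x + \<phi> x - g x))) \<le>
      (1 + 4 * l\<^sup>2) * (exp (l * S x) + exp (- (l * S x))) + l * (d x * v x)"
      by (simp add: d_def algebra_simps)
  qed
  also have "\<dots> = (1 + 4 * l\<^sup>2) * P + l * ((\<Sum>x\<in>X. d x * \<phi> x) - (\<Sum>x\<in>X. d x * g x))"
    unfolding P_def v_def sum_subtractf[symmetric] sum_distrib_left sum.distrib[symmetric]
    by (intro sum.cong refl) (simp add: algebra_simps)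
  also have "\<dots> \<le> (1 + 4 * l\<^sup>2) * P + l * (l * P)"
    using lin l by (intro add_left_mono mult_left_mono) auto
  also have "\<dots> = (1 + 5 * l\<^sup>2) * P" by (simp add: algebra_simps power2_eq_square)
  finally show ?thesis using \<phi> unfolding P_def by blast
qed

text \<open>The potential starts at 2 card X and grows by a factor of at most 1 + 5 l^2 per step. At
  every point it dominates exp(l |D|), where D is the accumulated deviation, so |D| \<le> 5 l N +
  ln(2 card X)/l; the lower bound on N makes the last term at most l N.\<close>

lemma greedy_approximation:
  fixes F :: "(real \<Rightarrow> real) set"
  assumes X: "finite X" "X \<noteq> {}" and bd: "\<And>\<phi> x. \<phi> \<in> F \<Longrightarrow> x \<in> X \<Longrightarrow> \<bar>\<phi> x - g x\<bar> \<le> 2"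
    and hull: "\<And>\<mu> B. (\<And>\<phi>. \<phi> \<in> F \<Longrightarrow> (\<Sum>x\<in>X. \<mu> x * \<phi> x) \<le> B) \<Longrightarrow> (\<Sum>x\<in>X. \<mu> x * g x) \<le> B"
    and l: "0 < l" "l \<le> 1/2" and N: "ln (2 * real (card X)) / l\<^sup>2 \<le> real N" "0 < N"
  shows "\<exists>\<phi>. (\<forall>i<N. \<phi> i \<in> F) \<and> (\<forall>x\<in>X. \<bar>(\<Sum>i<N. \<phi> i x) / real N - g x\<bar> \<le> 6 * l)"
proof -
  have "\<exists>\<phi>. (\<forall>i<n. \<phi> i \<in> F) \<and> (\<Sum>x\<in>X. exp (l * ((\<Sum>i<n. \<phi> i x) - real n * g x)) +
      exp (- (l * ((\<Sum>i<n. \<phi> i x) - real n * g x)))) \<le> (1 + 5 * l\<^sup>2) ^ n * (2 * real (card X))" for n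
  proof (induction n)
    case (Suc n)
    then obtain \<phi> where \<phi>: "\<forall>i<n. \<phi> i \<in> F"
      and le: "(\<Sum>x\<in>X. exp (l * ((\<Sum>i<n. \<phi> i x) - real n * g x)) +
        exp (- (l * ((\<Sum>i<n. \<phi> i x) - real n * g x)))) \<le> (1 + 5 * l\<^sup>2) ^ n * (2 * real (card X))" by blast
    define S where "S x = (\<Sum>i<n. \<phi> i x) - real n * g x" for x
    obtain f where f: "f \<in> F" and step: "(\<Sum>x\<in>X. exp (l * (S x + f x - g x)) + exp (- (l * (S x + f x - g x)))) \<le>
        (1 + 5 * l\<^sup>2) * (\<Sum>x\<in>X. exp (l * S x) + exp (- (l * S x)))"
    proof -
      have "\<exists>f\<in>F. (\<Sum>x\<in>X. exp (l * (S x + f x - g x)) + exp (- (l * (S x + f x - g x)))) \<le>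
        (1 + 5 * l\<^sup>2) * (\<Sum>x\<in>X. exp (l * S x) + exp (- (l * S x)))"
      proof (rule greedy_step[OF X(1) _ _ l X(2)])
        fix \<mu> B assume "\<And>\<phi>. \<phi> \<in> F \<Longrightarrow> (\<Sum>x\<in>X. \<mu> x * \<phi> x) \<le> B"
        thus "(\<Sum>x\<in>X. \<mu> x * g x) \<le> B" by (rule hull)
      qed (rule bd)
      thus ?thesis using that by blast
    qed
    have e: "(\<Sum>i<Suc n. (\<phi>(n := f)) i x) - real (Suc n) * g x = S x + f x - g x" for x
      by (simp add: S_def algebra_simps)
    have "(\<Sum>x\<in>X. exp (l * (S x + f x - g x)) + exp (- (l * (S x + f x - g x)))) \<le>
      (1 + 5 * l\<^sup>2) * ((1 + 5 * l\<^sup>2) ^ n * (2 * real (card X)))"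
      using step mult_left_mono[OF le, of "1 + 5 * l\<^sup>2"] unfolding S_def[symmetric] by simp
    hence "(\<Sum>x\<in>X. exp (l * ((\<Sum>i<Suc n. (\<phi>(n := f)) i x) - real (Suc n) * g x)) +
        exp (- (l * ((\<Sum>i<Suc n. (\<phi>(n := f)) i x) - real (Suc n) * g x)))) \<le> (1 + 5 * l\<^sup>2) ^ Suc n * (2 * real (card X))"
      unfolding e by (simp add: mult_ac)
    moreover have "\<forall>i<Suc n. (\<phi>(n := f)) i \<in> F" using \<phi> f by (simp add: less_Suc_eq)
    ultimately show ?case by blast
  qed simp
  then obtain \<phi> where \<phi>: "\<forall>i<N. \<phi> i \<in> F"
    and le: "(\<Sum>x\<in>X. exp (l * ((\<Sum>i<N. \<phi> i x) - real N * g x)) +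
      exp (- (l * ((\<Sum>i<N. \<phi> i x) - real N * g x)))) \<le> (1 + 5 * l\<^sup>2) ^ N * (2 * real (card X))" by blast
  have "\<bar>(\<Sum>i<N. \<phi> i x) / real N - g x\<bar> \<le> 6 * l" if x: "x \<in> X" for x
  proof -
    define D where "D = (\<Sum>i<N. \<phi> i x) - real N * g x"
    have cX: "0 < real (card X)" using X by (simp add: card_gt_0_iff)
    have "exp (l * \<bar>D\<bar>) \<le> exp (l * D) + exp (- (l * D))" by (cases "0 \<le> D") (auto simp: abs_if)
    also have "\<dots> \<le> (\<Sum>x\<in>X. exp (l * ((\<Sum>i<N. \<phi> i x) - real N * g x)) +
        exp (- (l * ((\<Sum>i<N. \<phi> i x) - real N * g x))))"
      unfolding D_def by (rule member_le_sum[OF x]) (use X in auto)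
    also note le
    also have "(1 + 5 * l\<^sup>2) ^ N * (2 * real (card X)) \<le> exp (5 * l\<^sup>2) ^ N * exp (ln (2 * real (card X)))"
      using cX by (intro mult_mono power_mono exp_ge_add_one_self) auto
    also have "\<dots> = exp (real N * (5 * l\<^sup>2) + ln (2 * real (card X)))"
      by (simp add: exp_add flip: exp_of_nat_mult)
    finally have "l * \<bar>D\<bar> \<le> real N * (5 * l\<^sup>2) + ln (2 * real (card X))" by simp
    also have "ln (2 * real (card X)) \<le> real N * l\<^sup>2" using N(1) l by (simp add: field_simps)
    finally have "l * \<bar>D\<bar> \<le> l * (real N * (6 * l))" by (simp add: algebra_simps power2_eq_square)
    hence "\<bar>D\<bar> \<le> real N * (6 * l)" using l by simp
    moreover have "(\<Sum>i<N. \<phi> i x) / real N - g x = D / real N"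
      using N(2) by (simp add: D_def diff_divide_distrib)
    hence "\<bar>(\<Sum>i<N. \<phi> i x) / real N - g x\<bar> = \<bar>D\<bar> / real N" by simp
    ultimately show ?thesis using N(2) by (simp add: field_simps)
  qed
  thus ?thesis using \<phi> by blast
qed

section \<open>An integral representation of the signed power\<close>

text \<open>For \<open>x > 0\<close> the substitution \<open>u = t x\<close> gives
  \<open>\<integral>\<^sub>0\<^sup>T x\<^sup>p t\<^sup>p\<^sup>-\<^sup>1\<^sup>-\<^sup>\<beta> sinc(t x)\<^sup>p\<^sup>+\<^sup>1 dt = x\<^sup>\<beta> \<integral>\<^sub>0\<^sup>T\<^sup>x wker\<close>. The last integral converges to a positive constant, since
  the integrand is continuous, nonnegative for odd \<open>p\<close>, and at most \<open>u\<^sup>-\<^sup>1\<^sup>-\<^sup>\<beta>\<close>.\<close>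

definition wker :: "real \<Rightarrow> nat \<Rightarrow> real \<Rightarrow> real" where
  "wker \<beta> p u = u powr (real p - 1 - \<beta>) * sinc u ^ Suc p"

definition wint :: "real \<Rightarrow> nat \<Rightarrow> real \<Rightarrow> real" where
  "wint \<beta> p V = integral {0..V} (wker \<beta> p)"

definition gker :: "real \<Rightarrow> nat \<Rightarrow> real \<Rightarrow> real \<Rightarrow> real" where
  "gker \<beta> p T x = integral {0..T} (\<lambda>t. x ^ p * t powr (real p - 1 - \<beta>) * sinc (t * x) ^ Suc p)"

context
  fixes \<beta> :: real and p :: nat
  assumes beta: "0 < \<beta>" and p: "odd p" "\<beta> + 2 \<le> real p"
begin

lemma continuous_powr_nonneg: "continuous_on {0..V} (\<lambda>t. t powr (real p - 1 - \<beta>))"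
  by (rule continuous_on_powr') (use p in \<open>auto intro!: continuous_intros\<close>)

lemma wker_cont: "continuous_on {0..V} (wker \<beta> p)"
  unfolding wker_def[abs_def] by (intro continuous_intros continuous_powr_nonneg)

lemma wker_nonneg: "0 \<le> wker \<beta> p u"
  unfolding wker_def using p by (intro mult_nonneg_nonneg zero_le_even_power) auto

lemma wker_le: "0 < u \<Longrightarrow> wker \<beta> p u \<le> u powr (- 1 - \<beta>)"
proof -
  assume u: "0 < u"
  have "wker \<beta> p u = u powr (- 1 - \<beta>) * (u ^ p * sinc u ^ Suc p)"
  proof -
    have "u powr (real p - 1 - \<beta>) = u powr (- 1 - \<beta>) * u ^ p"
      using u by (simp add: powr_realpow[symmetric] powr_add[symmetric] algebra_simps)
    thus ?thesis unfolding wker_def by simp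
  qed
  also have "u ^ p * sinc u ^ Suc p = sinc u * sin u ^ p"
    by (simp add: power_mult_distrib[symmetric] sinc_mult mult.left_commute mult.commute)
  also have "u powr (- 1 - \<beta>) * (sinc u * sin u ^ p) \<le> u powr (- 1 - \<beta>) * 1"
  proof (intro mult_left_mono)
    have "\<bar>sinc u * sin u ^ p\<bar> \<le> 1 * 1"
      unfolding abs_mult power_abs by (intro mult_mono abs_sinc_le_1 power_le_one) auto
    thus "sinc u * sin u ^ p \<le> 1" by simp
  qed simp
  finally show ?thesis by simp
qed

lemma wker_integrable: "wker \<beta> p integrable_on {a..b}" if "0 \<le> a" for a b
  by (rule integrable_continuous_interval, rule continuous_on_subset[OF wker_cont[of b]]) (use that in auto)

lemma powr_has_integral:
  assumes "0 < V" "V \<le> W"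
  shows "((\<lambda>u. u powr (- 1 - \<beta>)) has_integral ((V powr - \<beta> - W powr - \<beta>) / \<beta>)) {V..W}"
proof -
  have "((\<lambda>u. u powr (- 1 - \<beta>)) has_integral (- (W powr - \<beta>) / \<beta> - (- (V powr - \<beta>) / \<beta>))) {V..W}"
  proof (rule fundamental_theorem_of_calculus[OF assms(2)])
    fix u assume u: "u \<in> {V..W}"
    have "((\<lambda>u. - (u powr - \<beta>) / \<beta>) has_real_derivative u powr (- 1 - \<beta>)) (at u within {V..W})"
      using u assms beta by (auto intro!: derivative_eq_intros simp: field_simps powr_diff powr_minus)
    thus "((\<lambda>u. - (u powr - \<beta>) / \<beta>) has_vector_derivative u powr (- 1 - \<beta>)) (at u within {V..W})"
      by (simp add: has_real_derivative_iff_has_vector_derivative)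
  qed
  thus ?thesis by (simp add: diff_divide_distrib)
qed

lemma wint_mono: "0 \<le> V \<Longrightarrow> V \<le> W \<Longrightarrow> wint \<beta> p V \<le> wint \<beta> p W"
  unfolding wint_def by (rule integral_subset_le) (auto intro: wker_integrable wker_nonneg)

lemma wint_tail: "0 < V \<Longrightarrow> V \<le> W \<Longrightarrow> wint \<beta> p W \<le> wint \<beta> p V + V powr - \<beta> / \<beta>"
proof -
  assume V: "0 < V" "V \<le> W"
  have "wint \<beta> p W = wint \<beta> p V + integral {V..W} (wker \<beta> p)"
    unfolding wint_def using V
    by (intro Henstock_Kurzweil_Integration.integral_combine[symmetric] wker_integrable) auto
  also have "integral {V..W} (wker \<beta> p) \<le> integral {V..W} (\<lambda>u. u powr (- 1 - \<beta>))"
    using V powr_has_integral[OF V] by (intro integral_le wker_integrable wker_le) (auto simp: has_integral_iff)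
  also have "\<dots> = (V powr - \<beta> - W powr - \<beta>) / \<beta>"
    using powr_has_integral[OF V] by (simp add: has_integral_iff)
  also have "\<dots> \<le> V powr - \<beta> / \<beta>" using beta by (intro divide_right_mono) auto
  finally show ?thesis by simp
qed

text \<open>The constant c is the improper integral of \<open>wker\<close> over the half line,
  obtained as a supremum because \<open>wint\<close> is increasing. It is positive since
  \<open>wker\<close> is nonnegative, continuous and nonzero at 1, where sin does not
  vanish.\<close>

lemma wint_limit: "\<exists>c>0. \<forall>V>0. wint \<beta> p V \<le> c \<and> c \<le> wint \<beta> p V + V powr - \<beta> / \<beta>"
proof -
  define c where "c = (SUP V\<in>{1..}. wint \<beta> p V)"
  have bdd: "bdd_above (wint \<beta> p ` {1..})"
    by (rule bdd_aboveI2[where M = "wint \<beta> p 1 + 1 powr - \<beta> / \<beta>"]) (use wint_tail[of 1] in auto)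
  have up: "wint \<beta> p V \<le> c" if "0 < V" for V
  proof -
    have "wint \<beta> p V \<le> wint \<beta> p (max 1 V)" using that by (intro wint_mono) auto
    also have "\<dots> \<le> c" unfolding c_def by (rule cSUP_upper[OF _ bdd]) auto
    finally show ?thesis .
  qed
  have low: "c \<le> wint \<beta> p V + V powr - \<beta> / \<beta>" if V: "0 < V" for V
    unfolding c_def
  proof (rule cSUP_least)
    fix W :: real assume W: "W \<in> {1..}"
    show "wint \<beta> p W \<le> wint \<beta> p V + V powr - \<beta> / \<beta>"
    proof (cases "V \<le> W")
      case True thus ?thesis by (rule wint_tail[OF V])
    next
      case False
      have "wint \<beta> p W \<le> wint \<beta> p V" using False W by (intro wint_mono) auto
      thus ?thesis using beta by (simp add: add_increasing2)
    qed
  qed auto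
  have "wint \<beta> p 1 \<noteq> 0"
  proof
    assume "wint \<beta> p 1 = 0"
    hence "\<forall>u\<in>{0..1}. wker \<beta> p u = 0"
      unfolding wint_def using integral_eq_0_iff[OF wker_cont[of 1]] wker_nonneg by auto
    hence "wker \<beta> p 1 = 0" by auto
    hence "sin (1::real) = 0" by (auto simp: wker_def sinc_def)
    moreover have "0 < sin (1::real)" using pi_gt3 by (intro sin_gt_zero) auto
    ultimately show False by simp
  qed
  moreover have "0 \<le> wint \<beta> p 1" unfolding wint_def by (intro integral_nonneg wker_integrable) (auto simp: wker_nonneg)
  ultimately have "0 < c" using up[of 1] by simp
  thus ?thesis using up low by blast
qed

lemma gker_integrand_cont:
  "continuous_on {0..T} (\<lambda>t. x ^ p * t powr (real p - 1 - \<beta>) * sinc (t * x) ^ Suc p)"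
  by (intro continuous_intros continuous_powr_nonneg)

lemma gker_minus: "gker \<beta> p T (- x) = - gker \<beta> p T x"
  using p(1) unfolding gker_def by (simp add: power_minus_odd)

lemma gker_pos:
  assumes x: "0 < x" and T: "0 \<le> T"
  shows "gker \<beta> p T x = x powr \<beta> * wint \<beta> p (T * x)"
proof -
  have "(wker \<beta> p has_integral wint \<beta> p (T * x)) {0..T * x}"
    unfolding wint_def by (intro integrable_integral wker_integrable) simp
  from has_integral_stretch_real[OF this, of x]
  have "((\<lambda>t. wker \<beta> p (x * t)) has_integral (1 / \<bar>x\<bar>) *\<^sub>R wint \<beta> p (T * x)) ((\<lambda>t. t / x) ` {0..T * x})"
    using x by simp
  moreover have "(\<lambda>t. t / x) ` {0..T * x} = {0..T}"
    using x T image_divide_atLeastAtMost[of x 0 "T * x"] by simp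
  ultimately have "((\<lambda>t. wker \<beta> p (x * t)) has_integral wint \<beta> p (T * x) / x) {0..T}" using x by simp
  from has_integral_mult_right[OF this, of "x powr (1 + \<beta>)"]
  have "((\<lambda>t. x powr (1 + \<beta>) * wker \<beta> p (x * t)) has_integral x powr \<beta> * wint \<beta> p (T * x)) {0..T}"
    using x by (simp add: powr_add)
  moreover have "x powr (1 + \<beta>) * wker \<beta> p (x * t) = x ^ p * t powr (real p - 1 - \<beta>) * sinc (t * x) ^ Suc p"
    if "t \<in> {0..T}" for t
  proof -
    have "x powr (1 + \<beta>) * (x * t) powr (real p - 1 - \<beta>) = x powr (1 + \<beta>) * x powr (real p - 1 - \<beta>) * t powr (real p - 1 - \<beta>)"
      using x that by (simp add: powr_mult)
    also have "x powr (1 + \<beta>) * x powr (real p - 1 - \<beta>) = x ^ p"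
      using x by (simp add: powr_add[symmetric] powr_realpow)
    finally show ?thesis by (simp add: wker_def mult.commute[of x t])
  qed
  ultimately have "((\<lambda>t. x ^ p * t powr (real p - 1 - \<beta>) * sinc (t * x) ^ Suc p) has_integral x powr \<beta> * wint \<beta> p (T * x)) {0..T}"
    by (rule has_integral_eq[rotated]) auto
  thus ?thesis unfolding gker_def by (rule integral_unique)
qed

text \<open>Stopping the integral at T x loses at most (T x)^(-\<beta>)/\<beta>. Its factor
  x^(-\<beta>) cancels the factor x^\<beta> in front, so the error is uniform in x even near 0,
  where the signed power fails to be smooth.\<close>

lemma gker_approx: "\<exists>c>0. \<forall>T>0. \<forall>x. \<bar>sgn x * \<bar>x\<bar> powr \<beta> - gker \<beta> p T x / c\<bar> \<le> T powr - \<beta> / (\<beta> * c)"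
proof -
  obtain c where c: "0 < c" and lim: "\<And>V. 0 < V \<Longrightarrow> wint \<beta> p V \<le> c \<and> c \<le> wint \<beta> p V + V powr - \<beta> / \<beta>"
    using wint_limit by blast
  have pos: "\<bar>x powr \<beta> - gker \<beta> p T x / c\<bar> \<le> T powr - \<beta> / (\<beta> * c)" if T: "0 < T" and x: "0 < x" for T x
  proof -
    have Tx: "0 < T * x" using T x by simp
    have e: "x powr \<beta> - gker \<beta> p T x / c = x powr \<beta> * (c - wint \<beta> p (T * x)) / c"
      using c gker_pos[OF x, of T] T by (simp add: field_simps)
    have nn: "0 \<le> x powr \<beta> * (c - wint \<beta> p (T * x)) / c" using lim[OF Tx] c by simp
    have "x powr \<beta> * (c - wint \<beta> p (T * x)) / c \<le> x powr \<beta> * ((T * x) powr - \<beta> / \<beta>) / c"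
      using lim[OF Tx] c by (intro divide_right_mono mult_left_mono) auto
    also have "x powr \<beta> * ((T * x) powr - \<beta> / \<beta>) / c = T powr - \<beta> / (\<beta> * c)"
      using T x by (simp add: powr_mult powr_minus field_simps)
    finally show ?thesis unfolding e abs_of_nonneg[OF nn] .
  qed
  have "\<bar>sgn x * \<bar>x\<bar> powr \<beta> - gker \<beta> p T x / c\<bar> \<le> T powr - \<beta> / (\<beta> * c)" if T: "0 < T" for T x
  proof (cases x "0::real" rule: linorder_cases)
    case less
    thus ?thesis using pos[OF T, of "- x"] gker_minus[of T x] by (simp add: abs_minus_commute)
  next
    case equal
    have "0 < p" using p by (cases p) auto
    thus ?thesis using equal beta c by (simp add: gker_def zero_power)
  next
    case greater
    thus ?thesis using pos[OF T] by simp
  qed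
  thus ?thesis using c by blast
qed

text \<open>For \<open>t \<le> 1\<close> the integrand is a combination of characters weighted by \<open>(x/2)\<^sup>p\<close>; for \<open>t \<ge> 1\<close>
  the identity \<open>t x sinc(t x) = sin(t x)\<close> removes this factor in exchange for decay in \<open>t\<close>.\<close>

lemma gker_hull:
  assumes X: "finite X" and T: "1 \<le> T" and Om: "(real p + 1) * T \<le> \<Omega>"
    and B: "\<And>q \<omega>. q \<in> {0, p} \<Longrightarrow> \<bar>\<omega>\<bar> \<le> \<Omega> \<Longrightarrow> cmod (\<Sum>x\<in>X. complex_of_real (\<mu> x * (x / 2) ^ q) * cis (\<omega> * x)) \<le> B"
  shows "(\<Sum>x\<in>X. \<mu> x * gker \<beta> p T x) \<le> (2 ^ p + 1 / \<beta>) * B"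
proof -
  define f where "f t = (\<Sum>x\<in>X. \<mu> x * (x ^ p * t powr (real p - 1 - \<beta>) * sinc (t * x) ^ Suc p))" for t
  have Om0: "(real p + 1) * t \<le> \<Omega>" if "t \<le> T" for t
    using Om mult_left_mono[OF that, of "real p + 1"] by linarith
  have "0 \<le> \<Omega>" using Om0[of 0] T by simp
  hence B0: "0 \<le> B" using order_trans[OF norm_ge_zero B[of 0 0]] by simp
  have cont: "continuous_on {0..T} f"
    unfolding f_def by (intro continuous_intros continuous_powr_nonneg)
  have fi: "f integrable_on {a..b}" if "0 \<le> a" "b \<le> T" for a b
    by (rule integrable_continuous_interval, rule continuous_on_subset[OF cont]) (use that in auto)
  have "(f has_integral (\<Sum>x\<in>X. \<mu> x * gker \<beta> p T x)) {0..T}"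
    unfolding f_def gker_def
    by (intro has_integral_sum X has_integral_mult_right integrable_integral integrable_continuous_interval gker_integrand_cont)
  hence "(\<Sum>x\<in>X. \<mu> x * gker \<beta> p T x) = integral {0..T} f" by (simp add: has_integral_iff)
  also have "\<dots> = integral {0..1} f + integral {1..T} f"
    using T by (intro Henstock_Kurzweil_Integration.integral_combine[symmetric] fi) auto
  \<comment> \<open>The factor 2^p pays for the weight (x/2)^p in place of x^p; this is the weight
    that p rotations by pi/2 produce up to a phase.\<close>
  also have "integral {0..1} f \<le> 2 ^ p * B"
  proof -
    have "f t \<le> 2 ^ p * B" if t: "t \<in> {0..1}" for t
    proof -
      have "osc (real (Suc p) * \<bar>t\<bar>) (\<lambda>x. complex_of_real (sinc (t * x)) ^ Suc p)"
        by (rule osc_power[OF osc_sinc])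
      hence o: "osc \<Omega> (\<lambda>x. complex_of_real (sinc (t * x)) ^ Suc p)"
        by (rule osc_mono) (use t T Om0[of t] in \<open>auto simp: algebra_simps\<close>)
      have "cmod (\<Sum>x\<in>X. complex_of_real (\<mu> x * (x / 2) ^ p) * cis (0 * x) * complex_of_real (sinc (t * x)) ^ Suc p) \<le> B"
        by (rule oscD[OF o X, where W = \<Omega>]) (use B in auto)
      moreover have "(\<Sum>x\<in>X. complex_of_real (\<mu> x * (x / 2) ^ p) * cis (0 * x) * complex_of_real (sinc (t * x)) ^ Suc p) =
        complex_of_real (\<Sum>x\<in>X. \<mu> x * (x / 2) ^ p * sinc (t * x) ^ Suc p)" by simp
      ultimately have b: "\<bar>\<Sum>x\<in>X. \<mu> x * (x / 2) ^ p * sinc (t * x) ^ Suc p\<bar> \<le> B" by (simp only: norm_of_real)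
      have "f t = 2 ^ p * t powr (real p - 1 - \<beta>) * (\<Sum>x\<in>X. \<mu> x * (x / 2) ^ p * sinc (t * x) ^ Suc p)"
        unfolding f_def sum_distrib_left by (intro sum.cong refl) (simp add: power_divide)
      also have "\<dots> \<le> 2 ^ p * t powr (real p - 1 - \<beta>) * B"
        using b by (intro mult_left_mono) auto
      also have "\<dots> \<le> 2 ^ p * 1 * B"
        using B0 t p powr_mono2[of "real p - 1 - \<beta>" t 1] by (intro mult_right_mono mult_left_mono) auto
      finally show ?thesis by simp
    qed
    hence "integral {0..1} f \<le> integral {0..1::real} (\<lambda>_. 2 ^ p * B)"
      using T by (intro integral_le fi) auto
    thus ?thesis by simp
  qed
  \<comment> \<open>The factor 1/\<beta> is the integral of t^(-1-\<beta>) over the half line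
    starting at 1, so the bound does not depend on T.\<close>
  also have "integral {1..T} f \<le> 1 / \<beta> * B"
  proof -
    have "f t \<le> B * t powr (- 1 - \<beta>)" if t: "t \<in> {1..T}" for t
    proof -
      have "osc (\<bar>t\<bar> + real p * \<bar>t\<bar>) (\<lambda>x. complex_of_real (sinc (t * x)) * complex_of_real (sin (t * x)) ^ p)"
        by (intro osc_mult osc_sinc osc_power osc_cos_sin)
      hence o: "osc \<Omega> (\<lambda>x. complex_of_real (sinc (t * x)) * complex_of_real (sin (t * x)) ^ p)"
        by (rule osc_mono) (use t T Om0[of t] in \<open>auto simp: algebra_simps\<close>)
      have "cmod (\<Sum>x\<in>X. complex_of_real (\<mu> x * (x / 2) ^ 0) * cis (0 * x) *
          (complex_of_real (sinc (t * x)) * complex_of_real (sin (t * x)) ^ p)) \<le> B"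
        by (rule oscD[OF o X, where W = \<Omega>]) (use B[of 0] in auto)
      moreover have "(\<Sum>x\<in>X. complex_of_real (\<mu> x * (x / 2) ^ 0) * cis (0 * x) *
          (complex_of_real (sinc (t * x)) * complex_of_real (sin (t * x)) ^ p)) =
        complex_of_real (\<Sum>x\<in>X. \<mu> x * (sinc (t * x) * sin (t * x) ^ p))" by simp
      ultimately have b: "\<bar>\<Sum>x\<in>X. \<mu> x * (sinc (t * x) * sin (t * x) ^ p)\<bar> \<le> B" by (simp only: norm_of_real)
      have "f t = t powr (- 1 - \<beta>) * (\<Sum>x\<in>X. \<mu> x * (sinc (t * x) * sin (t * x) ^ p))"
        unfolding f_def sum_distrib_left
      proof (intro sum.cong refl)
        fix x
        have "t powr (real p - 1 - \<beta>) = t powr (- 1 - \<beta>) * t ^ p"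
          using t by (simp add: powr_realpow[symmetric] powr_add[symmetric] algebra_simps)
        moreover have "sin (t * x) ^ p = t ^ p * x ^ p * sinc (t * x) ^ p"
          by (simp add: power_mult_distrib[symmetric] sinc_mult)
        ultimately show "\<mu> x * (x ^ p * t powr (real p - 1 - \<beta>) * sinc (t * x) ^ Suc p) =
          t powr (- 1 - \<beta>) * (\<mu> x * (sinc (t * x) * sin (t * x) ^ p))" by simp
      qed
      also have "\<dots> \<le> t powr (- 1 - \<beta>) * B" using b by (intro mult_left_mono) auto
      finally show ?thesis by (simp add: mult.commute)
    qed
    moreover have "((\<lambda>t. B * t powr (- 1 - \<beta>)) has_integral B * ((1 powr - \<beta> - T powr - \<beta>) / \<beta>)) {1..T}"
      by (intro has_integral_mult_right powr_has_integral) (use T in auto)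
    ultimately have "integral {1..T} f \<le> B * ((1 powr - \<beta> - T powr - \<beta>) / \<beta>)"
      using fi[of 1 T] by (intro has_integral_le[OF integrable_integral]) auto
    also have "\<dots> \<le> B * (1 / \<beta>)" using B0 beta by (intro mult_left_mono divide_right_mono) auto
    finally show ?thesis by simp
  qed
  finally show ?thesis by (simp add: distrib_right)
qed

end

section \<open>Realising characters by products of small rotations\<close>

lemma cmod_cis_diff_le: "cmod (cis a - cis b) \<le> \<bar>a - b\<bar>"
proof -
  have "(cmod (cis a - cis b))\<^sup>2 = (sin a)\<^sup>2 + (cos a)\<^sup>2 + ((sin b)\<^sup>2 + (cos b)\<^sup>2) - 2 * cos (a - b)"
    unfolding cos_diff cmod_power2
    by (simp add: power2_diff) (use sin_cos_squared_add[of a] sin_cos_squared_add[of b] in linarith)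
  also have "\<dots> = (2 * sin ((a - b) / 2))\<^sup>2"
  proof -
    have "2 * ((a - b) / 2) = a - b" by simp
    hence "cos (a - b) = 1 - 2 * (sin ((a - b) / 2))\<^sup>2" using cos_double_sin[of "(a - b) / 2"] by (simp only:)
    thus ?thesis unfolding sin_cos_squared_add power_mult_distrib by simp
  qed
  finally have "(cmod (cis a - cis b))\<^sup>2 = (2 * sin ((a - b) / 2))\<^sup>2" .
  from arg_cong[OF this, of sqrt] have "cmod (cis a - cis b) = \<bar>2 * sin ((a - b) / 2)\<bar>"
    unfolding real_sqrt_abs by simp
  thus ?thesis using abs_sin_x_le_abs_x[of "(a - b) / 2"] by simp
qed

text \<open>Both sides equal 1 + \<i> d y to first order in d; real and imaginary parts each differ
  by at most d^2/2.\<close>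

lemma cos_sin_approx_cis:
  assumes y: "\<bar>y\<bar> \<le> 1 / 2"
  shows "cmod (complex_of_real (cos d) + \<i> * complex_of_real (sin d) * complex_of_real y - cis (d * y)) \<le> d\<^sup>2"
proof -
  have s: "\<bar>sin u - u\<bar> \<le> u\<^sup>2 / 2" for u :: real
    using Maclaurin_sin_bound[of u 2] by (simp add: numeral_2_eq_2 sin_coeff_def)
  have c: "0 \<le> 1 - cos u \<and> 1 - cos u \<le> u\<^sup>2 / 2" for u :: real
  proof -
    have "1 - cos (2 * (u / 2)) = 2 * (sin (u / 2))\<^sup>2" unfolding cos_double_sin by simp
    also have "\<dots> \<le> 2 * (u / 2)\<^sup>2"
      using abs_sin_x_le_abs_x[of "u / 2"] unfolding abs_le_square_iff by (intro mult_left_mono) auto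
    finally show ?thesis by (simp add: power_divide)
  qed
  have y2: "y\<^sup>2 \<le> 1 / 4" using power_mono[OF y, of 2] by (simp add: power_divide)
  have dy: "(d * y)\<^sup>2 \<le> d\<^sup>2 / 4" using mult_left_mono[OF y2, of "d\<^sup>2"] by (simp add: power_mult_distrib)
  have re: "\<bar>cos d - cos (d * y)\<bar> \<le> d\<^sup>2 / 2" using c[of d] c[of "d * y"] dy by linarith
  have "\<bar>y * (sin d - d)\<bar> \<le> 1 / 2 * (d\<^sup>2 / 2)" unfolding abs_mult by (intro mult_mono y s) auto
  moreover have "y * sin d - sin (d * y) = y * (sin d - d) - (sin (d * y) - d * y)" by (simp add: right_diff_distrib)
  ultimately have im: "\<bar>y * sin d - sin (d * y)\<bar> \<le> d\<^sup>2 / 2" using s[of "d * y"] dy by linarith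
  have "cmod z \<le> d\<^sup>2" if "\<bar>Re z\<bar> \<le> d\<^sup>2 / 2" "\<bar>Im z\<bar> \<le> d\<^sup>2 / 2" for z
    using cmod_le[of z] that by linarith
  thus ?thesis using re im by (simp add: mult.commute)
qed

lemma amp_append: "amp (\<theta> @ \<theta>') x = amp \<theta> x * amp \<theta>' x"
  by (simp add: amp_def)

lemma amp_replicate: "amp (replicate m d) x = (complex_of_real (cos d) + \<i> * complex_of_real (sin d) * complex_of_real (x / 2)) ^ m"
  by (induction m) (simp_all add: amp_def)

text \<open>The angle 2\<omega>/m makes up for the halving of x in \<open>amp\<close>. As both
  factors lie in the unit disc, their m-th powers differ by at most m times the error of a single
  factor, which is quadratic in the angle.\<close>

lemma amp_approx_cis:
  assumes m: "0 < m" and x: "\<bar>x\<bar> \<le> 1"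
  shows "cmod (amp (replicate m (2 * \<omega> / real m)) x - cis (\<omega> * x)) \<le> 4 * \<omega>\<^sup>2 / real m"
proof -
  define d where "d = 2 * \<omega> / real m"
  define z where "z = complex_of_real (cos d) + \<i> * complex_of_real (sin d) * complex_of_real (x / 2)"
  have x2: "\<bar>x / 2\<bar> \<le> 1 / 2" using x by simp
  have "(cmod z)\<^sup>2 = (cos d)\<^sup>2 + (sin d)\<^sup>2 * (x / 2)\<^sup>2" by (simp add: z_def cmod_power2 power_mult_distrib power_divide)
  also have "\<dots> \<le> (cos d)\<^sup>2 + (sin d)\<^sup>2 * 1"
    using x2 by (intro add_left_mono mult_left_mono) (auto simp: abs_square_le_1)
  finally have z: "cmod z \<le> 1" by (simp add: power_le_one_iff abs_square_le_1)
  have "real m * (d * (x / 2)) = \<omega> * x" using m by (simp add: d_def)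
  hence "cis (\<omega> * x) = cis (d * (x / 2)) ^ m" using Complex.DeMoivre[of "d * (x / 2)" m] by (simp only:)
  hence "cmod (amp (replicate m d) x - cis (\<omega> * x)) = cmod (z ^ m - cis (d * (x / 2)) ^ m)"
    by (simp only: amp_replicate z_def)
  also have "\<dots> \<le> real m * cmod (z - cis (d * (x / 2)))" by (rule norm_power_diff) (use z in auto)
  also have "\<dots> \<le> real m * d\<^sup>2" unfolding z_def using cos_sin_approx_cis[OF x2] by (intro mult_left_mono) auto
  also have "\<dots> = 4 * \<omega>\<^sup>2 / real m" using m by (simp add: d_def power2_eq_square field_simps)
  finally show ?thesis by (simp add: d_def)
qed

text \<open>The functions that a single test can realise approximately. Admitting every unit phase
  \<zeta> makes bounds on real linear functionals of this set equivalent to bounds on complex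
  moduli.\<close>

definition test_functions :: "nat \<Rightarrow> real \<Rightarrow> (real \<Rightarrow> real) set" where
  "test_functions p \<Omega> = {\<lambda>x. Re (\<zeta> * complex_of_real ((x / 2) ^ q) * cis (\<omega> * x)) | \<zeta> q \<omega>.
     cmod \<zeta> = 1 \<and> q \<in> {0, p} \<and> \<bar>\<omega>\<bar> \<le> \<Omega>}"

text \<open>A rotation by pi/2 contributes exactly \<i> x/2 and a rotation by 0 contributes 1. Hence
  p angles produce (x/2)^q for both values of q, a phase undoing the power of \<i>, and all tests
  get the same length p + m.\<close>

lemma amp_approx_test_function:
  assumes \<phi>: "\<phi> \<in> test_functions p \<Omega>" and m: "0 < m"
  shows "\<exists>\<zeta> \<theta>. cmod \<zeta> = 1 \<and> length \<theta> = p + m \<and>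
    (\<forall>x. \<bar>x\<bar> \<le> 1 \<longrightarrow> \<bar>Re (\<zeta> * amp \<theta> x) - \<phi> x\<bar> \<le> 4 * \<Omega>\<^sup>2 / real m)"
proof -
  obtain \<zeta> q \<omega> where z: "cmod \<zeta> = 1" and q: "q \<in> {0, p}" and w: "\<bar>\<omega>\<bar> \<le> \<Omega>"
    and \<phi>: "\<phi> = (\<lambda>x. Re (\<zeta> * complex_of_real ((x / 2) ^ q) * cis (\<omega> * x)))"
    using \<phi> unfolding test_functions_def by blast
  define \<tau> where "\<tau> = replicate m (2 * \<omega> / real m)"
  have "\<exists>\<zeta>' \<theta>. cmod \<zeta>' = 1 \<and> length \<theta> = p \<and> (\<forall>x. \<zeta>' * amp \<theta> x = \<zeta> * complex_of_real ((x / 2) ^ q))"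
  proof (cases "q = 0")
    case True
    thus ?thesis using z by (intro exI[of _ \<zeta>] exI[of _ "replicate p 0"]) (simp add: amp_replicate)
  next
    case False
    have "(- \<i>) ^ p * (\<i> * c) ^ p = c ^ p" for c :: complex
      unfolding power_mult_distrib[symmetric] by (simp flip: mult.assoc)
    from this[of "complex_of_real (x / 2)" for x] have "\<zeta> * (- \<i>) ^ p * amp (replicate p (pi / 2)) x = \<zeta> * complex_of_real ((x / 2) ^ q)" for x
      using q False unfolding amp_replicate mult.assoc by simp
    thus ?thesis using z by (intro exI[of _ "\<zeta> * (- \<i>) ^ p"] exI[of _ "replicate p (pi / 2)"]) (simp add: norm_mult norm_power)
  qed
  then obtain \<zeta>' \<theta> where z': "cmod \<zeta>' = 1" and th: "length \<theta> = p"
    and e: "\<And>x. \<zeta>' * amp \<theta> x = \<zeta> * complex_of_real ((x / 2) ^ q)" by blast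
  have "\<bar>Re (\<zeta>' * amp (\<theta> @ \<tau>) x) - \<phi> x\<bar> \<le> 4 * \<Omega>\<^sup>2 / real m" if x: "\<bar>x\<bar> \<le> 1" for x
  proof -
    have "\<zeta>' * amp (\<theta> @ \<tau>) x = \<zeta> * complex_of_real ((x / 2) ^ q) * amp \<tau> x"
      by (simp only: amp_append mult.assoc[symmetric] e)
    hence "Re (\<zeta>' * amp (\<theta> @ \<tau>) x) - \<phi> x = Re (\<zeta> * complex_of_real ((x / 2) ^ q) * (amp \<tau> x - cis (\<omega> * x)))"
      unfolding \<phi> by (simp only: right_diff_distrib minus_complex.sel)
    also have "\<bar>\<dots>\<bar> \<le> cmod (\<zeta> * complex_of_real ((x / 2) ^ q) * (amp \<tau> x - cis (\<omega> * x)))"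
      by (rule abs_Re_le_cmod)
    also have "\<dots> = \<bar>x / 2\<bar> ^ q * cmod (amp \<tau> x - cis (\<omega> * x))"
      unfolding norm_mult z norm_of_real power_abs by simp
    also have "\<dots> \<le> 1 * (4 * \<omega>\<^sup>2 / real m)"
      unfolding \<tau>_def using x by (intro mult_mono power_le_one amp_approx_cis m) auto
    also have "\<dots> \<le> 4 * \<Omega>\<^sup>2 / real m"
      using power_mono[OF w, of 2] by (simp add: divide_right_mono)
    finally show ?thesis .
  qed
  thus ?thesis using z' th by (intro exI[of _ \<zeta>'] exI[of _ "\<theta> @ \<tau>"]) (simp add: \<tau>_def)
qed

lemma test_functions_le_1:
  assumes "\<phi> \<in> test_functions p \<Omega>" "\<bar>x\<bar> \<le> 1" shows "\<bar>\<phi> x\<bar> \<le> 1"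
proof -
  obtain \<zeta> q \<omega> where z: "cmod \<zeta> = 1" and \<phi>: "\<phi> = (\<lambda>x. Re (\<zeta> * complex_of_real ((x / 2) ^ q) * cis (\<omega> * x)))"
    using assms(1) unfolding test_functions_def by blast
  have "\<bar>\<phi> x\<bar> \<le> cmod (\<zeta> * complex_of_real ((x / 2) ^ q) * cis (\<omega> * x))"
    unfolding \<phi> by (rule abs_Re_le_cmod)
  also have "\<dots> = \<bar>x / 2\<bar> ^ q" unfolding norm_mult z norm_of_real power_abs by simp
  also have "\<dots> \<le> 1" by (rule power_le_one) (use assms(2) in auto)
  finally show ?thesis .
qed

section \<open>From the hull condition to a short average of test functions\<close>

lemma test_functions_lipschitz:
  assumes "\<phi> \<in> test_functions p \<Omega>" "\<bar>x\<bar> \<le> 1" "\<bar>y\<bar> \<le> 1"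
  shows "\<phi> x - \<phi> y \<le> (real p + \<Omega>) * \<bar>x - y\<bar>"
proof -
  obtain \<zeta> q \<omega> where z: "cmod \<zeta> = 1" and q: "q \<in> {0, p}" and w: "\<bar>\<omega>\<bar> \<le> \<Omega>"
    and \<phi>: "\<phi> = (\<lambda>x. Re (\<zeta> * complex_of_real ((x / 2) ^ q) * cis (\<omega> * x)))"
    using assms(1) unfolding test_functions_def by blast
  have "\<phi> x - \<phi> y = Re (\<zeta> * (complex_of_real ((x / 2) ^ q - (y / 2) ^ q) * cis (\<omega> * x) +
      complex_of_real ((y / 2) ^ q) * (cis (\<omega> * x) - cis (\<omega> * y))))"
    unfolding \<phi> minus_complex.sel[symmetric] by (simp only: of_real_diff) (simp add: algebra_simps)
  also have "\<dots> \<le> cmod (\<zeta> * (complex_of_real ((x / 2) ^ q - (y / 2) ^ q) * cis (\<omega> * x) +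
      complex_of_real ((y / 2) ^ q) * (cis (\<omega> * x) - cis (\<omega> * y))))" by (rule complex_Re_le_cmod)
  also have "\<dots> = cmod (complex_of_real ((x / 2) ^ q - (y / 2) ^ q) * cis (\<omega> * x) +
      complex_of_real ((y / 2) ^ q) * (cis (\<omega> * x) - cis (\<omega> * y)))" by (simp only: norm_mult z mult_1_left)
  also have "\<dots> \<le> cmod (complex_of_real ((x / 2) ^ q - (y / 2) ^ q) * cis (\<omega> * x)) +
      cmod (complex_of_real ((y / 2) ^ q) * (cis (\<omega> * x) - cis (\<omega> * y)))" by (rule norm_triangle_ineq)
  also have "\<dots> = \<bar>(x / 2) ^ q - (y / 2) ^ q\<bar> + \<bar>y / 2\<bar> ^ q * cmod (cis (\<omega> * x) - cis (\<omega> * y))"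
    by (simp only: norm_mult norm_of_real norm_cis mult_1_right power_abs)
  also have "\<dots> \<le> real p * \<bar>x - y\<bar> + \<Omega> * \<bar>x - y\<bar>"
  proof (intro add_mono)
    have "\<bar>(x / 2) ^ q - (y / 2) ^ q\<bar> \<le> real q * \<bar>x / 2 - y / 2\<bar>"
      using norm_power_diff[of "x / 2" "y / 2" q] assms(2,3) by simp
    also have "\<dots> \<le> real p * \<bar>x - y\<bar>" using q by (intro mult_mono) (auto simp: abs_if)
    finally show "\<bar>(x / 2) ^ q - (y / 2) ^ q\<bar> \<le> real p * \<bar>x - y\<bar>" .
    have "\<bar>y / 2\<bar> ^ q * cmod (cis (\<omega> * x) - cis (\<omega> * y)) \<le> 1 * \<bar>\<omega> * x - \<omega> * y\<bar>"
      using assms(3) by (intro mult_mono power_le_one cmod_cis_diff_le) auto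
    also have "\<dots> = \<bar>\<omega>\<bar> * \<bar>x - y\<bar>" by (simp add: abs_mult flip: right_diff_distrib)
    also have "\<dots> \<le> \<Omega> * \<bar>x - y\<bar>" using w by (intro mult_right_mono) auto
    finally show "\<bar>y / 2\<bar> ^ q * cmod (cis (\<omega> * x) - cis (\<omega> * y)) \<le> \<Omega> * \<bar>x - y\<bar>" .
  qed
  finally show ?thesis by (simp add: distrib_right)
qed

context
  fixes \<beta> :: real and p :: nat and T \<Omega> :: real and g :: "real \<Rightarrow> real"
  assumes beta: "0 < \<beta>" and p: "odd p" "\<beta> + 2 \<le> real p" and T: "1 \<le> T" and Om: "\<Omega> = (real p + 1) * T"
    and g: "g = (\<lambda>x. gker \<beta> p T x / (2 ^ p + 1 / \<beta>))"
begin

text \<open>\<open>gker_hull\<close> needs bounds on moduli of complex sums. Choosing \<zeta> as the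
  conjugate phase of such a sum turns its modulus into the value of the real functional at a test
  function.\<close>

lemma gker_test_functions:
  assumes X: "finite X" and B: "\<And>\<phi>. \<phi> \<in> test_functions p \<Omega> \<Longrightarrow> (\<Sum>x\<in>X. \<mu> x * \<phi> x) \<le> B"
  shows "(\<Sum>x\<in>X. \<mu> x * g x) \<le> B"
proof -
  have k: "(0::real) < 2 ^ p + 1 / \<beta>" using beta by (simp add: add_pos_pos)
  have "(\<Sum>x\<in>X. \<mu> x * gker \<beta> p T x) \<le> (2 ^ p + 1 / \<beta>) * B"
  proof (rule gker_hull[OF beta p X T])
    show "(real p + 1) * T \<le> \<Omega>" by (simp add: Om)
    fix q and \<omega> :: real assume q: "q \<in> {0, p}" and w: "\<bar>\<omega>\<bar> \<le> \<Omega>"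
    define z where "z = (\<Sum>x\<in>X. complex_of_real (\<mu> x * (x / 2) ^ q) * cis (\<omega> * x))"
    define \<zeta> where "\<zeta> = (if z = 0 then 1 else cnj z / complex_of_real (cmod z))"
    have "\<zeta> * z = complex_of_real (cmod z)"
    proof (cases "z = 0")
      case False
      have "cnj z * z = complex_of_real ((cmod z)\<^sup>2)" unfolding complex_norm_square by (rule mult.commute)
      thus ?thesis using False by (simp add: \<zeta>_def power2_eq_square)
    qed simp
    hence "cmod z = Re (\<zeta> * z)" by simp
    also have "\<dots> = (\<Sum>x\<in>X. \<mu> x * Re (\<zeta> * complex_of_real ((x / 2) ^ q) * cis (\<omega> * x)))"
      unfolding z_def sum_distrib_left Re_sum by (intro sum.cong refl) (simp add: algebra_simps)
    also have "\<dots> \<le> B"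
    proof (rule B)
      have "cmod \<zeta> = 1" by (simp add: \<zeta>_def norm_divide)
      thus "(\<lambda>x. Re (\<zeta> * complex_of_real ((x / 2) ^ q) * cis (\<omega> * x))) \<in> test_functions p \<Omega>"
        unfolding test_functions_def using q w by blast
    qed
    finally show "cmod (\<Sum>x\<in>X. complex_of_real (\<mu> x * (x / 2) ^ q) * cis (\<omega> * x)) \<le> B" by (simp only: z_def)
  qed
  moreover have "(\<Sum>x\<in>X. \<mu> x * g x) = (\<Sum>x\<in>X. \<mu> x * gker \<beta> p T x) / (2 ^ p + 1 / \<beta>)"
    unfolding g times_divide_eq_right sum_divide_distrib[symmetric] by (rule refl)
  ultimately show ?thesis using k by (simp add: divide_le_eq mult.commute)
qed

lemma gker_scaled_le_1: assumes "\<bar>x\<bar> \<le> 1" shows "\<bar>g x\<bar> \<le> 1"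
proof -
  have "g x \<le> 1"
    using gker_test_functions[of "{x}" "\<lambda>_. 1" 1] test_functions_le_1[OF _ assms] by (auto simp: abs_le_iff)
  moreover have "- g x \<le> 1"
    using gker_test_functions[of "{x}" "\<lambda>_. - 1" 1] test_functions_le_1[OF _ assms] by (auto simp: abs_le_iff)
  ultimately show ?thesis by simp
qed

text \<open>A linear inequality on finitely many values that holds for all test functions passes to
  \<open>g\<close>. Here the functional is evaluation at x minus evaluation at y.\<close>

lemma gker_scaled_lipschitz:
  assumes "\<bar>x\<bar> \<le> 1" "\<bar>y\<bar> \<le> 1"
  shows "g x - g y \<le> (real p + \<Omega>) * \<bar>x - y\<bar>"
proof (cases "x = y")
  case False
  have s: "(\<Sum>z\<in>{x, y}. (if z = x then 1 else - 1) * h z) = h x - h y" for h :: "real \<Rightarrow> real"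
    using False by simp
  have "(\<Sum>z\<in>{x, y}. (if z = x then 1 else - 1) * g z) \<le> (real p + \<Omega>) * \<bar>x - y\<bar>"
    by (rule gker_test_functions, simp) (unfold s, rule test_functions_lipschitz[OF _ assms])
  thus ?thesis unfolding s .
qed simp

text \<open>The greedy lemma controls a finite grid of 2G + 1 points only. Averages of test
  functions and \<open>g\<close> share a Lipschitz constant, so moving to a grid point at distance
  at most 1/G costs this constant over G twice.\<close>

lemma gker_greedy:
  assumes l: "0 < l" "l \<le> 1/2" and G: "0 < G" and N: "ln (2 * (2 * real G + 1)) / l\<^sup>2 \<le> real N" "0 < N"
  shows "\<exists>\<phi>. (\<forall>i<N. \<phi> i \<in> test_functions p \<Omega>) \<and>
    (\<forall>x. \<bar>x\<bar> \<le> 1 \<longrightarrow> \<bar>(\<Sum>i<N. \<phi> i x) / real N - g x\<bar> \<le> 6 * l + 2 * (real p + \<Omega>) / real G)"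
proof -
  define X where "X = (\<lambda>k::int. real_of_int k / real G) ` {- int G..int G}"
  have fX: "finite X" and Xne: "X \<noteq> {}" unfolding X_def by auto
  have X1: "\<bar>x\<bar> \<le> 1" if "x \<in> X" for x using that G unfolding X_def by (auto simp: abs_le_iff field_simps)
  have "card X \<le> card {- int G..int G}" unfolding X_def by (rule card_image_le) simp
  hence "real (card X) \<le> 2 * real G + 1" by simp
  moreover have "0 < real (card X)" using fX Xne by (simp add: card_gt_0_iff)
  ultimately have "ln (2 * real (card X)) \<le> ln (2 * (2 * real G + 1))" by simp
  hence N1: "ln (2 * real (card X)) / l\<^sup>2 \<le> real N" using N(1) by (meson divide_right_mono order_trans zero_le_power2)
  obtain \<phi> where \<phi>: "\<And>i. i < N \<Longrightarrow> \<phi> i \<in> test_functions p \<Omega>"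
    and ap: "\<And>x. x \<in> X \<Longrightarrow> \<bar>(\<Sum>i<N. \<phi> i x) / real N - g x\<bar> \<le> 6 * l"
  proof -
    have "\<exists>\<phi>. (\<forall>i<N. \<phi> i \<in> test_functions p \<Omega>) \<and> (\<forall>x\<in>X. \<bar>(\<Sum>i<N. \<phi> i x) / real N - g x\<bar> \<le> 6 * l)"
    proof (rule greedy_approximation[OF fX Xne _ _ l N1 N(2)])
      fix \<phi> x assume "\<phi> \<in> test_functions p \<Omega>" "x \<in> X"
      thus "\<bar>\<phi> x - g x\<bar> \<le> 2" using test_functions_le_1[of \<phi> p \<Omega> x] gker_scaled_le_1[of x] X1[of x] by linarith
    next
      fix \<mu> B assume "\<And>\<phi>. \<phi> \<in> test_functions p \<Omega> \<Longrightarrow> (\<Sum>x\<in>X. \<mu> x * \<phi> x) \<le> B"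
      thus "(\<Sum>x\<in>X. \<mu> x * g x) \<le> B" by (rule gker_test_functions[OF fX])
    qed
    thus ?thesis using that by blast
  qed
  define L where "L = (real p + \<Omega>) / real G"
  have "\<bar>(\<Sum>i<N. \<phi> i x) / real N - g x\<bar> \<le> 6 * l + 2 * L" if x: "\<bar>x\<bar> \<le> 1" for x
  proof -
    define y where "y = real_of_int \<lfloor>x * real G\<rfloor> / real G"
    have xG: "- real G \<le> x * real G" "x * real G \<le> real G"
      using mult_right_mono[of x 1 "real G"] mult_right_mono[of "- 1" x "real G"] x by auto
    have "- int G \<le> \<lfloor>x * real G\<rfloor>" "\<lfloor>x * real G\<rfloor> \<le> int G" using xG by (simp_all add: le_floor_iff floor_le_iff)
    hence yX: "y \<in> X" unfolding X_def y_def by auto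
    have "x - y = (x * real G - real_of_int \<lfloor>x * real G\<rfloor>) / real G" using G by (simp add: y_def diff_divide_distrib)
    moreover have "\<bar>(x * real G - real_of_int \<lfloor>x * real G\<rfloor>) / real G\<bar> \<le> 1 / real G"
    proof -
      have "\<bar>x * real G - real_of_int \<lfloor>x * real G\<rfloor>\<bar> \<le> 1" by linarith
      thus ?thesis using G by (simp add: abs_divide divide_right_mono)
    qed
    ultimately have xy: "\<bar>x - y\<bar> \<le> 1 / real G" by (simp only:)
    have Om0: "0 \<le> real p + \<Omega>" using T by (simp add: Om)
    have La: "(real p + \<Omega>) * \<bar>x - y\<bar> \<le> L" using mult_left_mono[OF xy Om0] by (simp add: L_def)
    have g1: "\<bar>g x - g y\<bar> \<le> L"
      using gker_scaled_lipschitz[OF x X1[OF yX]] gker_scaled_lipschitz[OF X1[OF yX] x] La by (simp add: abs_minus_commute)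
    have f1: "\<bar>\<phi> i x - \<phi> i y\<bar> \<le> L" if i: "i < N" for i
      using test_functions_lipschitz[OF \<phi>[OF i] x X1[OF yX]] test_functions_lipschitz[OF \<phi>[OF i] X1[OF yX] x] La
      by (simp add: abs_minus_commute)
    have "\<bar>\<Sum>i<N. \<phi> i x - \<phi> i y\<bar> \<le> (\<Sum>i<N. L)"
      by (rule order_trans[OF sum_abs sum_mono]) (use f1 in auto)
    hence "\<bar>(\<Sum>i<N. \<phi> i x - \<phi> i y) / real N\<bar> \<le> L" using N(2) by (simp add: divide_le_eq mult.commute)
    hence "\<bar>(\<Sum>i<N. \<phi> i x) / real N - (\<Sum>i<N. \<phi> i y) / real N\<bar> \<le> L"
      by (simp add: sum_subtractf diff_divide_distrib)
    thus ?thesis using g1 ap[OF yX] by linarith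
  qed
  thus ?thesis using \<phi> by (intro exI[of _ \<phi>]) (simp add: L_def)
qed

end

text \<open>All errors are balanced at order \<delta>: truncation of the integral, deviation of the
  average on the grid, transfer from the grid to the interval, and replacement of characters by
  products of rotations. A finer grid affects N only through its logarithm, so it does not change
  the power of \<delta>.\<close>

lemma signed_power_approx:
  assumes beta: "0 < \<beta>"
  obtains A C p where "0 < A" "1 \<le> C"
    "\<forall>\<delta> N m. 0 < \<delta> \<longrightarrow> \<delta> \<le> 1 / 2 \<longrightarrow> C * ln (1 / \<delta>) / \<delta>\<^sup>2 \<le> real N \<longrightarrow>
      \<delta> powr (- 2 / \<beta> - 1) \<le> real m \<longrightarrow>
      (\<exists>\<zeta> \<theta>. (\<forall>i<N. cmod (\<zeta> i) = 1 \<and> length (\<theta> i) = p + m) \<and>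
        (\<forall>x. \<bar>x\<bar> \<le> 1 \<longrightarrow> \<bar>sgn x * \<bar>x\<bar> powr \<beta> - A * ((\<Sum>i<N. Re (\<zeta> i * amp (\<theta> i) x)) / real N)\<bar> \<le> C * \<delta>))"
proof -
  \<comment> \<open>Oddness makes \<open>gker\<close> odd in x and \<open>wker\<close> nonnegative.
    The margin p \<ge> \<beta> + 2 keeps t^(p-1-\<beta>) continuous at 0 and at most 1 on the unit
    interval.\<close>
  define p where "p = 2 * nat \<lceil>\<beta>\<rceil> + 3"
  have p: "odd p" "\<beta> + 2 \<le> real p" unfolding p_def using beta by (simp, linarith)
  obtain c where c: "0 < c" and gk: "\<And>T x. 0 < T \<Longrightarrow> \<bar>sgn x * \<bar>x\<bar> powr \<beta> - gker \<beta> p T x / c\<bar> \<le> T powr - \<beta> / (\<beta> * c)"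
    using gker_approx[OF beta p] by blast
  define \<kappa> where "\<kappa> = 2 ^ p + 1 / \<beta>"
  have k: "0 < \<kappa>" unfolding \<kappa>_def using beta by (simp add: add_pos_pos)
  define A where "A = \<kappa> / c"
  have A: "0 < A" using k c by (simp add: A_def)
  \<comment> \<open>\<open>C1\<close> absorbs the logarithm of the grid size, which is
    O(\<delta>^(-1-1/\<beta>)). In \<open>C2\<close>, the first summand is the truncation error, 8 =
    6 + 2 collects the greedy and the grid error, and 4 (p + 1)^2 comes from the rotations.\<close>
  define C1 where "C1 = ln (8 * real p + 10) / ln 2 + 1 / \<beta> + 1"
  define C2 where "C2 = 1 / (\<beta> * c) + A * (8 + 4 * (real p + 1)\<^sup>2)"
  define C where "C = max 1 (max C1 C2)"
  have main: "\<exists>\<zeta> \<theta>. (\<forall>i<N. cmod (\<zeta> i) = 1 \<and> length (\<theta> i) = p + m) \<and>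
      (\<forall>x. \<bar>x\<bar> \<le> 1 \<longrightarrow> \<bar>sgn x * \<bar>x\<bar> powr \<beta> - A * ((\<Sum>i<N. Re (\<zeta> i * amp (\<theta> i) x)) / real N)\<bar> \<le> C * \<delta>)"
    if d: "0 < \<delta>" "\<delta> \<le> 1 / 2" and N: "C * ln (1 / \<delta>) / \<delta>\<^sup>2 \<le> real N" and m: "\<delta> powr (- 2 / \<beta> - 1) \<le> real m" for \<delta> N m
  proof -
    \<comment> \<open>With this T the truncation error of order T^(-\<beta>) is of order \<delta>,
      and \<Omega>^2/m \<le> (p + 1)^2 \<delta> becomes the condition imposed on m.\<close>
    define T where "T = \<delta> powr (- 1 / \<beta>)"
    define \<Omega> where "\<Omega> = (real p + 1) * T"
    define G where "G = nat \<lceil>(real p + \<Omega>) / \<delta>\<rceil>"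
    define g where "g = (\<lambda>x. gker \<beta> p T x / (2 ^ p + 1 / \<beta>))"
    have T: "1 \<le> T" unfolding T_def using d beta powr_mono2'[of "- 1 / \<beta>" \<delta> 1] by simp
    have Om: "0 < real p + \<Omega>" using T by (simp add: \<Omega>_def add_nonneg_pos)
    have G: "(real p + \<Omega>) / \<delta> \<le> real G" unfolding G_def by linarith
    have G0: "0 < G" using G Om d by (metis divide_pos_pos less_le_trans of_nat_0_less_iff)
    have ld: "ln 2 \<le> ln (1 / \<delta>)" using d by (simp add: field_simps)
    have ld0: "0 < ln (1 / \<delta>)" using ld ln_gt_zero[of "2::real"] by linarith
    have "ln (2 * (2 * real G + 1)) \<le> C * ln (1 / \<delta>)"
    proof -
      define D where "D = T / \<delta>"
      have Td: "1 \<le> D" unfolding D_def using mult_mono[of 1 T 1 "1 / \<delta>"] T d by simp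
      have "0 \<le> (real p + \<Omega>) / \<delta>" using Om d by simp
      hence "real G \<le> (real p + \<Omega>) / \<delta> + 1" unfolding G_def by linarith
      also have "\<dots> \<le> (2 * real p + 1) * D + 1"
      proof -
        have "real p + \<Omega> \<le> (2 * real p + 1) * T" using mult_left_mono[OF T, of "real p"] by (simp add: \<Omega>_def algebra_simps)
        thus ?thesis using d by (simp add: D_def divide_right_mono)
      qed
      finally have "2 * (2 * real G + 1) \<le> (8 * real p + 10) * D"
        using Td by (simp add: algebra_simps)
      hence "ln (2 * (2 * real G + 1)) \<le> ln ((8 * real p + 10) * D)" by simp
      also have "\<dots> = ln (8 * real p + 10) + (ln T - ln \<delta>)" using T d by (simp add: D_def ln_mult ln_div)
      also have "ln T = 1 / \<beta> * ln (1 / \<delta>)" using d by (simp add: T_def ln_powr ln_div)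
      also have "ln (8 * real p + 10) + (1 / \<beta> * ln (1 / \<delta>) - ln \<delta>) \<le> C1 * ln (1 / \<delta>)"
      proof -
        have "ln (8 * real p + 10) / ln 2 * ln 2 \<le> ln (8 * real p + 10) / ln 2 * ln (1 / \<delta>)"
          using ld by (intro mult_left_mono) auto
        thus ?thesis using d unfolding C1_def distrib_right by (simp add: ln_div)
      qed
      also have "\<dots> \<le> C * ln (1 / \<delta>)" using ld0 by (intro mult_right_mono) (auto simp: C_def)
      finally show ?thesis .
    qed
    hence N1: "ln (2 * (2 * real G + 1)) / \<delta>\<^sup>2 \<le> real N" using N by (meson divide_right_mono order_trans zero_le_power2)
    have N0: "0 < N"
    proof -
      have "0 < C * ln (1 / \<delta>) / \<delta>\<^sup>2" using ld0 d by (simp add: C_def)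
      thus ?thesis using N by linarith
    qed
    have "0 < \<delta> powr (- 2 / \<beta> - 1)" using d by simp
    hence m0: "0 < m" using m by linarith
    obtain \<phi> where \<phi>: "\<And>i. i < N \<Longrightarrow> \<phi> i \<in> test_functions p \<Omega>"
      and ap: "\<And>x. \<bar>x\<bar> \<le> 1 \<Longrightarrow> \<bar>(\<Sum>i<N. \<phi> i x) / real N - g x\<bar> \<le> 6 * \<delta> + 2 * (real p + \<Omega>) / real G"
      using gker_greedy[OF beta p T \<Omega>_def g_def d G0 N1 N0] by blast
    have "\<exists>\<zeta> \<theta>. \<forall>i<N. cmod (\<zeta> i) = 1 \<and> length (\<theta> i) = p + m \<and>
      (\<forall>x. \<bar>x\<bar> \<le> 1 \<longrightarrow> \<bar>Re (\<zeta> i * amp (\<theta> i) x) - \<phi> i x\<bar> \<le> 4 * \<Omega>\<^sup>2 / real m)"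
      using amp_approx_test_function[OF \<phi> m0] by metis
    then obtain \<zeta> \<theta> where zt: "\<And>i. i < N \<Longrightarrow> cmod (\<zeta> i) = 1 \<and> length (\<theta> i) = p + m"
      and am: "\<And>i x. i < N \<Longrightarrow> \<bar>x\<bar> \<le> 1 \<Longrightarrow> \<bar>Re (\<zeta> i * amp (\<theta> i) x) - \<phi> i x\<bar> \<le> 4 * \<Omega>\<^sup>2 / real m" by blast
    have "\<bar>sgn x * \<bar>x\<bar> powr \<beta> - A * ((\<Sum>i<N. Re (\<zeta> i * amp (\<theta> i) x)) / real N)\<bar> \<le> C * \<delta>" if x: "\<bar>x\<bar> \<le> 1" for x
    proof -
      let ?a = "(\<Sum>i<N. Re (\<zeta> i * amp (\<theta> i) x)) / real N" and ?f = "(\<Sum>i<N. \<phi> i x) / real N"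
      have "\<bar>\<Sum>i<N. Re (\<zeta> i * amp (\<theta> i) x) - \<phi> i x\<bar> \<le> (\<Sum>i<N. 4 * \<Omega>\<^sup>2 / real m)"
        by (rule order_trans[OF sum_abs sum_mono]) (use am x in auto)
      also have "\<dots> = real N * (4 * \<Omega>\<^sup>2 / real m)" by simp
      finally have "\<bar>\<Sum>i<N. Re (\<zeta> i * amp (\<theta> i) x) - \<phi> i x\<bar> / real N \<le> 4 * \<Omega>\<^sup>2 / real m"
        using N0 by (simp only: divide_le_eq of_nat_0_less_iff if_True mult.commute)
      hence e1: "\<bar>?a - ?f\<bar> \<le> 4 * \<Omega>\<^sup>2 / real m"
        by (simp only: sum_subtractf diff_divide_distrib[symmetric] abs_divide abs_of_nat)
      have "4 * \<Omega>\<^sup>2 \<le> 4 * (real p + 1)\<^sup>2 * \<delta> * real m"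
      proof -
        have "T\<^sup>2 = \<delta> powr (- 2 / \<beta>)" using d by (simp add: T_def power2_eq_square flip: powr_add)
        also have "\<dots> = \<delta> powr (- 2 / \<beta> - 1) * \<delta>" using d by (simp add: powr_diff)
        also have "\<dots> \<le> real m * \<delta>" using m d by (intro mult_right_mono) auto
        finally have "4 * (real p + 1)\<^sup>2 * T\<^sup>2 \<le> 4 * (real p + 1)\<^sup>2 * (real m * \<delta>)" by (intro mult_left_mono) auto
        thus ?thesis by (simp add: \<Omega>_def power_mult_distrib mult_ac)
      qed
      hence e2: "4 * \<Omega>\<^sup>2 / real m \<le> 4 * (real p + 1)\<^sup>2 * \<delta>" using m0 by (simp add: divide_le_eq)
      have e3: "2 * (real p + \<Omega>) / real G \<le> 2 * \<delta>" using G G0 d by (simp add: field_simps)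
      have "\<bar>?a - g x\<bar> \<le> (8 + 4 * (real p + 1)\<^sup>2) * \<delta>" using e1 e2 e3 ap[OF x] by (simp add: distrib_right)
      hence "A * \<bar>?a - g x\<bar> \<le> A * ((8 + 4 * (real p + 1)\<^sup>2) * \<delta>)" using A by (intro mult_left_mono) auto
      hence e4: "\<bar>A * ?a - A * g x\<bar> \<le> A * (8 + 4 * (real p + 1)\<^sup>2) * \<delta>"
        using A by (simp only: right_diff_distrib[symmetric] abs_mult abs_of_pos mult.assoc)
      have "A * g x = gker \<beta> p T x / c" using k by (simp add: A_def g_def \<kappa>_def[symmetric])
      hence "\<bar>sgn x * \<bar>x\<bar> powr \<beta> - A * g x\<bar> \<le> T powr - \<beta> / (\<beta> * c)" using gk[of T x] T by simp
      also have "\<dots> = 1 / (\<beta> * c) * \<delta>" using d beta by (simp add: T_def powr_powr)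
      finally have "\<bar>sgn x * \<bar>x\<bar> powr \<beta> - A * g x\<bar> \<le> 1 / (\<beta> * c) * \<delta>" .
      with e4 have "\<bar>sgn x * \<bar>x\<bar> powr \<beta> - A * ?a\<bar> \<le> C2 * \<delta>" unfolding C2_def distrib_right by linarith
      also have "\<dots> \<le> C * \<delta>" using d by (intro mult_right_mono) (auto simp: C_def)
      finally show ?thesis .
    qed
    thus ?thesis using zt by blast
  qed
  have "1 \<le> C" by (simp add: C_def)
  thus ?thesis using that A main by blast
qed

section \<open>From the power sum to the distance\<close>

lemma powr_subadditive:
  fixes a b s :: real assumes "0 \<le> a" "0 \<le> b" "0 < s" "s \<le> 1"
  shows "(a + b) powr s \<le> a powr s + b powr s"
proof (cases "a + b = 0")
  case False
  hence ab: "0 < a + b" using assms by linarith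
  have u: "u \<le> u powr s" if "0 \<le> u" "u \<le> 1" for u :: real
    using powr_mono'[of s 1 u] that assms by simp
  have "1 = a / (a + b) + b / (a + b)" using ab by (simp flip: add_divide_distrib)
  also have "\<dots> \<le> (a / (a + b)) powr s + (b / (a + b)) powr s"
    using assms ab by (intro add_mono u) auto
  also have "\<dots> = (a powr s + b powr s) / (a + b) powr s" using assms by (simp add: powr_divide add_divide_distrib)
  finally show ?thesis using ab by (simp add: le_divide_eq)
qed (use assms in simp)

lemma powr_diff_le_powr_abs_diff:
  fixes u v s :: real assumes "0 \<le> u" "0 \<le> v" "0 < s" "s \<le> 1"
  shows "\<bar>u powr s - v powr s\<bar> \<le> \<bar>u - v\<bar> powr s"
proof -
  have *: "\<bar>a powr s - b powr s\<bar> \<le> \<bar>a - b\<bar> powr s" if ab: "0 \<le> a" "a \<le> b" for a b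
  proof -
    have "b powr s - a powr s \<le> (b - a) powr s" using powr_subadditive[of "b - a" a s] ab assms by simp
    moreover have "a powr s \<le> b powr s" using ab assms by (intro powr_mono2) auto
    ultimately show ?thesis using ab by (simp add: abs_minus_commute[of a] abs_minus_commute[of "a powr s"])
  qed
  show ?thesis using *[of u v] *[of v u] assms by (cases "u \<le> v") (auto simp: abs_minus_commute)
qed

text \<open>The |l i| add up to at most 2, so a uniform error \<epsilon>^\<alpha>/4 of
  \<open>A * h\<close> changes the power sum by at most \<epsilon>^\<alpha>/2, independently of d.
  The statistical error, scaled by A, takes the other half, and Hoelder continuity of the root turns
  \<epsilon>^\<alpha> into \<epsilon>.\<close>

lemma l_distance_estimate:
  fixes l p q :: "nat \<Rightarrow> real" and h :: "real \<Rightarrow> real"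
  assumes \<alpha>: "1 < \<alpha>" and eps: "0 < \<epsilon>" and A: "0 < A"
    and p: "\<And>i. i < d \<Longrightarrow> 0 \<le> p i" "(\<Sum>i<d. p i) = 1" and q: "\<And>i. i < d \<Longrightarrow> 0 \<le> q i" "(\<Sum>i<d. q i) = 1"
    and l: "\<And>i. i < d \<Longrightarrow> l i = p i - q i"
    and h: "\<And>x. \<bar>x\<bar> \<le> 1 \<Longrightarrow> \<bar>sgn x * \<bar>x\<bar> powr (\<alpha> - 1) - A * h x\<bar> \<le> \<epsilon> powr \<alpha> / 4"
    and y: "\<bar>y - (\<Sum>i<d. l i * h (l i))\<bar> \<le> \<epsilon> powr \<alpha> / (2 * A)"
  shows "\<bar>1/2 * max 0 (A * y) powr (1/\<alpha>) - 1/2 * (\<Sum>i<d. \<bar>l i\<bar> powr \<alpha>) powr (1/\<alpha>)\<bar> \<le> \<epsilon>"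
proof -
  define S where "S = (\<Sum>i<d. \<bar>l i\<bar> powr \<alpha>)"
  have l1: "\<bar>l i\<bar> \<le> 1" if i: "i < d" for i
  proof -
    have "p i \<le> (\<Sum>i<d. p i)" "q i \<le> (\<Sum>i<d. q i)" using i p(1) q(1) by (auto intro!: member_le_sum)
    thus ?thesis using l[OF i] p(1)[OF i] q(1)[OF i] p(2) q(2) by simp
  qed
  have "(\<Sum>i<d. \<bar>l i\<bar>) \<le> (\<Sum>i<d. p i + q i)"
    using p(1) q(1) l by (intro sum_mono) (simp add: abs_if)
  hence l2: "(\<Sum>i<d. \<bar>l i\<bar>) \<le> 2" by (simp add: sum.distrib p(2) q(2))
  have S: "S = (\<Sum>i<d. l i * (sgn (l i) * \<bar>l i\<bar> powr (\<alpha> - 1)))"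
    unfolding S_def
  proof (intro sum.cong refl)
    fix i
    have "x * (sgn x * \<bar>x\<bar> powr (\<alpha> - 1)) = \<bar>x\<bar> powr \<alpha>" for x :: real
    proof (cases "x = 0")
      case False
      have "x * (sgn x * \<bar>x\<bar> powr (\<alpha> - 1)) = \<bar>x\<bar> powr 1 * \<bar>x\<bar> powr (\<alpha> - 1)" by (simp add: sgn_if)
      also have "\<dots> = \<bar>x\<bar> powr \<alpha>" unfolding powr_add[symmetric] by simp
      finally show ?thesis .
    qed simp
    thus "\<bar>l i\<bar> powr \<alpha> = l i * (sgn (l i) * \<bar>l i\<bar> powr (\<alpha> - 1))" by simp
  qed
  have "\<bar>S - A * (\<Sum>i<d. l i * h (l i))\<bar> = \<bar>\<Sum>i<d. l i * (sgn (l i) * \<bar>l i\<bar> powr (\<alpha> - 1) - A * h (l i))\<bar>"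
    unfolding S sum_distrib_left sum_subtractf[symmetric] by (intro arg_cong[of _ _ abs] sum.cong refl) (simp add: algebra_simps)
  also have "\<dots> \<le> (\<Sum>i<d. \<bar>l i\<bar> * (\<epsilon> powr \<alpha> / 4))"
  proof (rule order_trans[OF sum_abs sum_mono])
    fix i assume "i \<in> {..<d}"
    hence "\<bar>sgn (l i) * \<bar>l i\<bar> powr (\<alpha> - 1) - A * h (l i)\<bar> \<le> \<epsilon> powr \<alpha> / 4" by (intro h l1) simp
    thus "\<bar>l i * (sgn (l i) * \<bar>l i\<bar> powr (\<alpha> - 1) - A * h (l i))\<bar> \<le> \<bar>l i\<bar> * (\<epsilon> powr \<alpha> / 4)"
      unfolding abs_mult[of "l i"] by (intro mult_left_mono) auto
  qed
  also have "\<dots> \<le> 2 * (\<epsilon> powr \<alpha> / 4)" unfolding sum_distrib_right[symmetric] by (intro mult_right_mono l2) simp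
  finally have 1: "\<bar>S - A * (\<Sum>i<d. l i * h (l i))\<bar> \<le> \<epsilon> powr \<alpha> / 2" by simp
  have "A * \<bar>y - (\<Sum>i<d. l i * h (l i))\<bar> \<le> A * (\<epsilon> powr \<alpha> / (2 * A))" using y A by (intro mult_left_mono) auto
  also have "\<dots> = \<epsilon> powr \<alpha> / 2" using A by simp
  also have "A * \<bar>y - (\<Sum>i<d. l i * h (l i))\<bar> = \<bar>A * y - A * (\<Sum>i<d. l i * h (l i))\<bar>"
    using A by (simp only: right_diff_distrib[symmetric] abs_mult abs_of_pos)
  finally have "\<bar>A * y - S\<bar> \<le> \<epsilon> powr \<alpha>" using 1 by linarith
  moreover have S0: "0 \<le> S" by (simp add: S_def sum_nonneg)
  \<comment> \<open>The estimate \<open>A * y\<close> may be negative, where \<open>powr\<close> is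
    no root; as S is nonnegative, clipping at 0 does not move it away from S.\<close>
  ultimately have 2: "\<bar>max 0 (A * y) - S\<bar> \<le> \<epsilon> powr \<alpha>" by linarith
  have "\<bar>max 0 (A * y) powr (1/\<alpha>) - S powr (1/\<alpha>)\<bar> \<le> \<bar>max 0 (A * y) - S\<bar> powr (1/\<alpha>)"
    using \<alpha> S0 by (intro powr_diff_le_powr_abs_diff) auto
  also have "\<dots> \<le> (\<epsilon> powr \<alpha>) powr (1/\<alpha>)" using 2 \<alpha> by (intro powr_mono2) auto
  also have "\<dots> = \<epsilon>" using \<alpha> eps by (simp add: powr_powr)
  finally show ?thesis using eps unfolding S_def by linarith
qed

text \<open>With w = \<epsilon>^\<alpha>, the number N of members is of order L/w^2 and m is of
  order w^(-\<gamma>), so the product is of order L/w^(\<gamma>+2). The restriction to \<epsilon>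
  \<le> 1/e gives L \<ge> 1, which absorbs additive constants into L and bounds L by its
  square.\<close>

lemma parameter_bound:
  fixes \<alpha> :: real
  assumes \<alpha>: "1 < \<alpha>" and A: "0 < A" and C: "1 \<le> C"
  shows "\<exists>K>0. \<forall>\<epsilon>. 0 < \<epsilon> \<and> \<epsilon> \<le> exp (- 1) \<longrightarrow> (\<exists>N m. let \<delta> = \<epsilon> powr \<alpha> / (4 * C) in
    0 < \<delta> \<and> \<delta> \<le> 1 / 2 \<and> 1 \<le> N \<and> 6 \<le> real N * (\<epsilon> powr \<alpha> / (2 * A))\<^sup>2 \<and>
    C * ln (1 / \<delta>) / \<delta>\<^sup>2 \<le> real N \<and> \<delta> powr (- 2 / (\<alpha> - 1) - 1) \<le> real m \<and>
    real N * real (Suc (P + m)) \<le> K * (1 / \<epsilon> powr (3 * \<alpha> + 2 + 2 / (\<alpha> - 1)) * (ln (1 / \<epsilon>))\<^sup>2))"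
proof -
  define \<gamma> where "\<gamma> = 2 / (\<alpha> - 1) + 1"
  \<comment> \<open>The two summands of \<open>K1\<close> meet the two demands on N: the first is
    the length of the Maurey average, C ln(1/\<delta>)/\<delta>^2 with \<delta> = w/(4C), and 24 A^2
    is what Chebyshev's inequality requires at accuracy w/(2A).\<close>
  define K1 where "K1 = 16 * C ^ 3 * (\<alpha> + ln (4 * C)) + 24 * A\<^sup>2"
  define K2 where "K2 = (4 * C) powr \<gamma> + real P + 2"
  have \<gamma>: "0 < \<gamma>" unfolding \<gamma>_def using \<alpha> by (intro add_pos_pos) auto
  have lnC: "0 \<le> ln (4 * C)" using C by simp
  have C3: "0 \<le> 16 * C ^ 3 * (\<alpha> + ln (4 * C))" using C \<alpha> lnC by simp
  have K1: "0 < K1" unfolding K1_def using C3 A by (intro add_nonneg_pos) auto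
  have K2: "0 < K2" unfolding K2_def by (simp add: add_nonneg_pos)
  have "\<exists>N m. let \<delta> = \<epsilon> powr \<alpha> / (4 * C) in
    0 < \<delta> \<and> \<delta> \<le> 1 / 2 \<and> 1 \<le> N \<and> 6 \<le> real N * (\<epsilon> powr \<alpha> / (2 * A))\<^sup>2 \<and>
    C * ln (1 / \<delta>) / \<delta>\<^sup>2 \<le> real N \<and> \<delta> powr (- 2 / (\<alpha> - 1) - 1) \<le> real m \<and>
    real N * real (Suc (P + m)) \<le> (K1 + 1) * K2 * (1 / \<epsilon> powr (3 * \<alpha> + 2 + 2 / (\<alpha> - 1)) * (ln (1 / \<epsilon>))\<^sup>2)"
    if e: "0 < \<epsilon>" "\<epsilon> \<le> exp (- 1)" for \<epsilon>
  proof -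
    define L where "L = ln (1 / \<epsilon>)"
    define w where "w = \<epsilon> powr \<alpha>"
    define \<delta> where "\<delta> = w / (4 * C)"
    have e1: "\<epsilon> \<le> 1" using e(2) exp_le_one_iff[of "- 1 :: real"] by linarith
    have "ln \<epsilon> \<le> - 1" using ln_mono[of \<epsilon> "exp (- 1)"] e by simp
    hence L: "1 \<le> L" using e by (simp add: L_def ln_div)
    have w: "0 < w" "w \<le> 1" using e e1 \<alpha> by (auto simp: w_def powr_le1)
    define N where "N = nat \<lceil>K1 * L / w\<^sup>2\<rceil>"
    define m where "m = nat \<lceil>\<delta> powr (- \<gamma>)\<rceil>"
    have d: "0 < \<delta>" "\<delta> \<le> 1 / 2" using w C by (simp_all add: \<delta>_def field_simps)
    have w2: "w\<^sup>2 \<le> 1" using w by (simp add: power_le_one)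
    have Nlow: "K1 * L / w\<^sup>2 \<le> real N" unfolding N_def by linarith
    have Npos: "0 < K1 * L / w\<^sup>2" using K1 L w by simp
    hence N1: "1 \<le> N" using Nlow by (cases N) auto
    have "24 * A\<^sup>2 \<le> K1 * L" using mult_mono[of "24 * A\<^sup>2" K1 1 L] C3 L K1 by (simp add: K1_def)
    hence "24 * A\<^sup>2 / w\<^sup>2 \<le> K1 * L / w\<^sup>2" by (intro divide_right_mono) auto
    hence "24 * A\<^sup>2 / w\<^sup>2 \<le> real N" using Nlow by linarith
    hence N2: "6 \<le> real N * (w / (2 * A))\<^sup>2" using w A by (simp add: power_divide power_mult_distrib field_simps)
    have "ln (1 / \<delta>) = \<alpha> * L + ln (4 * C)"
      using e C w by (simp add: \<delta>_def L_def w_def ln_div ln_mult ln_powr)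
    also have "\<dots> \<le> \<alpha> * L + ln (4 * C) * L" using mult_left_mono[OF L lnC] by simp
    finally have "C * ln (1 / \<delta>) / \<delta>\<^sup>2 \<le> C * ((\<alpha> + ln (4 * C)) * L) / \<delta>\<^sup>2"
      using C by (intro divide_right_mono mult_left_mono) (auto simp: distrib_right)
    also have "\<dots> = 16 * C ^ 3 * (\<alpha> + ln (4 * C)) * L / w\<^sup>2"
      using C w by (simp add: \<delta>_def power_divide power_mult_distrib power2_eq_square power3_eq_cube field_simps)
    also have "\<dots> \<le> K1 * L / w\<^sup>2" using L unfolding K1_def by (intro divide_right_mono mult_right_mono) auto
    finally have N3: "C * ln (1 / \<delta>) / \<delta>\<^sup>2 \<le> real N" using Nlow by linarith
    have "- 2 / (\<alpha> - 1) - 1 = - \<gamma>" by (simp add: \<gamma>_def)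
    moreover have "\<delta> powr (- \<gamma>) \<le> real m" unfolding m_def by linarith
    ultimately have m1: "\<delta> powr (- 2 / (\<alpha> - 1) - 1) \<le> real m" by (simp only:)
    have "1 \<le> L / w\<^sup>2" using mult_mono[of 1 L 1 "1 / w\<^sup>2"] L w w2 by simp
    moreover have "real N \<le> K1 * L / w\<^sup>2 + 1" using Npos unfolding N_def by linarith
    \<comment> \<open>The rounding in N is paid for by 1 \<le> L/w^2, which turns \<open>K1\<close>
      into \<open>K1 + 1\<close>.\<close>
    ultimately have Nup: "real N \<le> (K1 + 1) * (L / w\<^sup>2)" by (simp add: distrib_right add_divide_distrib)
    have "0 \<le> \<delta> powr (- \<gamma>)" by simp
    hence "real m \<le> \<delta> powr (- \<gamma>) + 1" unfolding m_def by linarith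
    also have "\<delta> powr (- \<gamma>) = (4 * C) powr \<gamma> * w powr (- \<gamma>)"
      using w C by (simp add: \<delta>_def powr_divide powr_minus field_simps)
    finally have "real (Suc (P + m)) \<le> (4 * C) powr \<gamma> * w powr (- \<gamma>) + (real P + 2) * 1" by simp
    also have "\<dots> \<le> (4 * C) powr \<gamma> * w powr (- \<gamma>) + (real P + 2) * w powr (- \<gamma>)"
      using w \<gamma> powr_mono2'[of "- \<gamma>" w 1] by (intro add_left_mono mult_left_mono) auto
    also have "\<dots> = K2 * w powr (- \<gamma>)" by (simp add: K2_def algebra_simps)
    finally have Mup: "real (Suc (P + m)) \<le> K2 * w powr (- \<gamma>)" .
    have "real N * real (Suc (P + m)) \<le> (K1 + 1) * (L / w\<^sup>2) * (K2 * w powr (- \<gamma>))"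
      using Nup Mup K1 L w by (intro mult_mono) auto
    also have "\<dots> = (K1 + 1) * K2 * (w powr (- \<gamma>) / w\<^sup>2 * L)" by simp
    also have "w powr (- \<gamma>) / w\<^sup>2 = 1 / w powr (\<gamma> + 2)" using w by (simp add: powr_add powr_minus field_simps)
    also have "w powr (\<gamma> + 2) = \<epsilon> powr (3 * \<alpha> + 2 + 2 / (\<alpha> - 1))"
    proof -
      have "\<alpha> * (\<gamma> + 2) = 3 * \<alpha> + 2 + 2 / (\<alpha> - 1)" using \<alpha> by (simp add: \<gamma>_def field_simps)
      thus ?thesis by (simp add: w_def powr_powr)
    qed
    also have "(K1 + 1) * K2 * (1 / \<epsilon> powr (3 * \<alpha> + 2 + 2 / (\<alpha> - 1)) * L) \<le>
      (K1 + 1) * K2 * (1 / \<epsilon> powr (3 * \<alpha> + 2 + 2 / (\<alpha> - 1)) * L\<^sup>2)"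
      using K1 K2 L by (intro mult_left_mono) (auto simp: power2_eq_square)
    finally show ?thesis
      using d N1 N2 N3 m1 unfolding Let_def L_def \<delta>_def w_def by blast
  qed
  moreover have "0 < (K1 + 1) * K2" using K1 K2 by simp
  ultimately show ?thesis by blast
qed

theorem theorem3p5:
  fixes \<alpha> :: real
  assumes "\<alpha> > 1"
  shows "\<exists>(Q :: nat \<Rightarrow> real \<Rightarrow> sample_algorithm) (C :: real). C > 0 \<and>
    (\<forall>\<^sub>F \<epsilon> in at_right (0::real). \<forall>n\<ge>1.
       valid_algorithm n (Q n \<epsilon>) \<and>
       estimates_l_distance \<alpha> n \<epsilon> (Q n \<epsilon>) \<and>
       real (sample_count (Q n \<epsilon>)) \<le>
         C * (1 / \<epsilon> powr (3 * \<alpha> + 2 + 2 / (\<alpha> - 1)) * (ln (1 / \<epsilon>))\<^sup>2) \<and>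
       real (gate_count (Q n \<epsilon>)) \<le>
         C * (real n / \<epsilon> powr (3 * \<alpha> + 2 + 2 / (\<alpha> - 1)) * (ln (1 / \<epsilon>))\<^sup>2))"
proof -
  obtain A C p where A: "0 < A" and C: "1 \<le> C" and ap: "\<forall>\<delta> N m. 0 < \<delta> \<longrightarrow> \<delta> \<le> 1 / 2 \<longrightarrow>
    C * ln (1 / \<delta>) / \<delta>\<^sup>2 \<le> real N \<longrightarrow> \<delta> powr (- 2 / (\<alpha> - 1) - 1) \<le> real m \<longrightarrow>
    (\<exists>\<zeta> \<theta>. (\<forall>i<N. cmod (\<zeta> i) = 1 \<and> length (\<theta> i) = p + m) \<and>
      (\<forall>x. \<bar>x\<bar> \<le> 1 \<longrightarrow> \<bar>sgn x * \<bar>x\<bar> powr (\<alpha> - 1) - A * ((\<Sum>i<N. Re (\<zeta> i * amp (\<theta> i) x)) / real N)\<bar> \<le> C * \<delta>))"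
    by (rule signed_power_approx[OF diff_gt_0_iff_gt[THEN iffD2, OF assms]])
  define R where "R \<epsilon> = 1 / \<epsilon> powr (3 * \<alpha> + 2 + 2 / (\<alpha> - 1)) * (ln (1 / \<epsilon>))\<^sup>2" for \<epsilon>
  obtain K where K: "0 < K" and par: "\<And>\<epsilon>. 0 < \<epsilon> \<and> \<epsilon> \<le> exp (- 1) \<Longrightarrow> \<exists>N m. let \<delta> = \<epsilon> powr \<alpha> / (4 * C) in
    0 < \<delta> \<and> \<delta> \<le> 1 / 2 \<and> 1 \<le> N \<and> 6 \<le> real N * (\<epsilon> powr \<alpha> / (2 * A))\<^sup>2 \<and>
    C * ln (1 / \<delta>) / \<delta>\<^sup>2 \<le> real N \<and> \<delta> powr (- 2 / (\<alpha> - 1) - 1) \<le> real m \<and>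
    real N * real (Suc (p + m)) \<le> K * R \<epsilon>"
    using parameter_bound[OF assms A C, of p] unfolding R_def by blast
  \<comment> \<open>Phases, angles and their number are chosen from \<epsilon> alone, before n is
    fixed. This is why a single constant and a single range of \<epsilon> work for all n.\<close>
  define good where "good \<epsilon> N M \<zeta> \<theta> \<longleftrightarrow> 1 \<le> N \<and> 6 \<le> real N * (\<epsilon> powr \<alpha> / (2 * A))\<^sup>2 \<and> real N * real (Suc M) \<le> K * R \<epsilon> \<and>
    (\<forall>i<N. cmod (\<zeta> i) = 1 \<and> length (\<theta> i) = M) \<and>
    (\<forall>x. \<bar>x\<bar> \<le> 1 \<longrightarrow> \<bar>sgn x * \<bar>x\<bar> powr (\<alpha> - 1) - A * ((\<Sum>i<N. Re (\<zeta> i * amp (\<theta> i) x)) / real N)\<bar> \<le> \<epsilon> powr \<alpha> / 4)"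
    for \<epsilon> N M and \<zeta> :: "nat \<Rightarrow> complex" and \<theta>
  have "\<exists>N M \<zeta> \<theta>. good \<epsilon> N M \<zeta> \<theta>" if e: "0 < \<epsilon> \<and> \<epsilon> \<le> exp (- 1)" for \<epsilon>
  proof -
    define \<delta> where "\<delta> = \<epsilon> powr \<alpha> / (4 * C)"
    obtain N m where Nm: "0 < \<delta>" "\<delta> \<le> 1 / 2" "1 \<le> N" "6 \<le> real N * (\<epsilon> powr \<alpha> / (2 * A))\<^sup>2"
      "C * ln (1 / \<delta>) / \<delta>\<^sup>2 \<le> real N" "\<delta> powr (- 2 / (\<alpha> - 1) - 1) \<le> real m" "real N * real (Suc (p + m)) \<le> K * R \<epsilon>"
      using par[OF e] unfolding Let_def \<delta>_def by blast
    have e': "C * \<delta> = \<epsilon> powr \<alpha> / 4" using C by (simp add: \<delta>_def)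
    obtain \<zeta> \<theta> where "\<forall>i<N. cmod (\<zeta> i) = 1 \<and> length (\<theta> i) = p + m"
      "\<forall>x. \<bar>x\<bar> \<le> 1 \<longrightarrow> \<bar>sgn x * \<bar>x\<bar> powr (\<alpha> - 1) - A * ((\<Sum>i<N. Re (\<zeta> i * amp (\<theta> i) x)) / real N)\<bar> \<le> \<epsilon> powr \<alpha> / 4"
      using ap[rule_format, OF Nm(1,2,5,6)] unfolding e' by blast
    with Nm(3,4,7) have "good \<epsilon> N (p + m) \<zeta> \<theta>" unfolding good_def by (intro conjI)
    thus ?thesis by blast
  qed
  then obtain N M \<zeta> \<theta> where gd: "\<And>\<epsilon>. 0 < \<epsilon> \<and> \<epsilon> \<le> exp (- 1) \<Longrightarrow> good \<epsilon> (N \<epsilon>) (M \<epsilon>) (\<zeta> \<epsilon>) (\<theta> \<epsilon>)" by metis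
  \<comment> \<open>The measured average y estimates the power sum divided by A, so rescaling,
    clipping and taking the root recover the distance classically.\<close>
  define Q where "Q n \<epsilon> = alg n (N \<epsilon>) (M \<epsilon>) (\<zeta> \<epsilon>) (\<theta> \<epsilon>) (\<lambda>y. 1/2 * max 0 (A * y) powr (1/\<alpha>))" for n \<epsilon>
  have main: "valid_algorithm n (Q n \<epsilon>) \<and> estimates_l_distance \<alpha> n \<epsilon> (Q n \<epsilon>) \<and>
       real (sample_count (Q n \<epsilon>)) \<le> 66 * K * R \<epsilon> \<and> real (gate_count (Q n \<epsilon>)) \<le> 66 * K * (real n * R \<epsilon>)"
    if e: "0 < \<epsilon>" "\<epsilon> \<le> exp (- 1)" and n: "1 \<le> n" for \<epsilon> n
  proof -
    let ?N = "N \<epsilon>" and ?M = "M \<epsilon>" and ?z = "\<zeta> \<epsilon>" and ?t = "\<theta> \<epsilon>"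
    have N: "1 \<le> ?N" "6 \<le> real ?N * (\<epsilon> powr \<alpha> / (2 * A))\<^sup>2" and NM: "real ?N * real (Suc ?M) \<le> K * R \<epsilon>"
      and z: "\<And>i. i < ?N \<Longrightarrow> cmod (?z i) = 1" and len: "\<And>i. i < ?N \<Longrightarrow> length (?t i) = ?M"
      and h: "\<And>x. \<bar>x\<bar> \<le> 1 \<Longrightarrow> \<bar>sgn x * \<bar>x\<bar> powr (\<alpha> - 1) - A * ((\<Sum>i<?N. Re (?z i * amp (?t i) x)) / real ?N)\<bar> \<le> \<epsilon> powr \<alpha> / 4"
      using gd[of \<epsilon>] e unfolding good_def by blast+
    have res: "valid_algorithm n (Q n \<epsilon>)" "sample_count (Q n \<epsilon>) = 4 * ?N * Suc ?M"
      "gate_count (Q n \<epsilon>) = 2 * ?N * (?M * (28 * n + 5) + 2)"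
      unfolding Q_def by (intro alg_resources z len; assumption)+
    have "estimates_l_distance \<alpha> n \<epsilon> (Q n \<epsilon>)"
      unfolding estimates_l_distance_def
    proof (intro allI impI)
      fix \<rho>0 \<rho>1 assume d: "density_mat (2 ^ n) \<rho>0" "density_mat (2 ^ n) \<rho>1"
      show "2/3 \<le> output_prob n (Q n \<epsilon>) \<rho>0 \<rho>1 (\<lambda>y. \<bar>y - l_distance \<alpha> \<rho>0 \<rho>1\<bar> \<le> \<epsilon>)"
      proof (rule density_spectral[OF d])
        fix l p q :: "nat \<Rightarrow> real"
        assume s: "\<And>i. i < 2 ^ n \<Longrightarrow> 0 \<le> p i" "\<And>i. i < 2 ^ n \<Longrightarrow> 0 \<le> q i" "\<And>i. i < 2 ^ n \<Longrightarrow> l i = p i - q i"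
          "(\<Sum>i<2 ^ n. p i) = 1" "(\<Sum>i<2 ^ n. q i) = 1"
          "\<And>a. l_distance a \<rho>0 \<rho>1 = 1/2 * (\<Sum>i<2 ^ n. \<bar>l i\<bar> powr a) powr (1/a)"
          "\<And>cs. (\<Sum>t<2 ^ n. cells_evolve n \<rho>0 \<rho>1 cs (\<lambda>x y. \<rho>0 $$ (x, y)) t t) =
            (\<Sum>i<2 ^ n. complex_of_real (p i) * amp (map cell_angle cs) (l i))"
          "\<And>cs. (\<Sum>t<2 ^ n. cells_evolve n \<rho>0 \<rho>1 cs (\<lambda>x y. \<rho>1 $$ (x, y)) t t) =
            (\<Sum>i<2 ^ n. complex_of_real (q i) * amp (map cell_angle cs) (l i))"
        show "2/3 \<le> output_prob n (Q n \<epsilon>) \<rho>0 \<rho>1 (\<lambda>y. \<bar>y - l_distance \<alpha> \<rho>0 \<rho>1\<bar> \<le> \<epsilon>)"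
          unfolding Q_def
        proof (rule alg_output[OF n N(1) z len _ N(2) d s(7,8,3)])
          fix y assume "\<bar>y - (\<Sum>k<2 ^ n. l k * ((\<Sum>i<?N. Re (?z i * amp (?t i) (l k))) / real ?N))\<bar> \<le> \<epsilon> powr \<alpha> / (2 * A)"
          thus "\<bar>1/2 * max 0 (A * y) powr (1/\<alpha>) - l_distance \<alpha> \<rho>0 \<rho>1\<bar> \<le> \<epsilon>"
            unfolding s(6) by (intro l_distance_estimate[where h = "\<lambda>x. (\<Sum>i<?N. Re (?z i * amp (?t i) x)) / real ?N",
              OF assms e(1) A _ s(4) _ s(5)] s(1-3) h)
        qed (use e A in auto)
      qed
    qed
    moreover have "real (sample_count (Q n \<epsilon>)) \<le> 66 * K * R \<epsilon>"
    proof -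
      have "real (sample_count (Q n \<epsilon>)) = 4 * (real ?N * real (Suc ?M))" unfolding res(2) by (simp add: algebra_simps)
      thus ?thesis using NM by linarith
    qed
    moreover have "real (gate_count (Q n \<epsilon>)) \<le> 66 * K * (real n * R \<epsilon>)"
    proof -
      \<comment> \<open>As n is positive, 28 n + 5 is at most 33 n, and the two gates outside the
        steps are covered by the extra 33 n from \<open>Suc ?M\<close>. With the 2N tests this gives
        66, which also exceeds the factor 4 for the samples.\<close>
      have "?M * (28 * n + 5) + 2 \<le> 33 * n * Suc ?M"
        by (simp add: algebra_simps) (use n mult_le_mono1[OF n, of "?M * 5"] in linarith)
      hence "gate_count (Q n \<epsilon>) \<le> 2 * ?N * (33 * n * Suc ?M)" unfolding res(3) by (rule mult_le_mono2)
      hence "real (gate_count (Q n \<epsilon>)) \<le> real (2 * ?N * (33 * n * Suc ?M))" by (rule of_nat_mono)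
      also have "\<dots> = 66 * real n * (real ?N * real (Suc ?M))" by (simp add: algebra_simps)
      also have "\<dots> \<le> 66 * real n * (K * R \<epsilon>)" by (intro mult_left_mono NM) auto
      finally show ?thesis by (simp add: mult_ac)
    qed
    ultimately show ?thesis using res(1) by blast
  qed
  have "\<forall>\<^sub>F \<epsilon> in at_right (0::real). 0 < \<epsilon> \<and> \<epsilon> \<le> exp (- 1)"
    unfolding eventually_at_right_field by (intro exI[of _ "exp (- 1)"]) auto
  hence "\<forall>\<^sub>F \<epsilon> in at_right (0::real). \<forall>n\<ge>1. valid_algorithm n (Q n \<epsilon>) \<and> estimates_l_distance \<alpha> n \<epsilon> (Q n \<epsilon>) \<and>
       real (sample_count (Q n \<epsilon>)) \<le> 66 * K * R \<epsilon> \<and> real (gate_count (Q n \<epsilon>)) \<le> 66 * K * (real n * R \<epsilon>)"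
    by (rule eventually_mono) (use main in blast)
  thus ?thesis using K unfolding R_def
    by (intro exI[of _ Q] exI[of _ "66 * K"]) simp
qed

end
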